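(* Algorithm $\mathcal{A}$ (described in the context) run with the neighboring function $\mathrm{neighbors}(B)=\bigcup_{v\in V(G)}\mathrm{neighbors}(B,v)$, where for $v\notin B$ $$\mathrm{neighbors}(B,v)=\{\mathrm{comp}(\mathrm{cc}_v(\{v\}\cup(B_i\setminus N(v))\cup B_{1-i}))\;:\;i=0,1\}$$ and $\mathrm{neighbors}(B,v)=\{B\}$ for $v\in B$, outputs all maximal connected induced bipartite subgraphs of $G$ without duplication, with $O(nm)$ delay.
   Context: $G$ is a simple undirected graph with vertices labeled $v_1,\dots,v_n$ and $m$ edges; isolated vertices are disregarded in the complexity analysis. A maximal connected induced bipartite subgraph is an inclusion-maximal $B\subseteq V(G)$ with $G[B]$ connected and bipartite; it is written $\langle B_0,B_1\rangle$ where $B_0,B_1$ are the two sides of its bipartition and $B_0$ contains the vertex of smallest label of $B$. $N(v)$ is the neighborhood of $v$; $\mathrm{cc}_v(A)$ is the vertex set of the connected component of $G[A]$ containing $v$. $\mathrm{comp}(A)$, for $A$ inducing a connected bipartite subgraph, returns a maximal connected induced bipartite subgraph containing $A$, obtained by repeatedly adding a vertex adjacent to the current set whose addition keeps the subgraph bipartite, until impossible. Algorithm $\mathcal{A}$: compute an arbitrary maximal solution $S_0$ and call $\mathrm{enum}(S_0)$ with an initially empty global set $\mathcal{S}$; $\mathrm{enum}(S)$ adds $S$ to $\mathcal{S}$, and for each $S'\in\mathrm{neighbors}(S)$ with $S'\notin\mathcal{S}$ calls $\mathrm{enum}(S')$; $S$ is output before the loop if the recursion depth is even and after the loop if it is odd.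 Delay is the maximum time before the first output, between consecutive outputs, and after the last output. *)

theory Defs
  imports "Graph_Theory.Digraph_Component" "Graph_Theory.Pair_Digraph"
begin

section \<open>Maximal connected induced bipartite subgraphs\<close>

text \<open>
  A simple undirected graph is a \<open>pair_graph\<close>: a finite loop-free symmetric digraph without
  parallel arcs. Vertices are natural numbers, the number being the label; the vertex with the
  i-th label is \<open>i - 1\<close>. An edge is a pair of opposite arcs and is counted once in \<open>edges\<close>.
  The library predicate \<open>connected\<close> is false for the graph without vertices.
\<close>

type_synonym ngraph = "nat pair_pre_digraph"

definition edges :: "ngraph \<Rightarrow> nat set set" where
  "edges G = {{u, v} | u v. (u, v) \<in> parcs G}"

definition nbhd :: "ngraph \<Rightarrow> nat \<Rightarrow> nat set" where
  "nbhd G v = {u. (v, u) \<in> parcs G}"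

definition bipartition :: "('a, 'b) pre_digraph \<Rightarrow> 'a set \<Rightarrow> 'a set \<Rightarrow> bool" where
  "bipartition H X Y \<longleftrightarrow> X \<union> Y = verts H \<and> X \<inter> Y = {} \<and>
     (\<forall>(u, v) \<in> arcs_ends H. u \<in> X \<and> v \<in> Y \<or> u \<in> Y \<and> v \<in> X)"

definition bipartite :: "('a, 'b) pre_digraph \<Rightarrow> bool" where
  "bipartite H \<longleftrightarrow> (\<exists>X Y. bipartition H X Y)"

definition conn_bip :: "ngraph \<Rightarrow> nat set \<Rightarrow> bool" where
  "conn_bip G B \<longleftrightarrow> B \<subseteq> pverts G \<and>
     Digraph_Component.connected (with_proj G \<restriction> B) \<and> bipartite (with_proj G \<restriction> B)"

definition max_conn_bip :: "ngraph \<Rightarrow> nat set set" where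
  "max_conn_bip G = {B. conn_bip G B \<and> (\<forall>B'. conn_bip G B' \<and> B \<subseteq> B' \<longrightarrow> B' = B)}"

text \<open>The bipartition \<open>\<langle>B\<^sub>0, B\<^sub>1\<rangle>\<close> of a connected bipartite \<open>G[B]\<close>; it is unique once the smallest
  label is required to be in \<open>B\<^sub>0\<close>.\<close>

definition sides :: "ngraph \<Rightarrow> nat set \<Rightarrow> nat set \<times> nat set" where
  "sides G B = (THE (X, Y). bipartition (with_proj G \<restriction> B) X Y \<and> Min B \<in> X)"

definition cc :: "ngraph \<Rightarrow> nat \<Rightarrow> nat set \<Rightarrow> nat set" where
  "cc G v A = {u. v \<rightarrow>\<^sup>*\<^bsub>with_proj G \<restriction> A\<^esub> u}"


section \<open>The enumeration algorithm\<close>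

definition grow :: "ngraph \<Rightarrow> nat set \<Rightarrow> nat set \<Rightarrow> bool" where
  "grow G A A' \<longleftrightarrow> (\<exists>v \<in> pverts G - A. nbhd G v \<inter> A \<noteq> {} \<and>
     bipartite (with_proj G \<restriction> insert v A) \<and> A' = insert v A)"

text \<open>The order in which \<open>comp\<close> adds vertices is left open: it is any function \<open>cmp\<close> whose value is
  the end of some greedy sequence. That this end is inclusion-maximal is not assumed.\<close>

definition comp_spec :: "ngraph \<Rightarrow> (nat set \<Rightarrow> nat set) \<Rightarrow> bool" where
  "comp_spec G cmp \<longleftrightarrow>
     (\<forall>A. conn_bip G A \<longrightarrow> (grow G)\<^sup>*\<^sup>* A (cmp A) \<and> (\<nexists>A'. grow G (cmp A) A'))"

definition neighbors_at :: "ngraph \<Rightarrow> (nat set \<Rightarrow> nat set) \<Rightarrow> nat set \<Rightarrow> nat \<Rightarrow> nat set set" where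
  "neighbors_at G cmp B v =
     (if v \<in> B then {B}
      else let (B0, B1) = sides G B in
        {cmp (cc G v ({v} \<union> (B0 - nbhd G v) \<union> B1)),
         cmp (cc G v ({v} \<union> (B1 - nbhd G v) \<union> B0))})"

definition neighbors :: "ngraph \<Rightarrow> (nat set \<Rightarrow> nat set) \<Rightarrow> nat set \<Rightarrow> nat set set" where
  "neighbors G cmp B = (\<Union>v \<in> pverts G. neighbors_at G cmp B v)"

text \<open>
  \<open>enum nbs d S \<S> \<S>' out\<close>: the call \<open>enum(S)\<close> at recursion depth \<open>d\<close>, started when the global set
  is \<open>\<S>\<close>, terminates with global set \<open>\<S>'\<close> and outputs the list \<open>out\<close>. The list \<open>nbs S\<close> gives the
  order (possibly with repetitions) in which the loop runs through the set of neighbors of \<open>S\<close>;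
  \<open>enum_loop\<close> is that loop, whose recursive calls are at depth \<open>d + 1\<close>.
\<close>

inductive enum :: "('s \<Rightarrow> 's list) \<Rightarrow> nat \<Rightarrow> 's \<Rightarrow> 's set \<Rightarrow> 's set \<Rightarrow> 's list \<Rightarrow> bool"
  and enum_loop :: "('s \<Rightarrow> 's list) \<Rightarrow> nat \<Rightarrow> 's list \<Rightarrow> 's set \<Rightarrow> 's set \<Rightarrow> 's list \<Rightarrow> bool"
  for nbs where
  enum: "enum_loop nbs d (nbs S) (insert S \<S>) \<S>' out \<Longrightarrow>
     enum nbs d S \<S> \<S>' (if even d then S # out else out @ [S])"
| loop_Nil: "enum_loop nbs d [] \<S> \<S> []"
| loop_old: "S' \<in> \<S> \<Longrightarrow> enum_loop nbs d Ns \<S> \<S>' out \<Longrightarrow> enum_loop nbs d (S' # Ns) \<S> \<S>' out"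
| loop_new: "S' \<notin> \<S> \<Longrightarrow> enum nbs (Suc d) S' \<S> \<S>1 out1 \<Longrightarrow> enum_loop nbs d Ns \<S>1 \<S>2 out2 \<Longrightarrow>
     enum_loop nbs d (S' # Ns) \<S> \<S>2 (out1 @ out2)"

definition alg_outputs :: "('s \<Rightarrow> 's list) \<Rightarrow> 's \<Rightarrow> 's list \<Rightarrow> bool" where
  "alg_outputs nbs S0 out \<longleftrightarrow> (\<exists>\<S>'. enum nbs 0 S0 {} \<S>' out)"

text \<open>The three choices the algorithm leaves open: the greedy order in \<open>comp\<close>, the order of the
  loop, and the first solution.\<close>

definition admissible ::
  "ngraph \<Rightarrow> (nat set \<Rightarrow> nat set) \<Rightarrow> (nat set \<Rightarrow> nat set list) \<Rightarrow> nat set \<Rightarrow> bool" where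
  "admissible G cmp nbs S0 \<longleftrightarrow> comp_spec G cmp \<and>
     (\<forall>B \<in> max_conn_bip G. set (nbs B) = neighbors G cmp B) \<and> S0 \<in> max_conn_bip G"


section \<open>Machine model\<close>

text \<open>
  Running time is measured on a uniform-cost random-access machine over natural numbers, with
  structured control flow. A program uses finitely many registers and finitely many zero-initialised
  arrays (\<open>Cell a e\<close> is entry \<open>e\<close> of array \<open>a\<close>; array names are constants, indices are computed). The
  only arithmetic is successor and truncated subtraction, so every number that occurs is at most
  the largest number in the input or the program plus the number of steps made, and unit cost
  cannot be exploited by operating on very long numbers.

  An execution is the list of its events, each taking one unit of time: \<open>Tick\<close> is an internal step,
  \<open>Out v\<close> prints the number \<open>v\<close>, and \<open>Done\<close> completes the current output item.
\<close>

datatype expr =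
    Const nat
  | Reg nat
  | Cell nat expr
  | Succ expr
  | Minus expr expr

datatype prog =
    Skip
  | Assign nat expr
  | Store nat expr expr
  | Print expr
  | Finish
  | Seq prog prog
  | Cond expr prog prog
  | While expr prog

datatype event = Tick | Out nat | Done

record machine =
  regs :: "nat \<Rightarrow> nat"
  mem :: "nat \<Rightarrow> nat \<Rightarrow> nat"

primrec eval :: "machine \<Rightarrow> expr \<Rightarrow> nat" where
  "eval s (Const k) = k"
| "eval s (Reg x) = regs s x"
| "eval s (Cell a e) = mem s a (eval s e)"
| "eval s (Succ e) = Suc (eval s e)"
| "eval s (Minus e f) = eval s e - eval s f"

primrec cost :: "expr \<Rightarrow> nat" where
  "cost (Const k) = 1"
| "cost (Reg x) = 1"
| "cost (Cell a e) = Suc (cost e)"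
| "cost (Succ e) = Suc (cost e)"
| "cost (Minus e f) = Suc (cost e + cost f)"

abbreviation ticks :: "nat \<Rightarrow> event list" where
  "ticks k \<equiv> replicate k Tick"

text \<open>\<open>Cond\<close> and \<open>While\<close> test whether the value of the expression is nonzero.\<close>

inductive exec :: "prog \<Rightarrow> machine \<Rightarrow> event list \<Rightarrow> machine \<Rightarrow> bool" where
  "exec Skip s (ticks 1) s"
| "exec (Assign x e) s (ticks (Suc (cost e))) (s\<lparr>regs := (regs s)(x := eval s e)\<rparr>)"
| "exec (Store a i e) s (ticks (Suc (cost i + cost e)))
     (s\<lparr>mem := (mem s)(a := (mem s a)(eval s i := eval s e))\<rparr>)"
| "exec (Print e) s (ticks (cost e) @ [Out (eval s e)]) s"
| "exec Finish s [Done] s"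
| "exec p s tr s' \<Longrightarrow> exec q s' tr' s'' \<Longrightarrow> exec (Seq p q) s (tr @ tr') s''"
| "eval s e \<noteq> 0 \<Longrightarrow> exec p s tr s' \<Longrightarrow> exec (Cond e p q) s (ticks (Suc (cost e)) @ tr) s'"
| "eval s e = 0 \<Longrightarrow> exec q s tr s' \<Longrightarrow> exec (Cond e p q) s (ticks (Suc (cost e)) @ tr) s'"
| "eval s e = 0 \<Longrightarrow> exec (While e p) s (ticks (Suc (cost e))) s"
| "eval s e \<noteq> 0 \<Longrightarrow> exec p s tr s' \<Longrightarrow> exec (While e p) s' tr' s'' \<Longrightarrow>
     exec (While e p) s (ticks (Suc (cost e)) @ tr @ tr') s''"

text \<open>\<open>periods\<close> cuts an execution after each \<open>Done\<close>: before the first output, between consecutive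
  outputs, and (the last, possibly empty, piece) after the last output.\<close>

fun periods :: "event list \<Rightarrow> event list list" where
  "periods [] = [[]]"
| "periods (Done # es) = [Done] # periods es"
| "periods (e # es) = (case periods es of b # bs \<Rightarrow> (e # b) # bs)"

definition outputs :: "event list \<Rightarrow> nat set list" where
  "outputs tr = map (\<lambda>b. {v. Out v \<in> set b}) (butlast (periods tr))"

definition delay :: "event list \<Rightarrow> nat" where
  "delay tr = Max (length ` set (periods tr))"

text \<open>The input is given by adjacency lists, in any order: register 0 holds the number of vertices,
  array 1 the concatenation of the lists, and the list of \<open>v\<close> occupies the positions of array 1 from
  \<open>mem 0 v\<close> (inclusive) to \<open>mem 0 (v + 1)\<close> (exclusive). Everything else is zero.\<close>

definition adjacency_lists :: "ngraph \<Rightarrow> nat list list \<Rightarrow> bool" where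
  "adjacency_lists G adj \<longleftrightarrow> pverts G = {..<length adj} \<and>
     (\<forall>v < length adj. distinct (adj ! v) \<and> set (adj ! v) = nbhd G v)"

definition input :: "nat list list \<Rightarrow> machine" where
  "input adj =
     \<lparr>regs = (\<lambda>_. 0)(0 := length adj),
      mem = (\<lambda>_ _. 0)
        (0 := \<lambda>v. if v \<le> length adj then length (concat (take v adj)) else 0,
         1 := \<lambda>i. if i < length (concat adj) then concat adj ! i else 0)\<rparr>"

end

theory Submission
  imports Defs
begin

text \<open>
  Let \<open>C\<close> be a connected subset of \<open>B \<inter> T\<close> for solutions \<open>B \<noteq> T\<close>, and \<open>v \<in> T - C\<close> a neighbour of \<open>C\<close>
  (any \<open>v \<in> T\<close> if \<open>C\<close> is empty). If \<open>v \<in> B\<close>, then \<open>C\<close> can be enlarged by \<open>v\<close>. Otherwise \<open>v\<close> has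
  neighbours in at most one side of the 2-colouring of \<open>C\<close>, which is the one induced by \<open>B\<close>, so one of
  the two neighbours of \<open>B\<close> at \<open>v\<close> contains \<open>C \<union> {v}\<close>. Hence every solution is reachable from every
  other, and the depth-first search outputs each of them once.

  For the delay, one neighbour is computed in time \<open>O(n + m)\<close>: two greedy searches that mark the
  neighbourhoods of both colour classes give \<open>cc\<close> and \<open>comp\<close>, and a trie of 0-1 words of length \<open>n\<close>
  tells whether the result is new. The recursion is run on an explicit stack of trie leaves, the
  solution of the top frame and its colouring being recomputed in every iteration. A call thus spends
  \<open>O(n (n + m)) = O(nm)\<close> time of its own if there are no isolated vertices, and since outputs
  alternate between the beginning and the end of a call, only a bounded number of calls contribute to a period.
\<close>


section \<open>The solution graph\<close>

text \<open>\<open>cmp\<close> and \<open>nbs\<close> have to be functions of vertex sets, while the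
  machine works with colourings, flags and a queue. Its search is therefore mirrored by
  \<open>greedy\<close>, whose result depends on the allowed set, the start set and the initial
  queue alone. Colours enter only through the fact that a connected set has one 2-colouring up to a
  swap, so that two neighbourhood flags decide whether a vertex fits.

  The machine is not checked against the set of all solutions. Its main loop is matched with a
  derivation of \<open>enum\<close> for its particular choice of \<open>cmp\<close>,
  \<open>nbs\<close> and \<open>S0\<close>. That such a derivation exists, and what it outputs, is
  known from the correctness result for arbitrary choices, so termination and completeness of the
  program carry over and only time remains to be counted.

  A stretch without output spans at most two complete loops of \<open>2 * n\<close> iterations, one
  of a call at even depth and one of a call at odd depth; this is the origin of the factor
  \<open>4 * n\<close> in the gap bounds.\<close>

abbreviation con :: "ngraph \<Rightarrow> nat set \<Rightarrow> bool" where
  "con G B \<equiv> Digraph_Component.connected (with_proj G \<restriction> B)"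

abbreviation bip :: "ngraph \<Rightarrow> nat set \<Rightarrow> nat set \<Rightarrow> nat set \<Rightarrow> bool" where
  "bip G B X Y \<equiv> bipartition (with_proj G \<restriction> B) X Y"

section \<open>Induced subgraphs in terms of the arcs of the whole graph\<close>

lemma arcs_ends_induce: "arcs_ends (with_proj G \<restriction> B) = {(u, v) \<in> parcs G. u \<in> B \<and> v \<in> B}"
  by (auto simp: arcs_ends_def arc_to_ends_def)

lemma bip_iff:
  "bip G B X Y \<longleftrightarrow> X \<union> Y = B \<and> X \<inter> Y = {} \<and>
     (\<forall>u v. (u, v) \<in> parcs G \<longrightarrow> \<not> (u \<in> X \<and> v \<in> X) \<and> \<not> (u \<in> Y \<and> v \<in> Y))"
  by (auto simp: bipartition_def arcs_ends_induce)

lemma bip_swap: "bip G B X Y \<Longrightarrow> bip G B Y X"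
  by (auto simp: bip_iff)

lemma bip_subset: "bip G B X Y \<Longrightarrow> C \<subseteq> B \<Longrightarrow> bip G C (X \<inter> C) (Y \<inter> C)"
  by (auto simp: bip_iff)

lemma bipartite_subset:
  fixes G :: ngraph
  shows "bipartite (with_proj G \<restriction> B) \<Longrightarrow> C \<subseteq> B \<Longrightarrow> bipartite (with_proj G \<restriction> C)"
  unfolding bipartite_def using bip_subset[of G B _ _ C] by fast

lemma rtrancl_on_subset: "(u, v) \<in> rtrancl_on F r \<Longrightarrow> F \<subseteq> F' \<Longrightarrow> (u, v) \<in> rtrancl_on F' r"
  by (rule rtrancl_on_mono[OF order_refl])

text \<open>A path whose vertices all lie in \<open>A\<close> uses only arcs inside
  \<open>A\<close>, so paths of the induced subgraph are \<open>rtrancl_on A\<close> paths of the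
  whole graph.\<close>

lemma cc_eq: "cc G v A = {u. (v, u) \<in> rtrancl_on A (parcs G)}"
proof -
  have "(v, u) \<in> rtrancl_on A (parcs G)"
    if "(v, u) \<in> rtrancl_on A {(u, v) \<in> parcs G. u \<in> A \<and> v \<in> A}" for u
    by (rule rtrancl_on_mono[OF _ order_refl that]) auto
  moreover have "(v, u) \<in> rtrancl_on A {(u, v) \<in> parcs G. u \<in> A \<and> v \<in> A}"
    if "(v, u) \<in> rtrancl_on A (parcs G)" for u
    using that by (induct rule: rtrancl_on_induct) (auto intro: rtrancl_on_into_rtrancl_on)
  ultimately show ?thesis
    by (auto simp: cc_def reachable_def arcs_ends_induce)
qed

locale labelled_graph = pair_graph G for G :: ngraph
begin

lemma arc_sym: "(u, v) \<in> parcs G \<Longrightarrow> (v, u) \<in> parcs G"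
  using pair_sym_arcs unfolding symmetric_def sym_def with_proj_simps by simp

lemma arc_irrefl: "(v, v) \<notin> parcs G"
  using pair_no_loops[of "(v, v)"] by auto

lemma nbhd_sym: "u \<in> nbhd G v \<longleftrightarrow> v \<in> nbhd G u"
  unfolding nbhd_def using arc_sym by blast

lemma bip_insert:
  assumes "bip G Z X Y" "w \<notin> Z" "nbhd G w \<inter> X = {}"
  shows "bip G (insert w Z) (insert w X) Y"
proof -
  have "(u, w) \<notin> parcs G" "(w, u) \<notin> parcs G" if "u \<in> X" for u
    using assms(3) that nbhd_sym[of u w] by (auto simp: nbhd_def)
  then show ?thesis using assms(1,2) arc_irrefl unfolding bip_iff by auto
qed

section \<open>Connectivity and uniqueness of 2-colourings\<close>

lemma rtrancl_on_arc_sym: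
  "(u, v) \<in> rtrancl_on F (parcs G) \<Longrightarrow> (v, u) \<in> rtrancl_on F (parcs G)"
  by (rule symD[OF rtrancl_on_sym]) (metis arc_sym symI)

text \<open>The library defines connectivity as strong connectivity of the symmetric closure; the
  arcs here are symmetric already, so the closure adds none.\<close>

lemma con_iff: "con G B \<longleftrightarrow> B \<noteq> {} \<and> (\<forall>u\<in>B. \<forall>v\<in>B. (u, v) \<in> rtrancl_on B (parcs G))"
proof -
  have "arcs_ends (with_proj (mk_symmetric (with_proj G \<restriction> B))) = {(u, v) \<in> parcs G. u \<in> B \<and> v \<in> B}"
  proof -
    have "arcs_ends (with_proj (mk_symmetric (with_proj G \<restriction> B))) =
        {(u, v) \<in> parcs G. u \<in> B \<and> v \<in> B} \<union> {(v, u) | u v. (u, v) \<in> parcs G \<and> u \<in> B \<and> v \<in> B}"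
      unfolding with_proj_simps mk_symmetric_def by auto
    then show ?thesis using arc_sym by blast
  qed
  moreover have "(u, v) \<in> rtrancl_on B {(u, v) \<in> parcs G. u \<in> B \<and> v \<in> B} \<longleftrightarrow>
      (u, v) \<in> rtrancl_on B (parcs G)" for u v
    using cc_eq[of G u B] unfolding cc_def reachable_def arcs_ends_induce by auto
  moreover have "verts (with_proj (mk_symmetric (with_proj G \<restriction> B))) = B"
    by (simp add: mk_symmetric_def)
  ultimately show ?thesis
    by (simp only: Digraph_Component.connected_def strongly_connected_def reachable_def)
qed

lemma con_from_root:
  assumes "r \<in> B" "\<And>u. u \<in> B \<Longrightarrow> (r, u) \<in> rtrancl_on B (parcs G)"
  shows "con G B"
  unfolding con_iff
  using assms(1) rtrancl_on_trans[OF rtrancl_on_arc_sym[OF assms(2)] assms(2)] by auto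

lemma con_singleton: "con G {v}"
  by (rule con_from_root[of v]) auto

lemma con_insert:
  assumes "con G Z" "w \<in> nbhd G z" "z \<in> Z"
  shows "con G (insert w Z)"
proof (rule con_from_root[of z])
  fix u assume "u \<in> insert w Z"
  moreover have "(z, u) \<in> rtrancl_on (insert w Z) (parcs G)" if "u \<in> Z" for u
    using assms that by (intro rtrancl_on_subset[OF _ subset_insertI[of Z w]]) (simp add: con_iff)
  moreover have "(z, w) \<in> rtrancl_on (insert w Z) (parcs G)"
    by (rule rtrancl_on_into_rtrancl_on[of z z]) (use assms in \<open>auto simp: nbhd_def\<close>)
  ultimately show "(z, u) \<in> rtrancl_on (insert w Z) (parcs G)" by auto
qed (use assms in auto)

text \<open>A path in \<open>B\<close> from a vertex of \<open>C\<close> to one outside must leave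
  \<open>C\<close> somewhere. Most later uses of connectivity go through this form.\<close>

lemma boundary_vertex:
  assumes "con G B" "C \<subseteq> B" "C \<noteq> {}" "C \<noteq> B"
  obtains c v where "c \<in> C" "v \<in> B - C" "v \<in> nbhd G c"
proof -
  obtain c b where cb: "c \<in> C" "b \<in> B" "b \<notin> C" using assms by auto
  then have "(c, b) \<in> rtrancl_on B (parcs G)" using assms unfolding con_iff by auto
  then have "b \<notin> C \<longrightarrow> (\<exists>c\<in>C. \<exists>v\<in>B - C. v \<in> nbhd G c)"
  proof (induct rule: rtrancl_on_induct)
    case base then show ?case using cb by simp
  next
    case (step y z) then show ?case by (auto simp: nbhd_def)
  qed
  then show thesis using cb that by auto
qed

text \<open>Every vertex on a path from \<open>v\<close> inside \<open>A\<close> is itself reachable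
  from \<open>v\<close>, so the path stays inside the component and witnesses its
  connectivity.\<close>

lemma con_cc:
  assumes "v \<in> A"
  shows "con G (cc G v A)" "v \<in> cc G v A" "cc G v A \<subseteq> A"
proof -
  show v: "v \<in> cc G v A" using assms by (simp add: cc_eq)
  show "cc G v A \<subseteq> A" by (auto simp: cc_eq dest: in_rtrancl_on_in_F)
  show "con G (cc G v A)"
  proof (rule con_from_root[OF v])
    fix u assume "u \<in> cc G v A"
    then have "(v, u) \<in> rtrancl_on A (parcs G)" by (simp add: cc_eq)
    then show "(v, u) \<in> rtrancl_on (cc G v A) (parcs G)"
    proof (induct rule: rtrancl_on_induct)
      case base then show ?case using v by simp
    next
      case (step y z)
      then have "z \<in> cc G v A" using rtrancl_on_into_rtrancl_on[of v y A "parcs G" z] by (simp add: cc_eq)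
      then show ?case using step rtrancl_on_into_rtrancl_on by metis
    qed
  qed
qed

lemma con_subset_cc:
  assumes "con G C" "v \<in> C" "C \<subseteq> A"
  shows "C \<subseteq> cc G v A"
  using assms rtrancl_on_subset[of v _ C "parcs G" A] unfolding con_iff cc_eq by auto

text \<open>Otherwise a boundary vertex of \<open>Z\<close> within the component would contradict
  closure. This identifies the result of a search with \<open>cc\<close> without talking about
  paths.\<close>

lemma cc_unique:
  assumes "v \<in> A" "con G Z" "v \<in> Z" "Z \<subseteq> A" "\<And>z u. z \<in> Z \<Longrightarrow> u \<in> nbhd G z \<Longrightarrow> u \<in> A \<Longrightarrow> u \<in> Z"
  shows "Z = cc G v A"
proof (rule ccontr)
  assume "Z \<noteq> cc G v A"
  moreover have "Z \<subseteq> cc G v A" using con_subset_cc assms by auto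
  moreover have "Z \<noteq> {}" using assms(3) by auto
  ultimately obtain c u where "c \<in> Z" "u \<in> cc G v A - Z" "u \<in> nbhd G c"
    using boundary_vertex[OF con_cc(1)[OF assms(1)], of Z] by metis
  then show False using assms(5)[of c u] con_cc(3)[OF assms(1)] by auto
qed

text \<open>Colours alternate along every path, so agreement at \<open>a\<close> spreads to all of
  the connected set.\<close>

lemma bip_unique:
  assumes "con G B" "bip G B X Y" "bip G B X' Y'" "a \<in> X" "a \<in> X'"
  shows "X' = X" "Y' = Y"
proof -
  have "(u \<in> X') = (u \<in> X)" if "u \<in> B" for u
  proof -
    have "(a, u) \<in> rtrancl_on B (parcs G)" using assms that by (auto simp: con_iff bip_iff)
    then show ?thesis
    proof (induct rule: rtrancl_on_induct)
      case base then show ?case using assms by simp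
    next
      case (step y z)
      have "(z \<in> X) = (y \<notin> X)" using assms(2) step unfolding bip_iff by blast
      moreover have "(z \<in> X') = (y \<notin> X')" using assms(3) step unfolding bip_iff by blast
      ultimately show ?case using step by simp
    qed
  qed
  moreover have "X \<union> Y = B" "X \<inter> Y = {}" "X' \<union> Y' = B" "X' \<inter> Y' = {}"
    using assms(2,3) unfolding bip_iff by simp_all
  ultimately show "X' = X" "Y' = Y" by blast+
qed

text \<open>A 2-colouring of the larger set restricts to one of \<open>Z\<close>, which connectivity
  forces to be \<open>X\<close>, \<open>Y\<close> or its swap; the class of \<open>w\<close> then
  contains no neighbour of \<open>w\<close>. The four cases say which classes of the two colourings
  share the vertex \<open>a\<close>.\<close>

lemma bipartite_insert_iff:
  assumes "con G Z" "bip G Z X Y" "w \<notin> Z"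
  shows "bipartite (with_proj G \<restriction> insert w Z) \<longleftrightarrow> nbhd G w \<inter> X = {} \<or> nbhd G w \<inter> Y = {}"
proof
  assume "bipartite (with_proj G \<restriction> insert w Z)"
  then obtain X' Y' where XY': "bip G (insert w Z) X' Y'" "w \<in> X'"
    unfolding bipartite_def using bip_swap by (metis UnE bip_iff insertI1)
  then have n: "nbhd G w \<inter> X' = {}" by (auto simp: bip_iff nbhd_def)
  have b: "bip G Z (X' \<inter> Z) (Y' \<inter> Z)" using bip_subset[OF XY'(1)] by auto
  obtain a where a: "a \<in> Z" using assms(1) by (auto simp: con_iff)
  consider "a \<in> X \<inter> X'" | "a \<in> Y \<inter> Y'" | "a \<in> Y \<inter> X'" | "a \<in> X \<inter> Y'"
    using a b assms(2) by (auto simp: bip_iff)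
  then show "nbhd G w \<inter> X = {} \<or> nbhd G w \<inter> Y = {}"
  proof cases
    case 1 then show ?thesis using bip_unique(1)[OF assms(1) assms(2) b, of a] a n by auto
  next
    case 2 then show ?thesis using bip_unique(2)[OF assms(1) bip_swap[OF assms(2)] bip_swap[OF b], of a] a n by auto
  next
    case 3 then show ?thesis using bip_unique(1)[OF assms(1) bip_swap[OF assms(2)] b, of a] a n by auto
  next
    case 4 then show ?thesis using bip_unique(2)[OF assms(1) assms(2) bip_swap[OF b], of a] a n by auto
  qed
next
  assume "nbhd G w \<inter> X = {} \<or> nbhd G w \<inter> Y = {}"
  then have "bip G (insert w Z) (insert w X) Y \<or> bip G (insert w Z) (insert w Y) X"
    using bip_insert assms(2,3) bip_swap by metis
  then show "bipartite (with_proj G \<restriction> insert w Z)" by (auto simp: bipartite_def)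
qed

section \<open>Greedy extension ends in a maximal solution\<close>

lemma conn_bip_insert:
  "conn_bip G Z \<Longrightarrow> w \<in> nbhd G z \<Longrightarrow> z \<in> Z \<Longrightarrow> bipartite (with_proj G \<restriction> insert w Z) \<Longrightarrow>
    conn_bip G (insert w Z)"
  unfolding conn_bip_def using con_insert[of Z w z] in_arcsD2[of z w] by (auto simp: nbhd_def)

lemma grow_conn_bip:
  assumes "grow G A A'" "conn_bip G A"
  shows "conn_bip G A'"
proof -
  obtain v z where "z \<in> nbhd G v" "z \<in> A" "bipartite (with_proj G \<restriction> insert v A)" "A' = insert v A"
    using assms(1) unfolding grow_def by auto
  then show ?thesis using conn_bip_insert[OF assms(2), of v z] nbhd_sym by simp
qed

lemma conn_bip_singleton:
  assumes "v \<in> pverts G"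
  shows "conn_bip G {v}"
proof -
  have "bip G {} {} {}" unfolding bip_iff by simp
  then have "bip G {v} {v} {}" using bip_insert[of "{}" "{}" "{}" v] by simp
  then show ?thesis using assms con_singleton[of v] unfolding conn_bip_def bipartite_def by blast
qed

lemma finite_conn_bip: "conn_bip G B \<Longrightarrow> finite B"
  unfolding conn_bip_def using finite_subset[OF _ pair_finite_verts] by auto

lemma finite_max_conn_bip: "finite (max_conn_bip G)"
  by (rule finite_subset[of _ "Pow (pverts G)"])
    (use pair_finite_verts in \<open>auto simp: max_conn_bip_def conn_bip_def\<close>)

text \<open>This supplies the maximality that \<open>comp_spec\<close> leaves open: a larger
  solution \<open>B\<close> has a vertex outside \<open>A\<close> adjacent to \<open>A\<close>, and
  adding it keeps bipartiteness because subsets of \<open>B\<close> inherit it.\<close>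

lemma ungrowable_maximal:
  assumes "conn_bip G A" "\<nexists>A'. grow G A A'"
  shows "A \<in> max_conn_bip G"
proof -
  have "B = A" if "conn_bip G B" "A \<subseteq> B" for B
  proof (rule ccontr)
    assume "B \<noteq> A"
    moreover have "con G B" "A \<noteq> {}"
      using that assms(1) by (auto simp: conn_bip_def con_iff)
    ultimately obtain c v where cv: "c \<in> A" "v \<in> B - A" "v \<in> nbhd G c"
      using boundary_vertex[of B A] \<open>A \<subseteq> B\<close> by metis
    then have "grow G A (insert v A)"
      using that bipartite_subset[of G B "insert v A"] arc_sym[of c v]
      by (auto simp: grow_def conn_bip_def nbhd_def in_arcsD2 intro!: bexI[of _ v])
    then show False using assms by blast
  qed
  then show ?thesis using assms by (auto simp: max_conn_bip_def)
qed

lemma comp_maximal: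
  assumes "comp_spec G cmp" "conn_bip G A"
  shows "cmp A \<in> max_conn_bip G" "A \<subseteq> cmp A"
proof -
  have g: "(grow G)\<^sup>*\<^sup>* A (cmp A)" "\<nexists>A'. grow G (cmp A) A'"
    using assms(1)[unfolded comp_spec_def, rule_format, OF assms(2)] by blast+
  from g(1) have "conn_bip G (cmp A) \<and> A \<subseteq> cmp A"
  proof (induct rule: rtranclp_induct)
    case base then show ?case using assms(2) by simp
  next
    case (step B C)
    moreover have "B \<subseteq> C" using step(2) by (auto simp: grow_def)
    ultimately show ?case using grow_conn_bip[OF step(2)] by auto
  qed
  then show "cmp A \<in> max_conn_bip G" "A \<subseteq> cmp A"
    using ungrowable_maximal g(2) by auto
qed

section \<open>The neighbouring function and reachability of all solutions\<close>

lemma sides_eq: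
  assumes "conn_bip G B" "bip G B X Y" "Min B \<in> X"
  shows "sides G B = (X, Y)"
  unfolding sides_def
proof (rule the_equality)
  fix p assume p: "case p of (X, Y) \<Rightarrow> bip G B X Y \<and> Min B \<in> X"
  have "con G B" using assms(1) by (simp add: conn_bip_def)
  then show "p = (X, Y)"
    using bip_unique[OF _ assms(2) _ assms(3), of "fst p" "snd p"] p by (simp add: prod_eq_iff split: prod.splits)
qed (use assms in simp)

lemma sides_bip:
  assumes "conn_bip G B"
  shows "bip G B (fst (sides G B)) (snd (sides G B))"
proof -
  obtain X Y where XY: "bip G B X Y" using assms by (auto simp: conn_bip_def bipartite_def)
  have "B \<noteq> {}" using assms by (simp add: conn_bip_def con_iff)
  then have "Min B \<in> B" using finite_conn_bip[OF assms] by simp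
  then have "Min B \<in> X \<union> Y" using XY by (simp add: bip_iff)
  then consider "Min B \<in> X" | "Min B \<in> Y" by blast
  then show ?thesis
  proof cases
    case 1 then show ?thesis using sides_eq[OF assms XY] XY by simp
  next
    case 2 then show ?thesis using sides_eq[OF assms bip_swap[OF XY]] bip_swap[OF XY] by simp
  qed
qed

definition cand :: "nat set \<Rightarrow> nat set \<Rightarrow> nat \<Rightarrow> nat set" where
  "cand X Y v = {v} \<union> (X - nbhd G v) \<union> Y"

text \<open>\<open>Y\<close> may contain neighbours of \<open>v\<close>, so \<open>v\<close> joins the side \<open>X\<close>.\<close>

lemma bipartite_cand:
  assumes "bip G B X Y" "v \<notin> B"
  shows "bipartite (with_proj G \<restriction> cand X Y v)"
proof -
  have "bip G (X - nbhd G v \<union> Y) (X - nbhd G v) Y"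
    using assms(1) by (auto simp: bip_iff)
  moreover have "v \<notin> X - nbhd G v \<union> Y" using assms by (auto simp: bip_iff)
  ultimately have "bip G (cand X Y v) (insert v (X - nbhd G v)) Y"
    using bip_insert unfolding cand_def by fastforce
  then show ?thesis by (auto simp: bipartite_def)
qed

lemma conn_bip_cc_cand:
  assumes "conn_bip G B" "bip G B X Y" "v \<in> pverts G" "v \<notin> B"
  shows "conn_bip G (cc G v (cand X Y v))"
proof -
  have "cand X Y v \<subseteq> pverts G" using assms by (auto simp: cand_def bip_iff conn_bip_def)
  moreover have "v \<in> cand X Y v" by (simp add: cand_def)
  ultimately show ?thesis
    unfolding conn_bip_def
    using con_cc[of v "cand X Y v"] bipartite_cand[OF assms(2,4)] bipartite_subset by blast
qed

lemma neighbors_at_eq: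
  assumes "sides G B = (X, Y)" "v \<notin> B"
  shows "neighbors_at G cmp B v = {cmp (cc G v (cand X Y v)), cmp (cc G v (cand Y X v))}"
  using assms by (simp add: neighbors_at_def cand_def)

lemma neighbors_maximal:
  assumes "comp_spec G cmp" "B \<in> max_conn_bip G"
  shows "neighbors G cmp B \<subseteq> max_conn_bip G"
proof -
  have B: "conn_bip G B" using assms by (simp add: max_conn_bip_def)
  obtain X Y where s: "sides G B = (X, Y)" by fastforce
  then have b: "bip G B X Y" using sides_bip[OF B] by simp
  have "neighbors_at G cmp B v \<subseteq> max_conn_bip G" if "v \<in> pverts G" for v
  proof (cases "v \<in> B")
    case True then show ?thesis using assms by (simp add: neighbors_at_def)
  next
    case False
    then show ?thesis
      using neighbors_at_eq[OF s] comp_maximal(1)[OF assms(1)]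
        conn_bip_cc_cand[OF B b that] conn_bip_cc_cand[OF B bip_swap[OF b] that] by auto
  qed
  then show ?thesis by (auto simp: neighbors_def)
qed

lemma neighbor_extends:
  assumes "comp_spec G cmp" "B \<in> max_conn_bip G" "v \<in> pverts G" "v \<notin> B"
    and C: "C \<subseteq> B" "conn_bip G (insert v C)" "C = {} \<or> con G C"
  obtains S where "S \<in> neighbors G cmp B" "insert v C \<subseteq> S"
proof -
  have B: "conn_bip G B" using assms by (simp add: max_conn_bip_def)
  obtain X Y where s: "sides G B = (X, Y)" by fastforce
  then have b: "bip G B X Y" using sides_bip[OF B] by simp
  have "nbhd G v \<inter> (X \<inter> C) = {} \<or> nbhd G v \<inter> (Y \<inter> C) = {}"
  proof (cases "C = {}")
    case False
    then show ?thesis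
      using bipartite_insert_iff[of C "X \<inter> C" "Y \<inter> C" v] C assms(4) bip_subset[OF b C(1)]
      by (auto simp: conn_bip_def)
  qed simp
  \<comment> \<open>\<open>cand X Y v\<close> removes from \<open>B\<close> only the neighbours of
    \<open>v\<close> in \<open>X\<close>, so if \<open>C\<close> contains none of these it survives;
    the other case is symmetric.\<close>
  then have "insert v C \<subseteq> cand X Y v \<or> insert v C \<subseteq> cand Y X v"
    using C(1) b by (auto simp: cand_def bip_iff)
  then have "insert v C \<subseteq> cc G v (cand X Y v) \<or> insert v C \<subseteq> cc G v (cand Y X v)"
    using con_subset_cc[of "insert v C" v] C(2) by (auto simp: conn_bip_def)
  then have "insert v C \<subseteq> cmp (cc G v (cand X Y v)) \<or> insert v C \<subseteq> cmp (cc G v (cand Y X v))"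
    using comp_maximal(2)[OF assms(1)] conn_bip_cc_cand[OF B b assms(3,4)]
      conn_bip_cc_cand[OF B bip_swap[OF b] assms(3,4)] by blast
  moreover have "cmp (cc G v (cand X Y v)) \<in> neighbors G cmp B"
    "cmp (cc G v (cand Y X v)) \<in> neighbors G cmp B"
    using neighbors_at_eq[OF s assms(4)] assms(3) by (auto simp: neighbors_def)
  ultimately show thesis using that by blast
qed

text \<open>Induction on the number of vertices of \<open>T\<close> missing from a connected common part \<open>C\<close>.\<close>

lemma neighbors_reach:
  assumes "comp_spec G cmp" "T \<in> max_conn_bip G"
    and closed: "\<And>B. B \<in> M \<Longrightarrow> neighbors G cmp B \<subseteq> M"
    and B: "B \<in> M" "M \<subseteq> max_conn_bip G" and C: "C \<subseteq> B \<inter> T" "C = {} \<or> con G C"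
  shows "T \<in> M"
  using B(1) C
proof (induct "card (T - C)" arbitrary: B C rule: less_induct)
  case less
  have T: "conn_bip G T" using assms(2) by (simp add: max_conn_bip_def)
  show ?case
  proof (cases "C = T")
    case True
    then have "B = T" using less.prems assms(2) B(2) by (auto simp: max_conn_bip_def)
    then show ?thesis using less.prems by simp
  next
    case False
    obtain v where v: "v \<in> T - C" "con G (insert v C)"
    proof (cases "C = {}")
      case True
      then show thesis using that con_singleton False by auto
    next
      case neq: False
      obtain c v where "c \<in> C" "v \<in> T - C" "v \<in> nbhd G c"
        using boundary_vertex[of T C] T False neq less.prems unfolding conn_bip_def by (metis le_inf_iff)
      then show thesis using that con_insert neq less.prems by blast
    qed
    have sm: "card (T - insert v C) < card (T - C)"
      using v finite_conn_bip[OF T] by (intro psubset_card_mono) auto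
    show ?thesis
    proof (cases "v \<in> B")
      case True
      then show ?thesis using less.hyps[OF sm, of B] less.prems v by auto
    next
      case nv: False
      have vv: "v \<in> pverts G" using v T by (auto simp: conn_bip_def)
      have "insert v C \<subseteq> T" using less.prems v by auto
      then have "conn_bip G (insert v C)"
        using v T bipartite_subset[of G T "insert v C"] by (auto simp: conn_bip_def)
      then obtain S where "S \<in> neighbors G cmp B" "insert v C \<subseteq> S"
        using neighbor_extends[OF assms(1) _ vv nv, of C] less.prems B(2) by auto
      then show ?thesis
        using less.hyps[OF sm, of S] closed[OF less.prems(1)] v \<open>insert v C \<subseteq> T\<close> by auto
    qed
  qed
qed

end


section \<open>Depth-first enumeration\<close>

text \<open>The set grows by exactly the solutions that are output, and only by new ones, which
  excludes duplicates. The last clause makes the final set closed under neighbours: every solution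
  output has run its whole loop.\<close>

lemma enum_properties:
  "enum nbs d S \<S> \<S>' out \<Longrightarrow> S \<notin> \<S> \<Longrightarrow>
     \<S>' = \<S> \<union> set out \<and> set out \<inter> \<S> = {} \<and> distinct out \<and> S \<in> set out \<and>
     (\<forall>B\<in>set out. set (nbs B) \<subseteq> \<S>')"
  "enum_loop nbs d Ns \<S> \<S>' out \<Longrightarrow>
     \<S>' = \<S> \<union> set out \<and> set out \<inter> \<S> = {} \<and> distinct out \<and> set Ns \<subseteq> \<S>' \<and>
     (\<forall>B\<in>set out. set (nbs B) \<subseteq> \<S>')"
proof (induct rule: enum_enum_loop.inducts)
  case (enum d S \<S> \<S>' out)
  then show ?case by auto
next
  case (loop_new S' \<S> d \<S>1 out1 Ns \<S>2 out2)
  then have 1: "\<S>1 = \<S> \<union> set out1" "set out1 \<inter> \<S> = {}" "distinct out1" "S' \<in> set out1"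
    "\<forall>B\<in>set out1. set (nbs B) \<subseteq> \<S>1" by auto
  have 2: "\<S>2 = \<S>1 \<union> set out2" "set out2 \<inter> \<S>1 = {}" "distinct out2" "set Ns \<subseteq> \<S>2"
    "\<forall>B\<in>set out2. set (nbs B) \<subseteq> \<S>2" using loop_new by auto
  have "\<forall>B\<in>set (out1 @ out2). set (nbs B) \<subseteq> \<S>2" using 1(5) 2(1,5) by fastforce
  then show ?case using 1 2 by auto
qed auto

lemma enum_sound:
  "enum nbs d S \<S> \<S>' out \<Longrightarrow> (\<And>B. B \<in> M \<Longrightarrow> set (nbs B) \<subseteq> M) \<Longrightarrow> S \<in> M \<Longrightarrow> set out \<subseteq> M"
  "enum_loop nbs d Ns \<S> \<S>' out \<Longrightarrow> (\<And>B. B \<in> M \<Longrightarrow> set (nbs B) \<subseteq> M) \<Longrightarrow> set Ns \<subseteq> M \<Longrightarrow> set out \<subseteq> M"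
  by (induct rule: enum_enum_loop.inducts) (simp_all split: if_splits)

text \<open>Outer induction on the number of solutions not yet in the global set, inner induction on
  the list. A new \<open>S'\<close> is inserted before its own loop starts, so that loop and the
  rest of the current one both begin with fewer solutions missing.\<close>

lemma enum_loop_total:
  assumes "finite M" "\<And>B. B \<in> M \<Longrightarrow> set (nbs B) \<subseteq> M"
  shows "\<S> \<subseteq> M \<Longrightarrow> set Ns \<subseteq> M \<Longrightarrow> \<exists>\<S>' out. enum_loop nbs d Ns \<S> \<S>' out \<and> \<S>' \<subseteq> M"
proof (induct "card (M - \<S>)" arbitrary: \<S> Ns d rule: less_induct)
  case less
  show ?case using less.prems(2)
  proof (induct Ns)
    case Nil then show ?case using loop_Nil less.prems(1) by blast
  next
    case (Cons S' Ns)
    show ?case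
    proof (cases "S' \<in> \<S>")
      case True
      then show ?thesis using Cons loop_old[OF True, of nbs d Ns] by (metis insert_subset list.simps(15))
    next
      case False
      have "card (M - insert S' \<S>) < card (M - \<S>)"
        using Cons.prems False assms(1) by (intro psubset_card_mono) auto
      then obtain \<S>1 out1 where 1: "enum_loop nbs (Suc d) (nbs S') (insert S' \<S>) \<S>1 out1" "\<S>1 \<subseteq> M"
        using less.hyps[of "insert S' \<S>" "nbs S'" "Suc d"] less.prems(1) Cons.prems assms(2)[of S'] by auto
      then have sub: "insert S' \<S> \<subseteq> \<S>1" using enum_properties(2) by blast
      have "card (M - \<S>1) < card (M - \<S>)"
        using Cons.prems False assms(1) sub by (intro psubset_card_mono) auto
      then obtain \<S>2 out2 where 2: "enum_loop nbs d Ns \<S>1 \<S>2 out2" "\<S>2 \<subseteq> M"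
        using less.hyps[of \<S>1 Ns d] 1(2) Cons.prems by auto
      show ?thesis using loop_new[OF False enum_enum_loop.intros(1)[OF 1(1)] 2(1)] 2(2) by blast
    qed
  qed
qed

lemma (in labelled_graph) alg_correct:
  assumes "admissible G cmp nbs S0"
  shows "\<exists>out. alg_outputs nbs S0 out"
    and "alg_outputs nbs S0 out \<Longrightarrow> distinct out \<and> set out = max_conn_bip G"
proof -
  have a: "comp_spec G cmp" "S0 \<in> max_conn_bip G"
    and nb: "\<And>B. B \<in> max_conn_bip G \<Longrightarrow> set (nbs B) = neighbors G cmp B"
    using assms by (auto simp: admissible_def)
  then have closed: "\<And>B. B \<in> max_conn_bip G \<Longrightarrow> set (nbs B) \<subseteq> max_conn_bip G"
    using neighbors_maximal by simp
  have "\<exists>\<S>' out. enum_loop nbs 0 (nbs S0) {S0} \<S>' out \<and> \<S>' \<subseteq> max_conn_bip G"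
    using enum_loop_total[OF finite_max_conn_bip closed, where \<S> = "{S0}" and Ns = "nbs S0" and d = 0] a(2) closed by auto
  then show "\<exists>out. alg_outputs nbs S0 out"
    unfolding alg_outputs_def using enum_enum_loop.intros(1) by metis
  assume "alg_outputs nbs S0 out"
  then obtain \<S>' where e: "enum nbs 0 S0 {} \<S>' out" by (auto simp: alg_outputs_def)
  then have p: "\<S>' = set out" "distinct out" "S0 \<in> set out" "\<forall>B\<in>set out. set (nbs B) \<subseteq> set out"
    using enum_properties(1) by fastforce+
  \<comment> \<open>\<open>nbs\<close> is specified on maximal solutions only, hence closure is
    claimed for the maximal ones among the outputs.\<close>
  define M where "M = set out \<inter> max_conn_bip G"
  have M: "neighbors G cmp B \<subseteq> M" if "B \<in> M" for B
    using that bspec[OF p(4), of B] nb[of B] closed[of B] by (simp add: M_def)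
  have M': "S0 \<in> M" "M \<subseteq> max_conn_bip G"
    using p(3) a(2) by (simp_all add: M_def)
  \<comment> \<open>The common part starts empty, so that solutions disjoint from \<open>S0\<close>
    are reached as well.\<close>
  have sub: "max_conn_bip G \<subseteq> set out"
    using neighbors_reach[OF a(1) _ M M', of _ "{}"] unfolding M_def by blast
  show "distinct out \<and> set out = max_conn_bip G"
    using p(2) sub enum_sound(1)[OF e closed a(2)] by auto
qed


section \<open>Budgets for programs\<close>

inductive_simps exec_simps:
  "exec Skip s tr s'" "exec (Assign x e) s tr s'" "exec (Store a i e) s tr s'"
  "exec (Seq p q) s tr s'" "exec (Cond e p q) s tr s'"

lemma ticks_append: "ticks a @ ticks b = ticks (a + b)"
  by (simp add: replicate_add)

lemma ticks_eq_Cons: "ticks k = Tick # ticks j \<longleftrightarrow> k = Suc j"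
  by (metis replicate_Suc length_replicate)

lemma append_eq_ticks:
  "tr @ tr' = ticks k \<longleftrightarrow> (\<exists>a b. tr = ticks a \<and> tr' = ticks b \<and> k = a + b)"
proof
  assume h: "tr @ tr' = ticks k"
  then have "set (tr @ tr') \<subseteq> {Tick}" by (auto simp: set_replicate_conv_if)
  then have "tr = ticks (length tr)" "tr' = ticks (length tr')"
    by (auto intro!: replicate_eqI)
  moreover have "k = length tr + length tr'"
    using arg_cong[OF h, of length] by simp
  ultimately show "\<exists>a b. tr = ticks a \<and> tr' = ticks b \<and> k = a + b" by blast
qed (auto simp: ticks_append)

text \<open>\<open>c\<close> is a budget of steps, and \<open>Q\<close> is given what is left of it. Only executions without
  output are described.\<close>

definition wp :: "prog \<Rightarrow> nat \<Rightarrow> (nat \<Rightarrow> machine \<Rightarrow> bool) \<Rightarrow> machine \<Rightarrow> bool" where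
  "wp p c Q s \<longleftrightarrow> (\<exists>k s'. exec p s (ticks k) s' \<and> k \<le> c \<and> Q (c - k) s')"

text \<open>This and the following rules are equivalences, so that the simplifier can evaluate
  straight-line code together with its cost.\<close>

lemma wp_Skip: "wp Skip c Q s \<longleftrightarrow> 1 \<le> c \<and> Q (c - 1) s"
  unfolding wp_def exec_simps using ticks_eq_Cons[of _ 0] by auto

lemma wp_Assign: "wp (Assign x e) c Q s \<longleftrightarrow>
    Suc (cost e) \<le> c \<and> Q (c - Suc (cost e)) (s\<lparr>regs := (regs s)(x := eval s e)\<rparr>)"
  unfolding wp_def exec_simps by (auto simp: ticks_eq_Cons)

lemma wp_Store: "wp (Store a i e) c Q s \<longleftrightarrow>
    Suc (cost i + cost e) \<le> c \<and>
    Q (c - Suc (cost i + cost e)) (s\<lparr>mem := (mem s)(a := (mem s a)(eval s i := eval s e))\<rparr>)"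
  unfolding wp_def exec_simps by (auto simp: ticks_eq_Cons)

lemma wp_Seq: "wp (Seq p q) c Q s \<longleftrightarrow> wp p c (\<lambda>c' s'. wp q c' Q s') s"
proof
  assume "wp (Seq p q) c Q s"
  then obtain k s'' tr s' tr' where "exec p s tr s'" "exec q s' tr' s''" "ticks k = tr @ tr'" "k \<le> c" "Q (c - k) s''"
    unfolding wp_def exec_simps by blast
  moreover from this obtain a b where "tr = ticks a" "tr' = ticks b" "k = a + b"
    using append_eq_ticks by metis
  ultimately have "exec p s (ticks a) s' \<and> a \<le> c" "exec q s' (ticks b) s'' \<and> b \<le> c - a \<and> Q (c - a - b) s''"
    by auto
  then show "wp p c (\<lambda>c' s'. wp q c' Q s') s"
    unfolding wp_def by blast
next
  assume "wp p c (\<lambda>c' s'. wp q c' Q s') s"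
  then obtain a s' b s'' where "exec p s (ticks a) s'" "a \<le> c" "exec q s' (ticks b) s''" "b \<le> c - a"
    "Q (c - a - b) s''"
    unfolding wp_def by blast
  then show "wp (Seq p q) c Q s"
    unfolding wp_def exec_simps
    by (intro exI[of _ "a + b"] exI[of _ s'']) (force simp: ticks_append[symmetric])
qed

lemma wp_Cond: "wp (Cond e p q) c Q s \<longleftrightarrow>
    Suc (cost e) \<le> c \<and>
    (if eval s e \<noteq> 0 then wp p (c - Suc (cost e)) Q s else wp q (c - Suc (cost e)) Q s)"
proof -
  have *: "(\<exists>k s' tr. exec r s tr s' \<and> ticks k = ticks a @ tr \<and> k \<le> c \<and> Q (c - k) s') \<longleftrightarrow>
      a \<le> c \<and> wp r (c - a) Q s" (is "?L \<longleftrightarrow> ?R") for r a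
  proof
    assume ?L
    then obtain k s' tr b where "exec r s tr s'" "tr = ticks b" "k = a + b" "k \<le> c" "Q (c - k) s'"
      by (metis append_eq_ticks replicate_eq_replicate length_replicate)
    then show ?R unfolding wp_def by (auto intro!: exI[of _ b] exI[of _ s'])
  next
    assume ?R
    then obtain b s' where "a \<le> c" "exec r s (ticks b) s'" "b \<le> c - a" "Q (c - a - b) s'"
      unfolding wp_def by blast
    then show ?L by (intro exI[of _ "a + b"] exI[of _ s'] exI[of _ "ticks b"]) (auto simp: ticks_append)
  qed
  show ?thesis
    using *[of p "Suc (cost e)"] *[of q "Suc (cost e)"]
    unfolding wp_def[of "Cond e p q"] exec_simps by simp blast
qed

lemmas wp_simps = wp_Skip wp_Assign wp_Store wp_Seq wp_Cond

lemma wp_mono: "wp p c Q s \<Longrightarrow> (\<And>c' s'. Q c' s' \<Longrightarrow> Q' c' s') \<Longrightarrow> wp p c Q' s"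
  unfolding wp_def by blast

text \<open>Lets a program be verified with a round budget \<open>b\<close> and embedded into any
  larger one; at least the surplus \<open>c - b\<close> is still available afterwards.\<close>

lemma wp_budget:
  assumes "wp p b (\<lambda>_. Q) s" "b \<le> c" "\<And>c' s'. Q s' \<Longrightarrow> c - b \<le> c' \<Longrightarrow> Q' c' s'"
  shows "wp p c Q' s"
proof -
  obtain k s' where "exec p s (ticks k) s'" "k \<le> b" "Q s'"
    using assms(1) unfolding wp_def by blast
  then show ?thesis unfolding wp_def using assms(2) assms(3)[of s' "c - k"]
    by (intro exI[of _ k] exI[of _ s']) auto
qed

section \<open>Frame rule and loop rules\<close>

primrec wr :: "prog \<Rightarrow> nat set" where
  "wr Skip = {}" | "wr (Assign x e) = {x}" | "wr (Store a i e) = {}" | "wr (Print e) = {}"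
| "wr Finish = {}" | "wr (Seq p q) = wr p \<union> wr q" | "wr (Cond e p q) = wr p \<union> wr q"
| "wr (While e p) = wr p"

primrec wa :: "prog \<Rightarrow> nat set" where
  "wa Skip = {}" | "wa (Assign x e) = {}" | "wa (Store a i e) = {a}" | "wa (Print e) = {}"
| "wa Finish = {}" | "wa (Seq p q) = wa p \<union> wa q" | "wa (Cond e p q) = wa p \<union> wa q"
| "wa (While e p) = wa p"

definition same :: "prog \<Rightarrow> machine \<Rightarrow> machine \<Rightarrow> bool" where
  "same p s s' \<longleftrightarrow> (\<forall>x. x \<notin> wr p \<longrightarrow> regs s' x = regs s x) \<and> (\<forall>a. a \<notin> wa p \<longrightarrow> mem s' a = mem s a)"

lemma same_refl: "same p s s"
  by (simp add: same_def)

lemma exec_same: "exec p s tr s' \<Longrightarrow> same p s s'"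
  by (induct rule: exec.induct) (auto simp: same_def)

text \<open>Whatever lies outside the syntactic write sets is preserved, so invariants need to
  mention only what a program changes.\<close>

lemma wp_frame: "wp p c (\<lambda>c' s'. same p s s' \<longrightarrow> Q c' s') s \<Longrightarrow> wp p c Q s"
  unfolding wp_def using exec_same by blast

text \<open>The cost of the test makes the budget decrease in every iteration, so it serves as the
  termination measure.\<close>

lemma wp_While:
  assumes "I c0 s0"
    and "\<And>c s. I c s \<Longrightarrow> same p s0 s \<Longrightarrow> eval s e = 0 \<Longrightarrow> Suc (cost e) \<le> c \<and> Q (c - Suc (cost e)) s"
    and "\<And>c s. I c s \<Longrightarrow> same p s0 s \<Longrightarrow> eval s e \<noteq> 0 \<Longrightarrow> Suc (cost e) \<le> c \<and> wp p (c - Suc (cost e)) I s"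
  shows "wp (While e p) c0 Q s0"
proof -
  have "wp (While e p) c Q s" if "I c s" "same p s0 s" for c s
    using that
  proof (induct c arbitrary: s rule: less_induct)
    case (less c)
    show ?case
    proof (cases "eval s e = 0")
      case True
      then have "exec (While e p) s (ticks (Suc (cost e))) s" by (rule exec.intros)
      then show ?thesis using assms(2)[OF less.prems True] unfolding wp_def by blast
    next
      case False
      let ?d = "c - Suc (cost e)"
      obtain k s' where k: "exec p s (ticks k) s'" "k \<le> ?d" "I (?d - k) s'" "Suc (cost e) \<le> c"
        using assms(3)[OF less.prems False] unfolding wp_def by blast
      have "same p s0 s'" using less.prems(2) exec_same[OF k(1)] by (simp add: same_def)
      then obtain k' s'' where k': "exec (While e p) s' (ticks k') s''" "k' \<le> ?d - k" "Q (?d - k - k') s''"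
        using less.hyps[of "?d - k" s'] k by (auto simp: wp_def)
      have "exec (While e p) s (ticks (Suc (cost e)) @ ticks k @ ticks k') s''"
        using False k(1) k'(1) by (rule exec.intros)
      then show ?thesis using k k' unfolding wp_def ticks_append
        by (intro exI[of _ "Suc (cost e) + (k + k')"] exI[of _ s'']) (auto simp: diff_diff_left add.assoc simp del: replicate_Suc)
    qed
  qed
  then show ?thesis using assms(1) same_refl by blast
qed

text \<open>Register 0 holds the number of vertices, so this is the loop over all vertices.\<close>

definition for_upto :: "nat \<Rightarrow> prog \<Rightarrow> prog" where
  "for_upto j p = Seq (Assign j (Const 0)) (While (Minus (Reg 0) (Reg j)) (Seq p (Assign j (Succ (Reg j)))))"

lemma for_upto_writes [simp]: "wr (for_upto j p) = insert j (wr p)" "wa (for_upto j p) = wa p"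
  by (auto simp: for_upto_def)

text \<open>A round costs 4 for the test, 3 for the increment and at most \<open>b\<close> for the
  body, which is rounded to \<open>b + 10\<close>. The additional round in the factor
  \<open>1 + regs s 0\<close> pays for the initialisation and the last test.\<close>

lemma wp_for_upto:
  assumes "0 \<notin> insert j (wr p)" "j \<notin> wr p"
    and init: "I 0 (s\<lparr>regs := (regs s)(j := 0)\<rparr>)"
    and step: "\<And>i s'. i < regs s 0 \<Longrightarrow> I i s' \<Longrightarrow> same (for_upto j p) s s' \<Longrightarrow> regs s' j = i \<Longrightarrow>
      wp p b (\<lambda>_ s''. I (Suc i) (s''\<lparr>regs := (regs s'')(j := Suc i)\<rparr>)) s'"
    and exit: "\<And>c' s'. I (regs s 0) s' \<Longrightarrow> same (for_upto j p) s s' \<Longrightarrow>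
      c - (b + 10) * (1 + regs s 0) \<le> c' \<Longrightarrow> Q c' s'"
    and budget: "(b + 10) * (1 + regs s 0) \<le> c"
  shows "wp (for_upto j p) c Q s"
proof -
  let ?n = "regs s 0"
  let ?B = "(b + 10) * (1 + ?n)"
  let ?s0 = "s\<lparr>regs := (regs s)(j := 0)\<rparr>"
  let ?I = "\<lambda>c' s'. \<exists>i. i \<le> ?n \<and> regs s' j = i \<and> I i s' \<and> c - ?B + 5 + (b + 10) * (?n - i) \<le> c'"
  have *: "wp (While (Minus (Reg 0) (Reg j)) (Seq p (Assign j (Succ (Reg j))))) (c - 2)
      (\<lambda>c' s'. I ?n s' \<and> c - ?B \<le> c') ?s0"
  proof (rule wp_While[where I = ?I])
    show "?I (c - 2) ?s0" using init budget by (auto simp: algebra_simps)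
  next
    fix c' s' assume h: "?I c' s'" "same (Seq p (Assign j (Succ (Reg j)))) ?s0 s'"
    then obtain i where i: "i \<le> ?n" "regs s' j = i" "I i s'" "c - ?B + 5 + (b + 10) * (?n - i) \<le> c'" by blast
    have n: "regs s' 0 = ?n" using h(2) assms(1,2) by (simp add: same_def)
    have same: "same (for_upto j p) s s'" using h(2) by (auto simp: same_def)
    { assume "eval s' (Minus (Reg 0) (Reg j)) = 0"
      then have "i = ?n" using i n by simp
      then show "Suc (cost (Minus (Reg 0) (Reg j))) \<le> c' \<and>
          (I ?n s' \<and> c - ?B \<le> c' - Suc (cost (Minus (Reg 0) (Reg j))))"
        using i by auto }
    { assume "eval s' (Minus (Reg 0) (Reg j)) \<noteq> 0"
      then have lt: "i < ?n" using i n by simp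
      obtain m where m: "?n - i = Suc m" "m = ?n - Suc i" using lt by (metis Suc_diff_Suc)
      have st: "wp p b (\<lambda>_ s''. I (Suc i) (s''\<lparr>regs := (regs s'')(j := Suc i)\<rparr>)) s'"
        using step[OF lt i(3) same i(2)] .
      have "wp p b (\<lambda>_ s''. I (Suc i) (s''\<lparr>regs := (regs s'')(j := Suc i)\<rparr>) \<and> regs s'' j = i) s'"
        by (rule wp_frame, rule wp_mono[OF st]) (use i(2) assms(2) in \<open>auto simp: same_def\<close>)
      then have "wp (Seq p (Assign j (Succ (Reg j)))) (c' - 4) ?I s'"
        unfolding wp_Seq wp_Assign
      proof (rule wp_budget)
        show "b \<le> c' - 4" using i(4) m by simp
      next
        fix d s'' assume a: "I (Suc i) (s''\<lparr>regs := (regs s'')(j := Suc i)\<rparr>) \<and> regs s'' j = i" "c' - 4 - b \<le> d"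
        have "c - ?B + 8 + (b + 10) * (?n - Suc i) \<le> d"
          using i(4) a(2) m by simp
        then show "Suc (cost (Succ (Reg j))) \<le> d \<and> ?I (d - Suc (cost (Succ (Reg j))))
            (s''\<lparr>regs := (regs s'')(j := eval s'' (Succ (Reg j)))\<rparr>)"
          using a lt by auto
      qed
      then show "Suc (cost (Minus (Reg 0) (Reg j))) \<le> c' \<and>
          wp (Seq p (Assign j (Succ (Reg j)))) (c' - Suc (cost (Minus (Reg 0) (Reg j)))) ?I s'"
        using i(4) by (simp add: numeral_eq_Suc) }
  qed
  have "wp (for_upto j p) c (\<lambda>c' s'. I ?n s' \<and> c - ?B \<le> c') s"
    unfolding for_upto_def wp_Seq wp_Assign using * budget by (simp add: numeral_eq_Suc)
  note main = this
  show ?thesis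
    by (rule wp_frame, rule wp_mono[OF main]) (use exit in auto)
qed

definition each_nbr :: "nat \<Rightarrow> nat \<Rightarrow> nat \<Rightarrow> prog \<Rightarrow> prog" where
  "each_nbr r p u q = Seq (Assign p (Cell 0 (Reg r)))
     (While (Minus (Cell 0 (Succ (Reg r))) (Reg p))
       (Seq (Assign u (Cell 1 (Reg p))) (Seq (Assign p (Succ (Reg p))) q)))"

lemma each_nbr_writes [simp]:
  "wr (each_nbr r p u q) = insert p (insert u (wr q))" "wa (each_nbr r p u q) = wa q"
  by (auto simp: each_nbr_def)

definition has_input :: "nat list list \<Rightarrow> machine \<Rightarrow> bool" where
  "has_input adj s \<longleftrightarrow> regs s 0 = length adj \<and> mem s 0 = mem (input adj) 0 \<and> mem s 1 = mem (input adj) 1"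

lemma offset_Suc:
  "v < length adj \<Longrightarrow> mem (input adj) 0 v = length (concat (take v adj)) \<and>
     mem (input adj) 0 (Suc v) = length (concat (take v adj)) + length (adj ! v)"
  by (simp add: input_def take_Suc_conv_app_nth)

lemma adjacency_entry:
  assumes "v < length adj" "k < length (adj ! v)"
  shows "mem (input adj) 1 (length (concat (take v adj)) + k) = adj ! v ! k"
proof -
  have "concat adj = concat (take v adj) @ adj ! v @ concat (drop (Suc v) adj)"
    using id_take_nth_drop[OF assms(1)] by (metis concat.simps(2) concat_append)
  then show ?thesis using assms(2) by (simp add: input_def nth_append)
qed

text \<open>The overhead per list entry is 12: 6 for the test and 3 for each assignment. The pointer
  \<open>p\<close> has already moved on when \<open>q\<close> runs, so \<open>step\<close> leaves
  its value \<open>y\<close> arbitrary.\<close>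

lemma wp_each_nbr:
  assumes "has_input adj s" "regs s r = v" "v < length adj"
    and "r \<notin> insert p (insert u (wr q))" "p \<notin> wr q" "p \<noteq> u" "wa q \<inter> {0, 1} = {}"
    and init: "I 0 (s\<lparr>regs := (regs s)(p := length (concat (take v adj)))\<rparr>)"
    and step: "\<And>k s' y. k < length (adj ! v) \<Longrightarrow> I k s' \<Longrightarrow> same (each_nbr r p u q) s s' \<Longrightarrow>
      wp q b (\<lambda>_. I (Suc k)) (s'\<lparr>regs := (regs s')(u := adj ! v ! k, p := y)\<rparr>)"
    and exit: "\<And>c' s'. I (length (adj ! v)) s' \<Longrightarrow> same (each_nbr r p u q) s s' \<Longrightarrow>
      c - (b + 20) * (1 + length (adj ! v)) \<le> c' \<Longrightarrow> Q c' s'"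
    and budget: "(b + 20) * (1 + length (adj ! v)) \<le> c"
  shows "wp (each_nbr r p u q) c Q s"
proof -
  let ?n = "length (adj ! v)"
  let ?o = "length (concat (take v adj))"
  let ?B = "(b + 20) * (1 + ?n)"
  let ?s0 = "s\<lparr>regs := (regs s)(p := ?o)\<rparr>"
  let ?body = "Seq (Assign u (Cell 1 (Reg p))) (Seq (Assign p (Succ (Reg p))) q)"
  let ?e = "Minus (Cell 0 (Succ (Reg r))) (Reg p)"
  let ?I = "\<lambda>c' s'. \<exists>k. k \<le> ?n \<and> regs s' p = ?o + k \<and> I k s' \<and> c - ?B + 7 + (b + 20) * (?n - k) \<le> c'"
  have *: "wp (While ?e ?body) (c - 3) (\<lambda>c' s'. I ?n s' \<and> c - ?B \<le> c') ?s0"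
  proof (rule wp_While[where I = ?I])
    show "?I (c - 3) ?s0" using init budget by (auto simp: algebra_simps)
  next
    fix c' s' assume h: "?I c' s'" "same ?body ?s0 s'"
    then obtain k where k: "k \<le> ?n" "regs s' p = ?o + k" "I k s'" "c - ?B + 7 + (b + 20) * (?n - k) \<le> c'" by blast
    have same: "same (each_nbr r p u q) s s'" using h(2) by (auto simp: same_def)
    have ar: "mem s' 0 = mem (input adj) 0" "mem s' 1 = mem (input adj) 1" "regs s' r = v"
      using h(2) assms(1,2,4,5,7) unfolding same_def has_input_def by auto
    have e: "eval s' ?e = ?n - k" using k ar offset_Suc[OF assms(3)] by simp
    { assume "eval s' ?e = 0"
      then have "k = ?n" using k e by simp
      then show "Suc (cost ?e) \<le> c' \<and> (I ?n s' \<and> c - ?B \<le> c' - Suc (cost ?e))"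
        using k by auto }
    { assume "eval s' ?e \<noteq> 0"
      then have lt: "k < ?n" using k e by simp
      obtain m where m: "?n - k = Suc m" "m = ?n - Suc k" using lt by (metis Suc_diff_Suc)
      let ?s1 = "s'\<lparr>regs := (regs s')(u := adj ! v ! k, p := Suc (?o + k))\<rparr>"
      have ent: "mem s' 1 (?o + k) = adj ! v ! k"
        using ar(2) adjacency_entry[OF assms(3) lt] by simp
      have "wp q b (\<lambda>_ s''. I (Suc k) s'' \<and> regs s'' p = Suc (?o + k)) ?s1"
        by (rule wp_frame, rule wp_mono[OF step[OF lt k(3) same]]) (use assms(5) in \<open>auto simp: same_def\<close>)
      then have "wp q (c' - 12) ?I ?s1"
      proof (rule wp_budget)
        show "b \<le> c' - 12" using k(4) m by simp
      next
        fix d s'' assume a: "I (Suc k) s'' \<and> regs s'' p = Suc (?o + k)" "c' - 12 - b \<le> d"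
        have "c - ?B + 7 + (b + 20) * (?n - Suc k) \<le> d"
          using k(4) a(2) m by simp
        then show "?I d s''" using a lt by auto
      qed
      moreover have "12 \<le> c'" using k(4) m by simp
      ultimately have "wp ?body (c' - 6) ?I s'"
        unfolding wp_Seq wp_Assign using k(2,4) ent assms(6) by (simp add: numeral_eq_Suc) arith
      then show "Suc (cost ?e) \<le> c' \<and> wp ?body (c' - Suc (cost ?e)) ?I s'"
        using k(4) by (simp add: numeral_eq_Suc) }
  qed
  have "wp (each_nbr r p u q) c (\<lambda>c' s'. I ?n s' \<and> c - ?B \<le> c') s"
    unfolding each_nbr_def wp_Seq wp_Assign
    using * budget assms(1,2) offset_Suc[OF assms(3)] by (simp add: numeral_eq_Suc has_input_def)
  note main = this
  show ?thesis
    by (rule wp_frame, rule wp_mono[OF main]) (use exit in auto)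
qed


section \<open>Greedy extension\<close>

text \<open>Budgets of straight-line code appear as nested differences of numerals; this collapses
  them into one comparison.\<close>

lemma numeral_le_diff: "(numeral a :: nat) \<le> c - numeral b \<longleftrightarrow> numeral (a + b) \<le> c"
  by (simp only: numeral_plus_numeral[symmetric] le_diff_conv2) (use zero_less_numeral[of a, where 'a = nat] in linarith)

lemmas budget_simps = numeral_2_eq_2[symmetric] numeral_le_diff

locale adj_graph = labelled_graph +
  fixes adj :: "nat list list"
  assumes adj: "adjacency_lists G adj"
begin

abbreviation (input) "n \<equiv> length adj"

lemma verts_eq: "pverts G = {..<n}"
  using adj by (simp add: adjacency_lists_def)

lemma adj_nbhd: "v < n \<Longrightarrow> set (adj ! v) = nbhd G v"
  using adj by (simp add: adjacency_lists_def)

lemma nbhd_less: "u \<in> nbhd G v \<Longrightarrow> u < n"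
  using in_arcsD2[of v u] verts_eq by (simp add: nbhd_def)

text \<open>The set \<open>al\<close> of allowed vertices lets a single search serve three purposes:
  the component inside a candidate set, the extension to a maximal solution, and the recolouring of
  a known solution.\<close>

definition addable :: "nat set \<Rightarrow> nat set \<Rightarrow> nat \<Rightarrow> bool" where
  "addable al Z w \<longleftrightarrow> w < n \<and> w \<in> al \<and> w \<notin> Z \<and> nbhd G w \<inter> Z \<noteq> {} \<and>
     bipartite (with_proj G \<restriction> insert w Z)"

text \<open>A potential: each vertex outside \<open>Z\<close> carries one unit plus the number of
  queue entries that adding it would create. It proves termination of \<open>greedy\<close> and pays
  for the scan on the machine.\<close>

definition weight :: "nat set \<Rightarrow> nat" where
  "weight Z = (\<Sum>u\<in>{..<n} - Z. 1 + length (adj ! u))"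

definition sz :: nat where "sz = n + length (concat adj)"

lemma weight_insert:
  assumes "w < n" "w \<notin> Z"
  shows "weight Z = weight (insert w Z) + 1 + length (adj ! w)"
proof -
  define S where "S = {..<n} - insert w Z"
  have "{..<n} - Z = insert w S" "finite S" "w \<notin> S" using assms by (auto simp: S_def)
  then show ?thesis unfolding weight_def S_def[symmetric] by simp
qed

lemma weight_empty: "weight {} = sz"
  unfolding weight_def sz_def
  by (simp add: sum_Suc length_concat sum_list_sum_nth atLeast0LessThan)

lemma weight_le: "weight Z \<le> sz"
  unfolding weight_empty[symmetric] unfolding weight_def by (intro sum_mono2) auto

text \<open>The choice made by \<open>comp\<close>: candidates are taken from a queue, and the neighbours of an added
  vertex are appended to it. It depends on the vertex sets only, not on a 2-colouring.\<close>

function greedy :: "nat set \<Rightarrow> nat set \<Rightarrow> nat list \<Rightarrow> nat set" where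
  "greedy al Z [] = Z"
| "greedy al Z (w # q) =
     (if addable al Z w then greedy al (insert w Z) (q @ adj ! w) else greedy al Z q)"
  by pat_completeness auto
termination
proof (relation "measure (\<lambda>(al, Z, q). length q + weight Z)")
  fix al Z w q assume "addable al Z w"
  then have "weight Z = weight (insert w Z) + 1 + length (adj ! w)"
    using weight_insert by (simp add: addable_def)
  then show "((al, insert w Z, q @ adj ! w), al, Z, w # q) \<in> measure (\<lambda>(al, Z, q). length q + weight Z)"
    by simp
qed auto

lemma greedy_grow: "(grow G)\<^sup>*\<^sup>* Z (greedy al Z q)"
proof (induct al Z q rule: greedy.induct)
  case (2 al Z w q)
  show ?case
  proof (cases "addable al Z w")
    case True
    then have "grow G Z (insert w Z)" by (auto simp: grow_def addable_def verts_eq)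
    then show ?thesis using 2(1)[OF True] True by (simp add: converse_rtranclp_into_rtranclp)
  qed (use 2 in simp)
qed simp

lemma greedy_subset: "Z \<subseteq> greedy al Z q \<and> greedy al Z q \<subseteq> Z \<union> al"
  by (induct al Z q rule: greedy.induct) (auto simp: addable_def)

lemma greedy_conn_bip:
  assumes "conn_bip G Z"
  shows "conn_bip G (greedy al Z q)"
  using greedy_grow[of Z al q]
proof (induct rule: rtranclp_induct)
  case base then show ?case by (rule assms)
next
  case (step A B) then show ?case using grow_conn_bip by blast
qed

lemma greedy_complete:
  assumes "\<And>u. u < n \<Longrightarrow> u \<in> al \<Longrightarrow> u \<notin> Z \<Longrightarrow> nbhd G u \<inter> Z \<noteq> {} \<Longrightarrow>
      u \<in> set q \<or> \<not> bipartite (with_proj G \<restriction> insert u Z)"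
  shows "\<not> addable al (greedy al Z q) u"
  using assms
proof (induct al Z q rule: greedy.induct)
  case (1 al Z)
  then show ?case by (auto simp: addable_def)
next
  case (2 al Z w q)
  show ?case
  proof (cases "addable al Z w")
    case True
    have "x \<in> set (q @ adj ! w) \<or> \<not> bipartite (with_proj G \<restriction> insert x (insert w Z))"
      if x: "x < n" "x \<in> al" "x \<notin> insert w Z" "nbhd G x \<inter> insert w Z \<noteq> {}" for x
    proof (cases "w \<in> nbhd G x")
      case True
      then show ?thesis using nbhd_sym[of w x] adj_nbhd[of w] nbhd_less[of w x] by simp
    next
      case False
      then have "x \<in> set (w # q) \<or> \<not> bipartite (with_proj G \<restriction> insert x Z)"
        using 2(3)[of x] x by auto
      then show ?thesis
        using x bipartite_subset[of G "insert x (insert w Z)" "insert x Z"] by auto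
    qed
    then show ?thesis using 2(1)[OF True] True by simp
  next
    case False
    have "x \<in> set q \<or> \<not> bipartite (with_proj G \<restriction> insert x Z)"
      if x: "x < n" "x \<in> al" "x \<notin> Z" "nbhd G x \<inter> Z \<noteq> {}" for x
      using 2(3)[OF x] x False by (auto simp: addable_def)
    then show ?thesis using 2(2)[OF False] False by simp
  qed
qed

text \<open>With every vertex queued at the start, the hypothesis of \<open>greedy_complete\<close>
  is trivial and the boundary of \<open>A\<close> need not be computed.\<close>

definition saturate :: "nat set \<Rightarrow> nat set" where
  "saturate A = greedy {..<n} A [0..<n]"

lemma comp_spec_saturate: "comp_spec G saturate"
  unfolding comp_spec_def
proof (intro allI impI conjI)
  fix A assume "conn_bip G A"
  show "(grow G)\<^sup>*\<^sup>* A (saturate A)" unfolding saturate_def by (rule greedy_grow)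
  show "\<nexists>A'. grow G (saturate A) A'"
  proof
    assume "\<exists>A'. grow G (saturate A) A'"
    then obtain v where "addable {..<n} (saturate A) v"
      by (auto simp: grow_def addable_def verts_eq)
    then show False unfolding saturate_def using greedy_complete[of "{..<n}" A "[0..<n]" v] by auto
  qed
qed

text \<open>Inside a bipartite set the bipartiteness test never rejects a vertex, so the greedy
  search degenerates to an ordinary graph search.\<close>

lemma greedy_eq_cc:
  assumes "v < n" "al \<subseteq> {..<n}" "bipartite (with_proj G \<restriction> insert v al)"
  shows "greedy al {v} [0..<n] = cc G v (insert v al)"
proof (rule cc_unique)
  let ?Z = "greedy al {v} [0..<n]"
  have cb: "conn_bip G ?Z" using greedy_conn_bip conn_bip_singleton assms(1) verts_eq by simp
  then show "con G ?Z" by (simp add: conn_bip_def)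
  have sub: "{v} \<subseteq> ?Z" "?Z \<subseteq> {v} \<union> al" using greedy_subset[of "{v}" al "[0..<n]"] by auto
  then show "v \<in> ?Z" "?Z \<subseteq> insert v al" by auto
  show "u \<in> ?Z" if u: "z \<in> ?Z" "u \<in> nbhd G z" "u \<in> insert v al" for z u
  proof (rule ccontr)
    assume "u \<notin> ?Z"
    moreover have "bipartite (with_proj G \<restriction> insert u ?Z)"
      using bipartite_subset[OF assms(3)] sub(2) u(3) by auto
    moreover have "nbhd G u \<inter> ?Z \<noteq> {}" using u nbhd_sym[of u z] by auto
    ultimately have "addable al ?Z u" using u sub(1) assms(2) by (auto simp: addable_def)
    then show False using greedy_complete[of al "{v}" "[0..<n]" u] by auto
  qed
qed simp

end

text \<open>Registers are \<open>r\<dots>\<close>, arrays \<open>a\<dots>\<close>. A queue occupies the positions of \<open>aQ\<close> from \<open>rH\<close> to \<open>rT\<close>;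
  \<open>aSX\<close> and \<open>aSY\<close> flag the two colour classes, \<open>aNX\<close> and \<open>aNY\<close> their neighbourhoods, and \<open>aAl\<close>
  the vertices allowed to join. The search starts from vertex \<open>rX\<close>.\<close>

abbreviation (input) "rJ \<equiv> 2 :: nat"
abbreviation (input) "rP \<equiv> 3 :: nat"
abbreviation (input) "rU \<equiv> 4 :: nat"
abbreviation (input) "rW \<equiv> 5 :: nat"
abbreviation (input) "rH \<equiv> 6 :: nat"
abbreviation (input) "rT \<equiv> 7 :: nat"
abbreviation (input) "rX \<equiv> 8 :: nat"
abbreviation (input) "aAl \<equiv> 2 :: nat"
abbreviation (input) "aSX \<equiv> 3 :: nat"
abbreviation (input) "aSY \<equiv> 4 :: nat"
abbreviation (input) "aNX \<equiv> 5 :: nat"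
abbreviation (input) "aNY \<equiv> 6 :: nat"
abbreviation (input) "aQ \<equiv> 7 :: nat"

definition add_vertex :: "nat \<Rightarrow> nat \<Rightarrow> prog" where
  "add_vertex a b = Seq (Store a (Reg rW) (Const 1))
     (each_nbr rW rP rU (Seq (Store b (Reg rU) (Const 1))
       (Seq (Store aQ (Reg rT) (Reg rU)) (Assign rT (Succ (Reg rT))))))"

text \<open>Flags are 0 or 1, so \<open>Minus\<close> is \<open>and not\<close>.\<close>

definition eligible :: "nat \<Rightarrow> nat \<Rightarrow> expr" where
  "eligible a b = Minus (Minus (Minus (Minus (Cell a (Reg rW)) (Cell b (Reg rW)))
     (Cell aSX (Reg rW))) (Cell aSY (Reg rW))) (Minus (Const 1) (Cell aAl (Reg rW)))"

definition scan :: prog where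
  "scan = While (Minus (Reg rT) (Reg rH))
     (Seq (Assign rW (Cell aQ (Reg rH))) (Seq (Assign rH (Succ (Reg rH)))
       (Cond (eligible aNX aNY) (add_vertex aSY aNY)
         (Cond (eligible aNY aNX) (add_vertex aSX aNX) Skip))))"

definition grow_prog :: prog where
  "grow_prog = Seq (for_upto rJ (Store aQ (Reg rJ) (Reg rJ)))
     (Seq (Assign rH (Const 0)) (Seq (Assign rT (Reg 0)) scan))"

definition init_prog :: prog where
  "init_prog = Seq (for_upto rJ (Seq (Store aSX (Reg rJ) (Const 0)) (Seq (Store aSY (Reg rJ) (Const 0))
     (Seq (Store aNX (Reg rJ) (Const 0)) (Store aNY (Reg rJ) (Const 0))))))
     (Seq (Assign rW (Reg rX)) (Seq (Assign rT (Const 0)) (add_vertex aSX aNX)))"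

lemma add_vertex_writes [simp]:
  "wr (add_vertex a b) = {rP, rU, rT}" "wa (add_vertex a b) = {a, b, aQ}"
  by (auto simp: add_vertex_def)

lemma scan_writes [simp]:
  "wr scan = {rW, rH, rP, rU, rT}" "wa scan = {aSX, aSY, aNX, aNY, aQ}"
  by (auto simp: scan_def)

lemma grow_prog_writes [simp]:
  "wr grow_prog = {rJ, rW, rH, rP, rU, rT}" "wa grow_prog = {aSX, aSY, aNX, aNY, aQ}"
  by (auto simp: grow_prog_def)

lemma init_prog_writes [simp]:
  "wr init_prog = {rJ, rW, rP, rU, rT}" "wa init_prog = {aSX, aSY, aNX, aNY, aQ}"
  by (auto simp: init_prog_def)

lemma has_input_same:
  "has_input adj s \<Longrightarrow> same p s s' \<Longrightarrow> 0 \<notin> wr p \<Longrightarrow> 0 \<notin> wa p \<Longrightarrow> 1 \<notin> wa p \<Longrightarrow> has_input adj s'"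
  by (simp add: has_input_def same_def)

lemma wp_add_vertex:
  assumes "has_input adj s" "regs s rW = w" "w < length adj"
    and ab: "a \<noteq> b" "a \<noteq> aQ" "b \<noteq> aQ" "a \<notin> {0, 1}" "b \<notin> {0, 1}"
    and exit: "\<And>c' s'. same (add_vertex a b) s s' \<Longrightarrow> mem s' a = (mem s a)(w := 1) \<Longrightarrow>
      (\<forall>x. mem s' b x = (if x \<in> set (adj ! w) then 1 else mem s b x)) \<Longrightarrow>
      regs s' rT = regs s rT + length (adj ! w) \<Longrightarrow>
      (\<forall>i<length (adj ! w). mem s' aQ (regs s rT + i) = adj ! w ! i) \<Longrightarrow>
      (\<forall>i<regs s rT. mem s' aQ i = mem s aQ i) \<Longrightarrow>
      c - 40 * (1 + length (adj ! w)) \<le> c' \<Longrightarrow> Q c' s'"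
    and budget: "40 * (1 + length (adj ! w)) \<le> c"
  shows "wp (add_vertex a b) c Q s"
proof -
  let ?s = "s\<lparr>mem := (mem s)(a := (mem s a)(w := 1))\<rparr>"
  let ?I = "\<lambda>k s'. mem s' a = (mem s a)(w := 1) \<and>
     (\<forall>x. mem s' b x = (if x \<in> set (take k (adj ! w)) then 1 else mem s b x)) \<and>
     regs s' rT = regs s rT + k \<and> (\<forall>i<k. mem s' aQ (regs s rT + i) = adj ! w ! i) \<and>
     (\<forall>i<regs s rT. mem s' aQ i = mem s aQ i)"
  let ?q = "Seq (Store b (Reg rU) (Const 1)) (Seq (Store aQ (Reg rT) (Reg rU)) (Assign rT (Succ (Reg rT))))"
  have "wp (each_nbr rW rP rU ?q) (c - 3)
    (\<lambda>c' s'. ?I (length (adj ! w)) s' \<and> c - 40 * (1 + length (adj ! w)) \<le> c') ?s"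
  proof (rule wp_each_nbr[where I = ?I and b = 10 and v = w])
    show "has_input adj ?s" using assms(1) ab by (auto simp: has_input_def)
  next
    fix k y and s' :: machine assume k: "k < length (adj ! w)" "?I k s'"
    show "wp ?q 10 (\<lambda>_. ?I (Suc k)) (s'\<lparr>regs := (regs s')(rU := adj ! w ! k, rP := y)\<rparr>)"
      using k ab by (auto simp: wp_simps budget_simps take_Suc_conv_app_nth less_Suc_eq)
  qed (use assms ab in auto)
  then have main: "wp (add_vertex a b) c
      (\<lambda>c' s'. ?I (length (adj ! w)) s' \<and> c - 40 * (1 + length (adj ! w)) \<le> c') s"
    unfolding add_vertex_def wp_Seq[of "Store _ _ _"] wp_Store using assms(2) budget by (simp add: budget_simps)
  show ?thesis
    by (rule wp_frame, rule wp_mono[OF main]) (use exit in auto)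
qed

definition flags :: "nat \<Rightarrow> (nat \<Rightarrow> nat) \<Rightarrow> nat set \<Rightarrow> bool" where
  "flags n f A \<longleftrightarrow> (\<forall>u<n. f u = (if u \<in> A then 1 else 0))"

lemma flagsD: "flags n f A \<Longrightarrow> u < n \<Longrightarrow> f u = (if u \<in> A then 1 else 0)"
  by (simp add: flags_def)

lemma flags_insert: "flags n f A \<Longrightarrow> flags n (f(w := 1)) (insert w A)"
  by (simp add: flags_def)

section \<open>Invariants and cost of the search on the machine\<close>

context adj_graph
begin

definition nbrs :: "nat set \<Rightarrow> nat set" where
  "nbrs X = {u. nbhd G u \<inter> X \<noteq> {}}"

lemma nbrs_insert: "w < n \<Longrightarrow> nbrs (insert w X) = nbrs X \<union> set (adj ! w)"
  using adj_nbhd nbhd_sym[of w] by (auto simp: nbrs_def)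

definition coloured :: "machine \<Rightarrow> nat set \<Rightarrow> nat set \<Rightarrow> nat set \<Rightarrow> bool" where
  "coloured s Z X Y \<longleftrightarrow> bip G Z X Y \<and> con G Z \<and> Z \<subseteq> {..<n} \<and>
     flags n (mem s aSX) X \<and> flags n (mem s aSY) Y \<and>
     flags n (mem s aNX) (nbrs X) \<and> flags n (mem s aNY) (nbrs Y)"

definition queue :: "machine \<Rightarrow> nat list \<Rightarrow> bool" where
  "queue s q \<longleftrightarrow> regs s rT = regs s rH + length q \<and> set q \<subseteq> {..<n} \<and>
     (\<forall>i<length q. mem s aQ (regs s rH + i) = q ! i)"

text \<open>Adjacency to \<open>Z\<close> together with bipartiteness means adjacency to exactly one
  colour class, which is what \<open>eligible\<close> reads off the flags in constant time.\<close>

lemma addable_iff: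
  assumes "bip G Z X Y" "con G Z"
  shows "addable al Z w \<longleftrightarrow> w < n \<and> w \<in> al \<and> w \<notin> Z \<and> (w \<in> nbrs X) \<noteq> (w \<in> nbrs Y)"
proof (cases "w \<in> Z")
  case False
  have "Z = X \<union> Y" using assms(1) by (auto simp: bip_iff)
  then show ?thesis
    unfolding addable_def bipartite_insert_iff[OF assms(2,1) False] nbrs_def by auto
qed (simp add: addable_def)

lemma coloured_insert:
  assumes "coloured s Z X Y" "w < n" "w \<notin> Z" "w \<in> nbrs Y" "w \<notin> nbrs X"
    and "mem s' aSX = (mem s aSX)(w := 1)" "mem s' aSY = mem s aSY" "mem s' aNY = mem s aNY"
    and "\<forall>x. mem s' aNX x = (if x \<in> set (adj ! w) then 1 else mem s aNX x)"
  shows "coloured s' (insert w Z) (insert w X) Y"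
proof -
  have c: "bip G Z X Y" "con G Z" "Z \<subseteq> {..<n}" using assms(1) by (auto simp: coloured_def)
  obtain z where "z \<in> nbhd G w" "z \<in> Z" using assms(4) c(1) by (auto simp: nbrs_def bip_iff)
  then have "con G (insert w Z)" using con_insert[OF c(2)] nbhd_sym by blast
  moreover have "bip G (insert w Z) (insert w X) Y"
    using bip_insert[OF c(1) assms(3)] assms(5) by (simp add: nbrs_def)
  moreover have "flags n (mem s' aNX) (nbrs (insert w X))"
    using assms(1,9) unfolding nbrs_insert[OF assms(2)] by (auto simp: coloured_def flags_def)
  ultimately show ?thesis
    using assms(1,2,6-8) flags_insert[of n "mem s aSX" X w] by (simp add: coloured_def)
qed

lemma coloured_insert':
  assumes "coloured s Z X Y" "w < n" "w \<notin> Z" "w \<in> nbrs X" "w \<notin> nbrs Y"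
    and "mem s' aSY = (mem s aSY)(w := 1)" "mem s' aSX = mem s aSX" "mem s' aNX = mem s aNX"
    and "\<forall>x. mem s' aNY x = (if x \<in> set (adj ! w) then 1 else mem s aNY x)"
  shows "coloured s' (insert w Z) X (insert w Y)"
proof -
  have c: "bip G Z X Y" "con G Z" "Z \<subseteq> {..<n}" using assms(1) by (auto simp: coloured_def)
  obtain z where "z \<in> nbhd G w" "z \<in> Z" using assms(4) c(1) by (auto simp: nbrs_def bip_iff)
  then have "con G (insert w Z)" using con_insert[OF c(2)] nbhd_sym by blast
  moreover have "bip G (insert w Z) X (insert w Y)"
    using bip_swap[OF bip_insert[OF bip_swap[OF c(1)] assms(3)]] assms(5) by (simp add: nbrs_def)
  moreover have "flags n (mem s' aNY) (nbrs (insert w Y))"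
    using assms(1,9) unfolding nbrs_insert[OF assms(2)] by (auto simp: coloured_def flags_def)
  ultimately show ?thesis
    using assms(1,2,6-8) flags_insert[of n "mem s aSY" Y w] by (simp add: coloured_def)
qed

lemma queue_append:
  assumes "queue s (w # q)" "w < n"
    and "regs s' rH = Suc (regs s rH)" "regs s' rT = regs s rT + length (adj ! w)"
    and "\<forall>i<length (adj ! w). mem s' aQ (regs s rT + i) = adj ! w ! i"
    and "\<forall>i<regs s rT. mem s' aQ i = mem s aQ i"
  shows "queue s' (q @ adj ! w)"
proof -
  have "set (adj ! w) \<subseteq> {..<n}" using adj_nbhd[OF assms(2)] nbhd_less by auto
  moreover have "mem s' aQ (Suc (regs s rH + i)) = (q @ adj ! w) ! i" if "i < length q + length (adj ! w)" for i
  proof (cases "i < length q")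
    case True
    then have "mem s aQ (regs s rH + Suc i) = (w # q) ! Suc i" "Suc (regs s rH + i) < regs s rT"
      using assms(1) by (auto simp: queue_def)
    then show ?thesis using assms(6) True by (simp add: nth_append)
  next
    case False
    then obtain j where j: "i = length q + j" by (metis le_Suc_ex not_less)
    then have "mem s' aQ (regs s rT + j) = adj ! w ! j" using assms(5) that by simp
    moreover have "regs s rT = Suc (regs s rH + length q)" using assms(1) by (simp add: queue_def)
    ultimately show ?thesis using j by (simp add: nth_append add.assoc)
  qed
  ultimately show ?thesis using assms(1,3,4) by (auto simp: queue_def)
qed

text \<open>Each queue entry pays 50 for its tests. Adding \<open>w\<close> releases
  \<open>100 * (1 + length (adj ! w))\<close> of the potential, enough for the 40 per list entry of
  \<open>add_vertex\<close> and the 50 per entry appended. The inclusion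
  \<open>X \<subseteq> X'\<close> keeps the start vertex in the first class, by which the classes
  are later identified with \<open>sides\<close>.\<close>

lemma wp_scan:
  assumes "has_input adj s" "coloured s Z X Y" "queue s q" "flags n (mem s aAl) al"
    and exit: "\<And>c' s' X' Y'. same scan s s' \<Longrightarrow> coloured s' (greedy al Z q) X' Y' \<Longrightarrow> X \<subseteq> X' \<Longrightarrow>
      c - (50 * length q + 100 * weight Z + 10) \<le> c' \<Longrightarrow> Q c' s'"
    and budget: "50 * length q + 100 * weight Z + 10 \<le> c"
  shows "wp scan c Q s"
proof -
  let ?B = "50 * length q + 100 * weight Z + 10"
  let ?I = "\<lambda>c' s'. \<exists>Z' X' Y' q'. coloured s' Z' X' Y' \<and> queue s' q' \<and> X \<subseteq> X' \<and>
    greedy al Z' q' = greedy al Z q \<and> c - ?B + 50 * length q' + 100 * weight Z' + 10 \<le> c'"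
  let ?p = "Seq (Assign rW (Cell aQ (Reg rH))) (Seq (Assign rH (Succ (Reg rH)))
       (Cond (eligible aNX aNY) (add_vertex aSY aNY)
         (Cond (eligible aNY aNX) (add_vertex aSX aNX) Skip)))"
  let ?e = "Minus (Reg rT) (Reg rH)"
  have main: "wp scan c (\<lambda>c' s'. (\<exists>X' Y'. coloured s' (greedy al Z q) X' Y' \<and> X \<subseteq> X') \<and> c - ?B \<le> c') s"
    unfolding scan_def
  proof (rule wp_While[where I = ?I])
    show "?I c s" using assms(2,3) budget by (intro exI[of _ Z] exI[of _ X] exI[of _ Y] exI[of _ q]) auto
  next
    fix c' s' assume h: "?I c' s'" "same ?p s s'"
    then obtain Z' X' Y' q' where I: "coloured s' Z' X' Y'" "queue s' q'" "X \<subseteq> X'"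
      "greedy al Z' q' = greedy al Z q" "c - ?B + 50 * length q' + 100 * weight Z' + 10 \<le> c'" by blast
    have e: "eval s' ?e = length q'" using I(2) by (simp add: queue_def)
    { assume "eval s' ?e = 0"
      then have "q' = []" using e by simp
      then show "Suc (cost ?e) \<le> c' \<and>
        ((\<exists>X' Y'. coloured s' (greedy al Z q) X' Y' \<and> X \<subseteq> X') \<and> c - ?B \<le> c' - Suc (cost ?e))"
        using I by auto }
    assume "eval s' ?e \<noteq> 0"
    then obtain w q1 where q': "q' = w # q1" using e by (metis list.exhaust list.size(3))
    have in': "has_input adj s'" by (rule has_input_same[OF assms(1) h(2)]) auto
    have al: "flags n (mem s' aAl) al" using h(2) assms(4) by (simp add: same_def)
    have w: "w < n" using I(2) q' by (simp add: queue_def)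
    have mw: "mem s' aQ (regs s' rH) = w" using I(2) q' by (auto simp: queue_def)
    let ?s1 = "s'\<lparr>regs := (regs s')(rW := w, rH := Suc (regs s' rH))\<rparr>"
    have bc: "bip G Z' X' Y'" "con G Z'" using I(1) by (auto simp: coloured_def)
    have Z': "w \<in> Z' \<longleftrightarrow> w \<in> X' \<or> w \<in> Y'" using bc(1) by (auto simp: bip_iff)
    have fl: "flags n (mem s' aSX) X'" "flags n (mem s' aSY) Y'" "flags n (mem s' aNX) (nbrs X')"
      "flags n (mem s' aNY) (nbrs Y')" using I(1) by (auto simp: coloured_def)
    have el1: "eval ?s1 (eligible aNX aNY) \<noteq> 0 \<longleftrightarrow> w \<in> nbrs X' \<and> w \<notin> nbrs Y' \<and> w \<notin> Z' \<and> w \<in> al"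
      using flagsD[OF fl(1) w] flagsD[OF fl(2) w] flagsD[OF fl(3) w] flagsD[OF fl(4) w] flagsD[OF al w] Z'
      by (auto simp: eligible_def)
    have el2: "eval ?s1 (eligible aNY aNX) \<noteq> 0 \<longleftrightarrow> w \<in> nbrs Y' \<and> w \<notin> nbrs X' \<and> w \<notin> Z' \<and> w \<in> al"
      using flagsD[OF fl(1) w] flagsD[OF fl(2) w] flagsD[OF fl(3) w] flagsD[OF fl(4) w] flagsD[OF al w] Z'
      by (auto simp: eligible_def)
    have ce: "cost (eligible a b) = 16" for a b by (simp add: eligible_def)
    have ad: "addable al Z' w \<longleftrightarrow> w \<in> al \<and> w \<notin> Z' \<and> (w \<in> nbrs X') \<noteq> (w \<in> nbrs Y')"
      using addable_iff[OF bc] w by simp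
    have in1: "has_input adj ?s1" using in' by (simp add: has_input_def)
    have ge: "50 + 10 \<le> c'" using I(5) q' by simp
    have "wp (Cond (eligible aNX aNY) (add_vertex aSY aNY)
         (Cond (eligible aNY aNX) (add_vertex aSX aNX) Skip)) (c' - 10) ?I ?s1"
      unfolding wp_Cond wp_Skip ce
    proof (intro conjI)
      show "Suc 16 \<le> c' - 10" using ge by simp
      have g: "greedy al (insert w Z') (q1 @ adj ! w) = greedy al Z q" if "addable al Z' w"
        using I(4) that by (simp add: q')
      have wt: "weight Z' = weight (insert w Z') + 1 + length (adj ! w)" if "w \<notin> Z'"
        using weight_insert[OF w that] .
      show "if eval ?s1 (eligible aNX aNY) \<noteq> 0 then wp (add_vertex aSY aNY) (c' - 10 - Suc 16) ?I ?s1
        else Suc 16 \<le> c' - 10 - Suc 16 \<and>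
         (if eval ?s1 (eligible aNY aNX) \<noteq> 0 then wp (add_vertex aSX aNX) (c' - 10 - Suc 16 - Suc 16) ?I ?s1
          else 1 \<le> c' - 10 - Suc 16 - Suc 16 \<and> ?I (c' - 10 - Suc 16 - Suc 16 - 1) ?s1)"
      proof (cases "addable al Z' w")
        case False
        have "coloured ?s1 Z' X' Y'" using I(1) by (simp add: coloured_def)
        moreover have "queue ?s1 q1" using I(2) unfolding q' queue_def by auto
        moreover have "greedy al Z' q1 = greedy al Z q" using I(4) False by (simp add: q')
        moreover have "c - ?B + 50 * length q1 + 100 * weight Z' + 10 \<le> c' - 10 - Suc 16 - Suc 16 - 1"
          using I(5) q' by simp
        ultimately have "?I (c' - 10 - Suc 16 - Suc 16 - 1) ?s1" using I(3) by blast
        moreover have "\<not> eval ?s1 (eligible aNX aNY) \<noteq> 0" "\<not> eval ?s1 (eligible aNY aNX) \<noteq> 0"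
          using False ad el1 el2 by auto
        ultimately show ?thesis using ge by auto
      next
        case True
        then have nZ: "w \<notin> Z'" by (simp add: addable_def)
        have bud: "c - ?B + 50 * length (q1 @ adj ! w) + 100 * weight (insert w Z') + 10 +
            40 * (1 + length (adj ! w)) \<le> c' - 10 - Suc 16 - Suc 16"
          using I(5) wt[OF nZ] unfolding q' by simp
        consider (1) "w \<in> nbrs X'" "w \<notin> nbrs Y'" | (2) "w \<in> nbrs Y'" "w \<notin> nbrs X'"
          using True ad by blast
        then show ?thesis
        proof cases
          case 1
          have "wp (add_vertex aSY aNY) (c' - 10 - Suc 16) ?I ?s1"
          proof (rule wp_add_vertex[where w = w, OF in1])
            fix d s'' assume a: "same (add_vertex aSY aNY) ?s1 s''" "mem s'' aSY = (mem ?s1 aSY)(w := 1)"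
              "\<forall>x. mem s'' aNY x = (if x \<in> set (adj ! w) then 1 else mem ?s1 aNY x)"
              "regs s'' rT = regs ?s1 rT + length (adj ! w)"
              "\<forall>i<length (adj ! w). mem s'' aQ (regs ?s1 rT + i) = adj ! w ! i"
              "\<forall>i<regs ?s1 rT. mem s'' aQ i = mem ?s1 aQ i"
              "c' - 10 - Suc 16 - 40 * (1 + length (adj ! w)) \<le> d"
            have "coloured s'' (insert w Z') X' (insert w Y')"
              by (rule coloured_insert'[OF I(1) w nZ 1]) (use a in \<open>simp_all add: same_def\<close>)
            moreover have "queue s'' (q1 @ adj ! w)"
              by (rule queue_append[OF I(2)[unfolded q'] w]) (use a in \<open>simp_all add: same_def\<close>)
            moreover have "c - ?B + 50 * length (q1 @ adj ! w) + 100 * weight (insert w Z') + 10 \<le> d"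
              using bud a(7) by simp
            ultimately show "?I d s''" using g[OF True] I(3) by blast
          qed (use w bud in auto)
          then show ?thesis using el1 1 True ad by simp
        next
          case 2
          have "wp (add_vertex aSX aNX) (c' - 10 - Suc 16 - Suc 16) ?I ?s1"
          proof (rule wp_add_vertex[where w = w, OF in1])
            fix d s'' assume a: "same (add_vertex aSX aNX) ?s1 s''" "mem s'' aSX = (mem ?s1 aSX)(w := 1)"
              "\<forall>x. mem s'' aNX x = (if x \<in> set (adj ! w) then 1 else mem ?s1 aNX x)"
              "regs s'' rT = regs ?s1 rT + length (adj ! w)"
              "\<forall>i<length (adj ! w). mem s'' aQ (regs ?s1 rT + i) = adj ! w ! i"
              "\<forall>i<regs ?s1 rT. mem s'' aQ i = mem ?s1 aQ i"
              "c' - 10 - Suc 16 - Suc 16 - 40 * (1 + length (adj ! w)) \<le> d"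
            have "coloured s'' (insert w Z') (insert w X') Y'"
              by (rule coloured_insert[OF I(1) w nZ 2]) (use a in \<open>simp_all add: same_def\<close>)
            moreover have "queue s'' (q1 @ adj ! w)"
              by (rule queue_append[OF I(2)[unfolded q'] w]) (use a in \<open>simp_all add: same_def\<close>)
            moreover have "c - ?B + 50 * length (q1 @ adj ! w) + 100 * weight (insert w Z') + 10 \<le> d"
              using bud a(7) by simp
            moreover have "X \<subseteq> insert w X'" using I(3) by blast
            ultimately show "?I d s''" using g[OF True] by blast
          qed (use w bud in auto)
          then show ?thesis using el1 el2 2 True ad ge by simp
        qed
      qed
    qed
    then show "Suc (cost ?e) \<le> c' \<and> wp ?p (c' - Suc (cost ?e)) ?I s'"
      using ge mw by (simp add: wp_Seq wp_Assign budget_simps)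
  qed
  show ?thesis
    by (rule wp_frame, rule wp_mono[OF main]) (use exit in auto)
qed

lemma wp_grow_prog:
  assumes "has_input adj s" "coloured s Z X Y" "flags n (mem s aAl) al"
    and exit: "\<And>c' s' X' Y'. same grow_prog s s' \<Longrightarrow> coloured s' (greedy al Z [0..<n]) X' Y' \<Longrightarrow> X \<subseteq> X' \<Longrightarrow>
      c - 200 * (1 + sz) \<le> c' \<Longrightarrow> Q c' s'"
    and budget: "200 * (1 + sz) \<le> c"
  shows "wp grow_prog c Q s"
proof -
  let ?R = "\<lambda>c' s'. \<exists>X' Y'. coloured s' (greedy al Z [0..<n]) X' Y' \<and> X \<subseteq> X' \<and> c - 200 * (1 + sz) \<le> c'"
  have N: "regs s 0 = n" using assms(1) by (simp add: has_input_def)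
  have sz: "n \<le> sz" by (simp add: sz_def)
  have "wp (for_upto rJ (Store aQ (Reg rJ) (Reg rJ))) c
    (\<lambda>c' s'. wp (Seq (Assign rH (Const 0)) (Seq (Assign rT (Reg 0)) scan)) c' ?R s') s"
  proof (rule wp_for_upto[where I = "\<lambda>i s'. \<forall>j<i. mem s' aQ j = j" and b = 3])
    show "(3 + 10) * (1 + regs s 0) \<le> c" using N sz budget by simp
  next
    fix c' s' assume a: "\<forall>j<regs s 0. mem s' aQ j = j"
      "same (for_upto rJ (Store aQ (Reg rJ) (Reg rJ))) s s'" "c - (3 + 10) * (1 + regs s 0) \<le> c'"
    let ?s = "s'\<lparr>regs := (regs s')(rH := 0, rT := n)\<rparr>"
    have in': "has_input adj s'" by (rule has_input_same[OF assms(1) a(2)]) auto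
    then have N': "regs s' 0 = n" by (simp add: has_input_def)
    have "50 * length [0..<n] + 100 * weight Z + 10 \<le> 150 * sz + 10"
      using weight_le[of Z] sz by simp
    moreover have "200 * (1 + sz) \<le> c" "c - (13 + 13 * n) \<le> c'" using budget a(3) N by simp_all
    ultimately have le: "50 * length [0..<n] + 100 * weight Z + 10 + (c - 200 * (1 + sz)) \<le> c' - 4" "4 \<le> c'"
      using sz by simp_all
    have "wp scan (c' - 4) ?R ?s"
    proof (rule wp_scan[where al = al and X = X and Z = Z and Y = Y and q = "[0..<n]"])
      show "has_input adj ?s" using in' by (simp add: has_input_def)
      show "coloured ?s Z X Y" using assms(2) a(2) by (simp add: coloured_def same_def)
      show "flags n (mem ?s aAl) al" using assms(3) a(2) by (simp add: same_def)
      show "queue ?s [0..<n]" using a(1) N by (auto simp: queue_def)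
    next
      fix d s'' X' Y' assume b: "coloured s'' (greedy al Z [0..<n]) X' Y'" "X \<subseteq> X'"
        "c' - 4 - (50 * length [0..<n] + 100 * weight Z + 10) \<le> d"
      then have "c - 200 * (1 + sz) \<le> d" using le by linarith
      then show "?R d s''" using b by blast
    qed (use le in simp)
    then show "wp (Seq (Assign rH (Const 0)) (Seq (Assign rT (Reg 0)) scan)) c' ?R s'"
      using le(2) N' by (simp add: wp_simps budget_simps)
  qed (auto simp: wp_simps budget_simps less_Suc_eq)
  then have main: "wp grow_prog c ?R s" unfolding grow_prog_def wp_Seq .
  show ?thesis
    by (rule wp_frame, rule wp_mono[OF main]) (use exit in blast)
qed

lemma wp_init_prog:
  assumes "has_input adj s" "regs s rX = v" "v < n"
    and exit: "\<And>c' s'. same init_prog s s' \<Longrightarrow> coloured s' {v} {v} {} \<Longrightarrow> c - 100 * (1 + sz) \<le> c' \<Longrightarrow> Q c' s'"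
    and budget: "100 * (1 + sz) \<le> c"
  shows "wp init_prog c Q s"
proof -
  let ?R = "\<lambda>c' s'. coloured s' {v} {v} {} \<and> c - 100 * (1 + sz) \<le> c'"
  let ?q = "Seq (Store aSX (Reg rJ) (Const 0)) (Seq (Store aSY (Reg rJ) (Const 0))
     (Seq (Store aNX (Reg rJ) (Const 0)) (Store aNY (Reg rJ) (Const 0))))"
  let ?I = "\<lambda>i s'. \<forall>j<i. mem s' aSX j = 0 \<and> mem s' aSY j = 0 \<and> mem s' aNX j = 0 \<and> mem s' aNY j = 0"
  have N: "regs s 0 = n" using assms(1) by (simp add: has_input_def)
  have deg: "n + length (adj ! v) \<le> sz"
    using member_le_sum_list[of "length (adj ! v)" "map length adj"] assms(3)
    by (simp add: sz_def length_concat)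
  have "wp (for_upto rJ ?q) c
    (\<lambda>c' s'. wp (Seq (Assign rW (Reg rX)) (Seq (Assign rT (Const 0)) (add_vertex aSX aNX))) c' ?R s') s"
  proof (rule wp_for_upto[where I = ?I and b = 12])
    show "(12 + 10) * (1 + regs s 0) \<le> c" using N deg budget by simp
  next
    fix c' s' assume a: "?I (regs s 0) s'" "same (for_upto rJ ?q) s s'" "c - (12 + 10) * (1 + regs s 0) \<le> c'"
    let ?s = "s'\<lparr>regs := (regs s')(rW := v, rT := 0)\<rparr>"
    have in': "has_input adj ?s" using has_input_same[OF assms(1) a(2)] by (auto simp: has_input_def)
    have v: "regs s' rX = v" using a(2) assms(2) by (simp add: same_def)
    have le: "40 * (1 + length (adj ! v)) + (c - 100 * (1 + sz)) \<le> c' - 4" "4 \<le> c'"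
      using deg budget a(3) N by simp_all
    have "wp (add_vertex aSX aNX) (c' - 4) ?R ?s"
    proof (rule wp_add_vertex[where w = v, OF in'])
      fix d s'' assume b: "same (add_vertex aSX aNX) ?s s''" "mem s'' aSX = (mem ?s aSX)(v := 1)"
        "\<forall>x. mem s'' aNX x = (if x \<in> set (adj ! v) then 1 else mem ?s aNX x)"
        "c' - 4 - 40 * (1 + length (adj ! v)) \<le> d"
      have "bip G {v} {v} {}"
        using bip_insert[of "{}" "{}" "{}" v] by (simp add: bip_iff[of _ "{}"])
      moreover have "nbrs {} = {}" "nbrs {v} = set (adj ! v)"
        using nbrs_insert[OF assms(3), of "{}"] by (simp_all add: nbrs_def)
      ultimately have "coloured s'' {v} {v} {}"
        using assms(3) a(1) b N con_singleton by (auto simp: coloured_def flags_def same_def)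
      then show "?R d s''" using b(4) le by linarith
    qed (use assms(3) le in auto)
    then show "wp (Seq (Assign rW (Reg rX)) (Seq (Assign rT (Const 0)) (add_vertex aSX aNX))) c' ?R s'"
      using le(2) v by (simp add: wp_simps budget_simps)
  qed (auto simp: wp_simps budget_simps less_Suc_eq)
  then have main: "wp init_prog c ?R s" unfolding init_prog_def wp_Seq .
  show ?thesis
    by (rule wp_frame, rule wp_mono[OF main]) (use exit in blast)
qed

end


section \<open>The trie of solutions\<close>

text \<open>The solutions found are kept in a trie: children \<open>aC0\<close>, \<open>aC1\<close>, parent \<open>aTP\<close> and label \<open>aTB\<close>
  of a node, first free node \<open>rFresh\<close>. The stack has \<open>rDep\<close> frames, from index 1 on; a frame stores
  the trie leaf of its solution in \<open>aKId\<close> and its progress \<open>k\<close>, for want of arithmetic, as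
  \<open>k div 2\<close> in \<open>aKV\<close> and \<open>k mod 2\<close> in \<open>aKI\<close>. \<open>rPar\<close> is the parity of \<open>rDep\<close>, which is opposite to
  that of the recursion depth.\<close>

abbreviation (input) "rFresh \<equiv> 9 :: nat"
abbreviation (input) "rNode \<equiv> 10 :: nat"
abbreviation (input) "rNew \<equiv> 11 :: nat"
abbreviation (input) "rDep \<equiv> 12 :: nat"
abbreviation (input) "rPar \<equiv> 13 :: nat"
abbreviation (input) "rV \<equiv> 14 :: nat"
abbreviation (input) "rI \<equiv> 15 :: nat"
abbreviation (input) "aC0 \<equiv> 8 :: nat"
abbreviation (input) "aC1 \<equiv> 9 :: nat"
abbreviation (input) "aTP \<equiv> 10 :: nat"
abbreviation (input) "aTB \<equiv> 11 :: nat"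
abbreviation (input) "aKId \<equiv> 12 :: nat"
abbreviation (input) "aKV \<equiv> 13 :: nat"
abbreviation (input) "aKI \<equiv> 14 :: nat"

abbreviation (input) child :: "bool \<Rightarrow> nat" where
  "child b \<equiv> (if b then aC1 else aC0)"

definition trie_step :: "bool \<Rightarrow> prog" where
  "trie_step b = Seq
     (Cond (Cell (child b) (Reg rNode)) Skip
       (Seq (Store (child b) (Reg rNode) (Reg rFresh))
       (Seq (Store aTP (Reg rFresh) (Reg rNode))
       (Seq (Store aTB (Reg rFresh) (Const (of_bool b)))
       (Seq (Assign rFresh (Succ (Reg rFresh))) (Assign rNew (Const 1)))))))
     (Assign rNode (Cell (child b) (Reg rNode)))"

definition insert_prog :: prog where
  "insert_prog = Seq (Assign rNode (Const 0)) (Seq (Assign rNew (Const 0))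
     (for_upto rJ (Cond (Cell aSX (Reg rJ)) (trie_step True)
       (Cond (Cell aSY (Reg rJ)) (trie_step True) (trie_step False)))))"

text \<open>The walk from a leaf to the root meets the bits of vertex \<open>n - 1\<close> down to
  those of vertex 0, so the last assignment to \<open>rX\<close> leaves the smallest vertex of the
  solution.\<close>

definition decode_prog :: prog where
  "decode_prog = Seq (Assign rNode (Cell aKId (Reg rDep))) (Seq (Assign rJ (Reg 0))
     (While (Reg rJ)
       (Seq (Assign rJ (Minus (Reg rJ) (Const 1)))
       (Seq (Store aAl (Reg rJ) (Cell aTB (Reg rNode)))
       (Seq (Cond (Cell aTB (Reg rNode)) (Assign rX (Reg rJ)) Skip)
         (Assign rNode (Cell aTP (Reg rNode))))))))"

text \<open>On entry \<open>aAl\<close> flags the solution \<open>B\<close> itself. If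
  \<open>v\<close> is in \<open>B\<close> nothing is removed and the subsequent search rebuilds
  \<open>B\<close>, in agreement with \<open>neighbors_at\<close>.\<close>

definition cand_prog :: prog where
  "cand_prog = Cond (Cell aAl (Reg rW)) Skip (each_nbr rW rP rU
     (Cond (Reg rI) (Cond (Cell aSY (Reg rU)) (Store aAl (Reg rU) (Const 0)) Skip)
       (Cond (Cell aSX (Reg rU)) (Store aAl (Reg rU) (Const 0)) Skip)))"

text \<open>The first growth computes \<open>cc\<close>; the second one continues from its colouring
  with all vertices allowed, which is \<open>saturate\<close>.\<close>

definition search_prog :: prog where
  "search_prog = Seq init_prog (Seq grow_prog (Seq (for_upto rJ (Store aAl (Reg rJ) (Const 1)))
     (Seq grow_prog insert_prog)))"

lemma trie_step_writes [simp]: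
  "wr (trie_step b) = {rFresh, rNew, rNode}" "wa (trie_step b) = {child b, aTP, aTB}"
  by (auto simp: trie_step_def)

lemma insert_prog_writes [simp]:
  "wr insert_prog = {rFresh, rNew, rNode, rJ}" "wa insert_prog = {aC0, aC1, aTP, aTB}"
  by (auto simp: insert_prog_def)

lemma decode_prog_writes [simp]:
  "wr decode_prog = {rNode, rJ, rX}" "wa decode_prog = {aAl}"
  by (auto simp: decode_prog_def)

lemma cand_prog_writes [simp]: "wr cand_prog = {rP, rU}" "wa cand_prog = {aAl}"
  by (auto simp: cand_prog_def)

lemma search_prog_writes [simp]:
  "wr search_prog = {rJ, rW, rH, rP, rU, rT, rFresh, rNew, rNode}"
  "wa search_prog = {aSX, aSY, aNX, aNY, aQ, aAl, aC0, aC1, aTP, aTB}"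
  by (auto simp: search_prog_def)

text \<open>Node \<open>x\<close> of the trie represents the word \<open>nodes ! x\<close>; node 0 is the root, hence never a
  child, and 0 marks a missing child.\<close>

definition trie :: "machine \<Rightarrow> bool list list \<Rightarrow> bool" where
  "trie s nodes \<longleftrightarrow> regs s rFresh = length nodes \<and> 0 < length nodes \<and> nodes ! 0 = [] \<and> distinct nodes \<and>
     (\<forall>x<length nodes. \<forall>w b. nodes ! x = w @ [b] \<longrightarrow>
       mem s aTP x < length nodes \<and> nodes ! mem s aTP x = w \<and> mem s aTB x = of_bool b) \<and>
     (\<forall>b. \<forall>x<length nodes. \<forall>y<length nodes. nodes ! y = nodes ! x @ [b] \<longrightarrow> mem s (child b) x = y) \<and>
     (\<forall>b. \<forall>x<length nodes. nodes ! x @ [b] \<notin> set nodes \<longrightarrow> mem s (child b) x = 0) \<and>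
     (\<forall>b. \<forall>x\<ge>length nodes. mem s (child b) x = 0)"

lemma update_mem_regs: "s\<lparr>mem := M, regs := R\<rparr> = (s :: machine)\<lparr>regs := R, mem := M\<rparr>"
  by (cases s) simp

lemma trie_cong:
  assumes "trie s nodes" "regs s' rFresh = regs s rFresh" "mem s' aTP = mem s aTP" "mem s' aTB = mem s aTB"
    "mem s' aC0 = mem s aC0" "mem s' aC1 = mem s aC1"
  shows "trie s' nodes"
proof -
  have "mem s' (child b) = mem s (child b)" for b using assms by simp
  then show ?thesis using assms unfolding trie_def by simp
qed

lemma trie_parent:
  assumes "trie s nodes" "x < length nodes" "nodes ! x = w @ [b]"
  shows "mem s aTP x < length nodes" "nodes ! mem s aTP x = w" "mem s aTB x = of_bool b"
  using assms unfolding trie_def by blast+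

lemma trie_child:
  assumes "trie s nodes"
  shows "x < length nodes \<Longrightarrow> y < length nodes \<Longrightarrow> nodes ! y = nodes ! x @ [b] \<Longrightarrow> mem s (child b) x = y"
    and "x < length nodes \<Longrightarrow> nodes ! x @ [b] \<notin> set nodes \<Longrightarrow> mem s (child b) x = 0"
    and "length nodes \<le> x \<Longrightarrow> mem s (child b) x = 0"
  using assms unfolding trie_def by blast+

lemma wp_trie_step:
  fixes s :: machine and nodes :: "bool list list" and b :: bool
  assumes t: "trie s nodes" and x: "regs s rNode < length nodes"
  defines "w \<equiv> nodes ! regs s rNode @ [b]"
  defines "nodes' \<equiv> (if w \<in> set nodes then nodes else nodes @ [w])"
  shows "wp (trie_step b) 40 (\<lambda>_ s'. trie s' nodes' \<and> regs s' rNode < length nodes' \<and>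
    nodes' ! regs s' rNode = w \<and> regs s' rNew = (if w \<in> set nodes then regs s rNew else 1)) s"
proof (cases "w \<in> set nodes")
  case True
  then obtain y where y: "y < length nodes" "nodes ! y = w" by (auto simp: in_set_conv_nth)
  then have m: "mem s (child b) (regs s rNode) = y" using trie_child(1)[OF t x] unfolding w_def by blast
  have "nodes ! 0 = []" using t unfolding trie_def by blast
  then have "y \<noteq> 0" using y(2) by (metis w_def append_is_Nil_conv not_Cons_self2)
  moreover have "trie (s\<lparr>regs := (regs s)(rNode := y)\<rparr>) nodes" by (rule trie_cong[OF t]) simp_all
  ultimately show ?thesis
    unfolding trie_step_def using True y m by (simp add: wp_simps budget_simps nodes'_def)
next
  case False
  let ?x = "regs s rNode" and ?f = "length nodes"
  let ?s = "s\<lparr>regs := (regs s)(rFresh := Suc ?f, rNew := 1, rNode := ?f),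
    mem := (mem s)(child b := (mem s (child b))(?x := ?f), aTP := (mem s aTP)(?f := ?x),
      aTB := (mem s aTB)(?f := of_bool b))\<rparr>"
  have f: "regs s rFresh = ?f" "mem s (child b) ?x = 0"
    using t trie_child(2)[OF t x] False unfolding w_def by (simp_all add: trie_def)
  have ne: "?f \<noteq> ?x" using x by simp
  have tr: "trie ?s (nodes @ [w])"
    unfolding trie_def
  proof (intro conjI allI impI)
    show "distinct (nodes @ [w])" using t False by (simp add: trie_def)
    show "(nodes @ [w]) ! 0 = []" using t by (simp add: trie_def nth_append)
    fix z v c assume z: "z < length (nodes @ [w])" "(nodes @ [w]) ! z = v @ [c]"
    have "mem ?s aTP z < ?f + 1 \<and> (nodes @ [w]) ! mem ?s aTP z = v \<and> mem ?s aTB z = of_bool c"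
    proof (cases "z = ?f")
      case True
      then show ?thesis using z x by (simp add: w_def nth_append)
    next
      case False
      then have "z < ?f" "nodes ! z = v @ [c]" using z by (auto simp: nth_append)
      then show ?thesis using trie_parent[OF t, of z v c] False by (simp add: nth_append)
    qed
    then show "mem ?s aTP z < length (nodes @ [w])" "(nodes @ [w]) ! mem ?s aTP z = v" "mem ?s aTB z = of_bool c"
      by simp_all
  next
    fix c z y assume a: "z < length (nodes @ [w])" "y < length (nodes @ [w])"
      "(nodes @ [w]) ! y = (nodes @ [w]) ! z @ [c]"
    \<comment> \<open>The new node has no child: an older node extending \<open>w\<close> would have
      a parent labelled \<open>w\<close>, but \<open>w\<close> was missing.\<close>
    have nz: "z \<noteq> ?f"
    proof
      assume z: "z = ?f"
      then have "y < ?f" "nodes ! y = w @ [c]" using a by (auto simp: nth_append split: if_splits)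
      then have "w \<in> set nodes" using trie_parent[OF t, of y w c] by (metis nth_mem)
      then show False using False by simp
    qed
    then have z: "z < ?f" "(nodes @ [w]) ! z = nodes ! z" using a(1) by (auto simp: nth_append)
    show "mem ?s (child c) z = y"
    proof (cases "y = ?f")
      case True
      then have "nodes ! z = nodes ! ?x" "c = b" using a(3) z by (auto simp: w_def)
      then have "z = ?x" using t z(1) x by (auto simp: trie_def nth_eq_iff_index_eq)
      then show ?thesis using True \<open>c = b\<close> by auto
    next
      case y: False
      then have y: "y < ?f" "nodes ! y = nodes ! z @ [c]" using a z by (auto simp: nth_append split: if_splits)
      then have "mem s (child c) z = y" using trie_child(1)[OF t] z(1) by blast
      moreover have "\<not> (c = b \<and> z = ?x)"
      proof
        assume "c = b \<and> z = ?x"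
        then have "nodes ! y = w" using y(2) unfolding w_def by blast
        then show False using nth_mem[OF y(1)] False by simp
      qed
      ultimately show ?thesis by auto
    qed
  next
    fix c z assume a: "z < length (nodes @ [w])" "(nodes @ [w]) ! z @ [c] \<notin> set (nodes @ [w])"
    show "mem ?s (child c) z = 0"
    proof (cases "z = ?f")
      case True
      then have "mem s (child c) z = 0" using trie_child(3)[OF t] by simp
      then show ?thesis using True ne by auto
    next
      case False
      then have z: "z < ?f" "nodes ! z @ [c] \<notin> set nodes" "nodes ! z @ [c] \<noteq> w"
        using a by (auto simp: nth_append)
      then have "mem s (child c) z = 0" using trie_child(2)[OF t] by blast
      moreover have "\<not> (c = b \<and> z = ?x)" using z(3) unfolding w_def by blast
      ultimately show ?thesis by auto
    qed
  next
    fix c z assume "length (nodes @ [w]) \<le> z"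
    moreover from this have "mem s (child c) z = 0" using trie_child(3)[OF t] by simp
    ultimately show "mem ?s (child c) z = 0" using x by auto
  qed (use t in \<open>simp_all add: trie_def\<close>)
  show ?thesis
    unfolding trie_step_def wp_Seq wp_Cond wp_Skip wp_Assign wp_Store
    using False f tr ne by (cases b) (simp_all add: budget_simps nodes'_def fun_upd_twist update_mem_regs)
qed

section \<open>Solutions as 0-1 words in the trie\<close>

definition word :: "nat \<Rightarrow> nat set \<Rightarrow> bool list" where
  "word n B = map (\<lambda>u. u \<in> B) [0..<n]"

lemma word_length [simp]: "length (word n B) = n"
  by (simp add: word_def)

lemma word_nth: "u < n \<Longrightarrow> word n B ! u = (u \<in> B)"
  by (simp add: word_def)

lemma word_inj: "word n A = word n B \<Longrightarrow> A \<subseteq> {..<n} \<Longrightarrow> B \<subseteq> {..<n} \<Longrightarrow> A = B"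
  by (auto simp: word_def)

lemma take_Suc_word: "j < n \<Longrightarrow> take (Suc j) (word n B) = take j (word n B) @ [j \<in> B]"
  by (simp add: take_Suc_conv_app_nth word_nth)

text \<open>Only words of full length represent sets; the inner nodes carry shorter words and do not
  count.\<close>

definition sols :: "nat \<Rightarrow> bool list list \<Rightarrow> nat set set" where
  "sols n nodes = {B. B \<subseteq> {..<n} \<and> word n B \<in> set nodes}"

lemma trie_prefix_closed:
  assumes "trie s nodes" "w @ [b] \<in> set nodes"
  shows "w \<in> set nodes"
proof -
  obtain x where "x < length nodes" "nodes ! x = w @ [b]" using assms(2) by (auto simp: in_set_conv_nth)
  then show ?thesis using trie_parent[OF assms(1)] by (metis nth_mem)
qed

context adj_graph
begin

text \<open>New nodes are appended as \<open>ext\<close>, so existing nodes keep their numbers and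
  the leaves recorded on the stack stay valid.\<close>

lemma wp_insert_prog:
  assumes "has_input adj s" "trie s nodes" "flags n (mem s aSX) X" "flags n (mem s aSY) Y" "X \<union> Y \<subseteq> {..<n}"
    and exit: "\<And>c' s' ext. same insert_prog s s' \<Longrightarrow> trie s' (nodes @ ext) \<Longrightarrow>
      regs s' rNode < length (nodes @ ext) \<Longrightarrow> (nodes @ ext) ! regs s' rNode = word n (X \<union> Y) \<Longrightarrow>
      sols n (nodes @ ext) = insert (X \<union> Y) (sols n nodes) \<Longrightarrow>
      regs s' rNew = (if X \<union> Y \<in> sols n nodes then 0 else 1) \<Longrightarrow>
      c - 100 * (1 + sz) \<le> c' \<Longrightarrow> Q c' s'"
    and budget: "100 * (1 + sz) \<le> c"
  shows "wp insert_prog c Q s"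
proof -
  let ?w = "word n (X \<union> Y)"
  let ?I = "\<lambda>j s'. \<exists>ext. trie s' (nodes @ ext) \<and> regs s' rNode < length (nodes @ ext) \<and>
    (nodes @ ext) ! regs s' rNode = take j ?w \<and> set (nodes @ ext) = set nodes \<union> (\<lambda>i. take i ?w) ` {..j} \<and>
    regs s' rNew = (if take j ?w \<in> set nodes then 0 else 1)"
  let ?q = "Cond (Cell aSX (Reg rJ)) (trie_step True)
       (Cond (Cell aSY (Reg rJ)) (trie_step True) (trie_step False))"
  have N: "regs s 0 = n" using assms(1) by (simp add: has_input_def)
  have sz: "n \<le> sz" by (simp add: sz_def)
  let ?s = "s\<lparr>regs := (regs s)(rNode := 0, rNew := 0)\<rparr>"
  have main: "wp (for_upto rJ ?q) (c - 4) (\<lambda>c' s'. ?I n s' \<and> c - 100 * (1 + sz) \<le> c') ?s"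
  proof (rule wp_for_upto[where I = ?I and b = 60])
    have t: "trie (?s\<lparr>regs := (regs ?s)(rJ := 0)\<rparr>) nodes"
      by (rule trie_cong[OF assms(2)]) simp_all
    have "0 < length nodes" "nodes ! 0 = []" using assms(2) unfolding trie_def by blast+
    moreover from this have "[] \<in> set nodes" by (metis nth_mem)
    ultimately show "?I 0 (?s\<lparr>regs := (regs ?s)(rJ := 0)\<rparr>)"
      using t by (intro exI[of _ "[]"]) auto
  next
    fix j s' assume j: "j < regs ?s 0" "?I j s'" "same (for_upto rJ ?q) ?s s'" "regs s' rJ = j"
    then obtain ext where e: "trie s' (nodes @ ext)" "regs s' rNode < length (nodes @ ext)"
      "(nodes @ ext) ! regs s' rNode = take j ?w" "set (nodes @ ext) = set nodes \<union> (\<lambda>i. take i ?w) ` {..j}"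
      "regs s' rNew = (if take j ?w \<in> set nodes then 0 else 1)" by blast
    have jn: "j < n" using j(1) N by simp
    define b where "b \<longleftrightarrow> j \<in> X \<union> Y"
    have w': "take (Suc j) ?w = take j ?w @ [b]" using take_Suc_word[OF jn] by (simp add: b_def)
    have "mem s' aSX j = (if j \<in> X then 1 else 0)" "mem s' aSY j = (if j \<in> Y then 1 else 0)"
      using flagsD[OF assms(3) jn] flagsD[OF assms(4) jn] j(3) by (simp_all add: same_def)
    note fl = this
    \<comment> \<open>Every extension of a missing prefix is missing too, so \<open>rNew\<close>
      never has to be reset.\<close>
    have pre: "take j ?w \<in> set nodes" if "take (Suc j) ?w \<in> set nodes"
      using trie_prefix_closed[OF assms(2)] that w' by metis
    have "wp (trie_step b) 40 (\<lambda>_ s''. ?I (Suc j) (s''\<lparr>regs := (regs s'')(rJ := Suc j)\<rparr>)) s'"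
    proof (rule wp_mono[OF wp_trie_step[OF e(1,2), of b]], unfold e(3) w'[symmetric])
      fix d s''
      let ?n = "if take (Suc j) ?w \<in> set (nodes @ ext) then nodes @ ext else (nodes @ ext) @ [take (Suc j) ?w]"
      assume a: "trie s'' ?n \<and> regs s'' rNode < length ?n \<and> ?n ! regs s'' rNode = take (Suc j) ?w \<and>
        regs s'' rNew = (if take (Suc j) ?w \<in> set (nodes @ ext) then regs s' rNew else 1)"
      define ext' where "ext' = (if take (Suc j) ?w \<in> set (nodes @ ext) then ext else ext @ [take (Suc j) ?w])"
      have n: "?n = nodes @ ext'" by (simp add: ext'_def)
      have "trie s'' (nodes @ ext')" using a unfolding n by blast
      then have t: "trie (s''\<lparr>regs := (regs s'')(rJ := Suc j)\<rparr>) (nodes @ ext')"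
        by (rule trie_cong) simp_all
      have st: "set (nodes @ ext') = set nodes \<union> (\<lambda>i. take i ?w) ` {..Suc j}"
        using e(4) unfolding ext'_def atMost_Suc by auto
      have ntk: "take (Suc j) ?w \<noteq> take i ?w" if "i \<le> j" for i
      proof
        assume "take (Suc j) ?w = take i ?w"
        then have "length (take (Suc j) ?w) = length (take i ?w)" by simp
        then show False using that jn by simp
      qed
      \<comment> \<open>The nodes added during this insertion are shorter prefixes, so being absent
        now is the same as being absent originally.\<close>
      have "take (Suc j) ?w \<in> set (nodes @ ext) \<longleftrightarrow> take (Suc j) ?w \<in> set nodes"
        unfolding e(4) using ntk by auto
      then have "regs s'' rNew = (if take (Suc j) ?w \<in> set nodes then 0 else 1)"
        using a e(5) pre by (auto split: if_splits)
      then show "?I (Suc j) (s''\<lparr>regs := (regs s'')(rJ := Suc j)\<rparr>)"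
        using t st a unfolding n by (intro exI[of _ ext']) simp
    qed
    then have st: "wp (trie_step b) m (\<lambda>_ s''. ?I (Suc j) (s''\<lparr>regs := (regs s'')(rJ := Suc j)\<rparr>)) s'"
      if "40 \<le> m" for m
      using that by (rule wp_budget)
    show "wp ?q 60 (\<lambda>_ s''. ?I (Suc j) (s''\<lparr>regs := (regs s'')(rJ := Suc j)\<rparr>)) s'"
    proof (cases "j \<in> X")
      case True
      then show ?thesis using st[of 57] fl j(4) unfolding wp_Cond[of "Cell aSX (Reg rJ)"]
        by (simp add: b_def budget_simps)
    next
      case False
      then show ?thesis using st[of 54] fl j(4) unfolding wp_Cond
        by (auto simp: b_def budget_simps)
    qed
  next
    fix c' s' assume a: "?I (regs ?s 0) s'" "c - 4 - (60 + 10) * (1 + regs ?s 0) \<le> c'"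
    have "c - 100 * (1 + sz) \<le> c'" using a(2) N sz by simp
    then show "?I n s' \<and> c - 100 * (1 + sz) \<le> c'" using a(1) N by simp
  qed (use N sz budget in auto)
  have main: "wp insert_prog c (\<lambda>c' s'. ?I n s' \<and> c - 100 * (1 + sz) \<le> c') s"
    unfolding insert_prog_def wp_Seq wp_Assign using main budget by (simp add: budget_simps)
  show ?thesis
  proof (rule wp_frame, rule wp_mono[OF main], intro impI)
    fix c' s' assume a: "?I n s' \<and> c - 100 * (1 + sz) \<le> c'" "same insert_prog s s'"
    then obtain ext where e: "trie s' (nodes @ ext)" "regs s' rNode < length (nodes @ ext)"
      "(nodes @ ext) ! regs s' rNode = ?w" "set (nodes @ ext) = set nodes \<union> (\<lambda>i. take i ?w) ` {..n}"
      "regs s' rNew = (if ?w \<in> set nodes then 0 else 1)" by auto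
    have "B \<in> sols n (nodes @ ext) \<longleftrightarrow> B \<in> insert (X \<union> Y) (sols n nodes)" for B
    proof (cases "B \<subseteq> {..<n}")
      case True
      have "i = n" if "word n B = take i ?w" "i \<le> n" for i
        using arg_cong[OF that(1), of length] that(2) by simp
      then have "word n B \<in> (\<lambda>i. take i ?w) ` {..n} \<longleftrightarrow> word n B = ?w" by force
      then show ?thesis
        using True assms(5) word_inj[of n B "X \<union> Y"] unfolding sols_def e(4) by blast
    next
      case False
      then show ?thesis using assms(5) by (auto simp: sols_def)
    qed
    then have "sols n (nodes @ ext) = insert (X \<union> Y) (sols n nodes)" by blast
    moreover have "X \<union> Y \<in> sols n nodes \<longleftrightarrow> ?w \<in> set nodes" using assms(5) by (simp add: sols_def)
    ultimately show "Q c' s'" using exit[OF a(2) e(1-3)] e(5) a(1) by simp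
  qed
qed

lemma wp_decode_prog:
  assumes "has_input adj s" "trie s nodes" "mem s aKId (regs s rDep) < length nodes"
    "nodes ! mem s aKId (regs s rDep) = word n B" "B \<subseteq> {..<n}" "B \<noteq> {}"
    and exit: "\<And>c' s'. same decode_prog s s' \<Longrightarrow> flags n (mem s' aAl) B \<Longrightarrow> regs s' rX = Min B \<Longrightarrow>
      c - 100 * (1 + sz) \<le> c' \<Longrightarrow> Q c' s'"
    and budget: "100 * (1 + sz) \<le> c"
  shows "wp decode_prog c Q s"
proof -
  let ?R = "c - 100 * (1 + sz)"
  let ?s = "s\<lparr>regs := (regs s)(rNode := mem s aKId (regs s rDep), rJ := n)\<rparr>"
  let ?q = "Seq (Assign rJ (Minus (Reg rJ) (Const 1)))
       (Seq (Store aAl (Reg rJ) (Cell aTB (Reg rNode)))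
       (Seq (Cond (Cell aTB (Reg rNode)) (Assign rX (Reg rJ)) Skip)
         (Assign rNode (Cell aTP (Reg rNode)))))"
  let ?I = "\<lambda>c' s'. \<exists>j. j \<le> n \<and> regs s' rJ = j \<and> regs s' rNode < length nodes \<and>
    nodes ! regs s' rNode = take j (word n B) \<and> (\<forall>u. j \<le> u \<longrightarrow> u < n \<longrightarrow> mem s' aAl u = (if u \<in> B then 1 else 0)) \<and>
    (B \<inter> {j..} \<noteq> {} \<longrightarrow> regs s' rX = Min (B \<inter> {j..})) \<and> ?R + 30 * j + 10 \<le> c'"
  have fB: "finite B" using assms(5) finite_subset by auto
  have N: "regs s 0 = n" using assms(1) by (simp add: has_input_def)
  have sz: "n \<le> sz" by (simp add: sz_def)
  have "wp (While (Reg rJ) ?q) (c - 5) (\<lambda>c' s'. (flags n (mem s' aAl) B \<and> regs s' rX = Min B) \<and> ?R \<le> c') ?s"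
  proof (rule wp_While[where I = ?I])
    show "?I (c - 5) ?s" using assms(3-5) sz budget by auto
  next
    fix c' s' assume h: "?I c' s'" "same ?q ?s s'"
    then obtain j where j: "j \<le> n" "regs s' rJ = j" "regs s' rNode < length nodes"
      "nodes ! regs s' rNode = take j (word n B)" "\<forall>u. j \<le> u \<longrightarrow> u < n \<longrightarrow> mem s' aAl u = (if u \<in> B then 1 else 0)"
      "B \<inter> {j..} \<noteq> {} \<longrightarrow> regs s' rX = Min (B \<inter> {j..})" "?R + 30 * j + 10 \<le> c'" by blast
    { assume "eval s' (Reg rJ) = 0"
      then have "j = 0" using j(2) by simp
      then show "Suc (cost (Reg rJ)) \<le> c' \<and>
          ((flags n (mem s' aAl) B \<and> regs s' rX = Min B) \<and> ?R \<le> c' - Suc (cost (Reg rJ)))"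
        using j assms(6) by (auto simp: flags_def atLeast_0) }
    assume "eval s' (Reg rJ) \<noteq> 0"
    then obtain i where i: "j = Suc i" using j(2) by (metis eval.simps(2) not0_implies_Suc)
    have t: "trie s' nodes" by (rule trie_cong[OF assms(2)]) (use h(2) in \<open>simp_all add: same_def\<close>)
    have w: "nodes ! regs s' rNode = take i (word n B) @ [i \<in> B]"
      using j(1,4) take_Suc_word[of i n B] by (simp add: i)
    note p = trie_parent[OF t j(3) w]
    let ?s' = "s'\<lparr>regs := (regs s')(rJ := i, rX := (if i \<in> B then i else regs s' rX), rNode := mem s' aTP (regs s' rNode)),
      mem := (mem s')(aAl := (mem s' aAl)(i := of_bool (i \<in> B)))\<rparr>"
    have dec: "B \<inter> {i..} = (if i \<in> B then insert i (B \<inter> {j..}) else B \<inter> {j..})"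
      unfolding i by (auto simp: le_Suc_eq Suc_le_eq order_le_less)
    have mn: "B \<inter> {i..} \<noteq> {} \<longrightarrow> regs ?s' rX = Min (B \<inter> {i..})"
    proof (cases "i \<in> B")
      case True
      have "Min (B \<inter> {i..}) = i" by (rule Min_eqI) (use True fB in auto)
      then show ?thesis using True by simp
    next
      case False
      then show ?thesis using j(6) unfolding dec by simp
    qed
    have c': "?R + 30 * i + 40 \<le> c'" using j(7) i by simp
    have al: "\<forall>u. i \<le> u \<longrightarrow> u < n \<longrightarrow> mem ?s' aAl u = (if u \<in> B then 1 else 0)"
      using j(5) i by (simp add: Suc_le_eq)
    have fin: "?I (c' - 30) ?s'"
      using j(1) i p c' mn al by (intro exI[of _ i]) simp
    have fin': "?I (c' - m) ?s'" if "m \<le> 30" for m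
    proof -
      have "c' - 30 \<le> c' - m" using that by simp
      then show ?thesis using fin by (meson le_trans)
    qed
    have ge: "40 \<le> c'" using c' by simp
    show "Suc (cost (Reg rJ)) \<le> c' \<and> wp ?q (c' - Suc (cost (Reg rJ))) ?I s'"
    proof (cases "i \<in> B")
      case True
      then show ?thesis using fin'[of 18] j(2) i p(3) ge
        by (simp add: wp_simps budget_simps fun_upd_twist update_mem_regs)
    next
      case False
      then show ?thesis using fin'[of 17] j(2) i p(3) ge
        by (simp add: wp_simps budget_simps fun_upd_twist update_mem_regs)
    qed
  qed
  then have main: "wp decode_prog c (\<lambda>c' s'. (flags n (mem s' aAl) B \<and> regs s' rX = Min B) \<and> ?R \<le> c') s"
    unfolding decode_prog_def wp_Seq wp_Assign using N budget by (simp add: budget_simps)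
  show ?thesis
    by (rule wp_frame, rule wp_mono[OF main]) (use exit in blast)
qed

lemma wp_cand_prog:
  assumes "has_input adj s" "regs s rW = v" "v < n" "flags n (mem s aAl) A"
    "flags n (mem s aSX) X" "flags n (mem s aSY) Y"
    and exit: "\<And>c' s'. same cand_prog s s' \<Longrightarrow>
      flags n (mem s' aAl) (if v \<in> A then A else A - (nbhd G v \<inter> (if regs s rI = 0 then X else Y))) \<Longrightarrow>
      c - 100 * (1 + sz) \<le> c' \<Longrightarrow> Q c' s'"
    and budget: "100 * (1 + sz) \<le> c"
  shows "wp cand_prog c Q s"
proof -
  let ?S = "if regs s rI = 0 then X else Y"
  let ?q = "Cond (Reg rI) (Cond (Cell aSY (Reg rU)) (Store aAl (Reg rU) (Const 0)) Skip)
       (Cond (Cell aSX (Reg rU)) (Store aAl (Reg rU) (Const 0)) Skip)"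
  let ?I = "\<lambda>k s'. flags n (mem s' aAl) (A - (set (take k (adj ! v)) \<inter> ?S))"
  let ?T = "\<lambda>c' s'. flags n (mem s' aAl) (if v \<in> A then A else A - (nbhd G v \<inter> ?S)) \<and> c - 100 * (1 + sz) \<le> c'"
  have deg: "length (adj ! v) \<le> sz"
    using member_le_sum_list[of "length (adj ! v)" "map length adj"] assms(3)
    by (simp add: sz_def length_concat)
  have loop: "wp (each_nbr rW rP rU ?q) (c - 3) ?T s" if "v \<notin> A"
  proof (rule wp_each_nbr[where I = ?I and b = 20 and v = v])
    fix k y and s' :: machine
    assume k: "k < length (adj ! v)" "?I k s'" "same (each_nbr rW rP rU ?q) s s'"
    have u: "adj ! v ! k < n" using k(1) nth_mem adj_nbhd[OF assms(3)] nbhd_less by blast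
    have st: "set (take (Suc k) (adj ! v)) = insert (adj ! v ! k) (set (take k (adj ! v)))"
      using k(1) by (simp add: take_Suc_conv_app_nth)
    have f: "regs s' rI = regs s rI" "mem s' aSX = mem s aSX" "mem s' aSY = mem s aSY"
      using k(3) by (simp_all add: same_def)
    show "wp ?q 20 (\<lambda>_. ?I (Suc k)) (s'\<lparr>regs := (regs s')(rU := adj ! v ! k, rP := y)\<rparr>)"
      using k(2) flagsD[OF assms(5) u] flagsD[OF assms(6) u] u unfolding st
      by (auto simp: wp_simps budget_simps f flags_def)
  next
    fix c' s' assume a: "?I (length (adj ! v)) s'" "c - 3 - (20 + 20) * (1 + length (adj ! v)) \<le> c'"
    show "?T c' s'" using a deg that adj_nbhd[OF assms(3)] by simp
  qed (use assms deg budget in auto)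
  have main: "wp cand_prog c ?T s"
  proof (cases "v \<in> A")
    case True
    then show ?thesis unfolding cand_prog_def wp_Cond[of "Cell aAl (Reg rW)"] wp_Skip
      using flagsD[OF assms(4,3)] assms(2,4) budget by (simp add: budget_simps) arith
  next
    case False
    then show ?thesis unfolding cand_prog_def wp_Cond[of "Cell aAl (Reg rW)"]
      using flagsD[OF assms(4,3)] assms(2) loop budget by (simp add: budget_simps)
  qed
  show ?thesis
    by (rule wp_frame, rule wp_mono[OF main]) (use exit in blast)
qed

text \<open>In units of \<open>1 + sz\<close>, the parts take at most 100 for the initialisation,
  200 for each of the two growths, 13 for allowing all vertices and 100 for the trie.\<close>

lemma wp_search_prog:
  assumes "has_input adj s" "trie s nodes" "flags n (mem s aAl) A" "A \<subseteq> {..<n}" "regs s rX = v" "v < n"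
    "bipartite (with_proj G \<restriction> insert v A)"
  defines "Z \<equiv> saturate (cc G v (insert v A))"
  assumes exit: "\<And>c' s' ext. same search_prog s s' \<Longrightarrow> trie s' (nodes @ ext) \<Longrightarrow>
      regs s' rNode < length (nodes @ ext) \<Longrightarrow> (nodes @ ext) ! regs s' rNode = word n Z \<Longrightarrow>
      sols n (nodes @ ext) = insert Z (sols n nodes) \<Longrightarrow>
      regs s' rNew = (if Z \<in> sols n nodes then 0 else 1) \<Longrightarrow> c - 700 * (1 + sz) \<le> c' \<Longrightarrow> Q c' s'"
    and budget: "700 * (1 + sz) \<le> c"
  shows "wp search_prog c Q s"
proof -
  let ?C = "cc G v (insert v A)"
  have N: "regs s 0 = n" using assms(1) by (simp add: has_input_def)
  have sz: "n \<le> sz" by (simp add: sz_def)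
  let ?T = "\<lambda>c' s'. (\<exists>ext. trie s' (nodes @ ext) \<and> regs s' rNode < length (nodes @ ext) \<and>
      (nodes @ ext) ! regs s' rNode = word n Z \<and> sols n (nodes @ ext) = insert Z (sols n nodes) \<and>
      regs s' rNew = (if Z \<in> sols n nodes then 0 else 1)) \<and> c - 700 * (1 + sz) \<le> c'"
  have main: "wp search_prog c ?T s"
    unfolding search_prog_def wp_Seq
  proof (rule wp_init_prog[OF assms(1,5,6)])
    fix c1 s1 assume 1: "same init_prog s s1" "coloured s1 {v} {v} {}" "c - 100 * (1 + sz) \<le> c1"
    have in1: "has_input adj s1" by (rule has_input_same[OF assms(1) 1(1)]) auto
    have al1: "flags n (mem s1 aAl) A" using assms(3) 1(1) by (simp add: same_def)
    have t1: "trie s1 nodes" by (rule trie_cong[OF assms(2)]) (use 1(1) in \<open>simp_all add: same_def\<close>)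
    show "wp grow_prog c1 (\<lambda>c s. wp (for_upto rJ (Store aAl (Reg rJ) (Const 1))) c
      (\<lambda>c s. wp grow_prog c (\<lambda>c s. wp insert_prog c ?T s) s) s) s1"
    proof (rule wp_grow_prog[OF in1 1(2) al1], unfold greedy_eq_cc[OF assms(6,4,7)])
      fix c2 s2 X Y assume 2: "same grow_prog s1 s2" "coloured s2 ?C X Y" "c1 - 200 * (1 + sz) \<le> c2"
      have in2: "has_input adj s2" by (rule has_input_same[OF in1 2(1)]) auto
      then have N2: "regs s2 0 = n" by (simp add: has_input_def)
      have t2: "trie s2 nodes" by (rule trie_cong[OF t1]) (use 2(1) in \<open>simp_all add: same_def\<close>)
      show "wp (for_upto rJ (Store aAl (Reg rJ) (Const 1))) c2
        (\<lambda>c s. wp grow_prog c (\<lambda>c s. wp insert_prog c ?T s) s) s2"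
      proof (rule wp_for_upto[where I = "\<lambda>i s'. \<forall>j<i. mem s' aAl j = 1" and b = 3])
        show "(3 + 10) * (1 + regs s2 0) \<le> c2" using 1(3) 2(3) budget sz N2 by simp
      next
        fix c3 s3 assume 3: "\<forall>j<regs s2 0. mem s3 aAl j = 1"
          "same (for_upto rJ (Store aAl (Reg rJ) (Const 1))) s2 s3" "c2 - (3 + 10) * (1 + regs s2 0) \<le> c3"
        have in3: "has_input adj s3" by (rule has_input_same[OF in2 3(2)]) auto
        have al3: "flags n (mem s3 aAl) {..<n}" using 3(1) N2 by (simp add: flags_def)
        have col3: "coloured s3 ?C X Y" using 2(2) 3(2) by (simp add: coloured_def same_def)
        have t3: "trie s3 nodes" by (rule trie_cong[OF t2]) (use 3(2) in \<open>simp_all add: same_def\<close>)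
        show "wp grow_prog c3 (\<lambda>c s. wp insert_prog c ?T s) s3"
        proof (rule wp_grow_prog[OF in3 col3 al3], unfold saturate_def[symmetric] Z_def[symmetric])
          fix c4 s4 X' Y' assume 4: "same grow_prog s3 s4" "coloured s4 Z X' Y'" "c3 - 200 * (1 + sz) \<le> c4"
          have in4: "has_input adj s4" by (rule has_input_same[OF in3 4(1)]) auto
          have t4: "trie s4 nodes" by (rule trie_cong[OF t3]) (use 4(1) in \<open>simp_all add: same_def\<close>)
          have Z: "X' \<union> Y' = Z" "Z \<subseteq> {..<n}" "flags n (mem s4 aSX) X'" "flags n (mem s4 aSY) Y'"
            using 4(2) by (auto simp: coloured_def bip_iff)
          show "wp insert_prog c4 ?T s4"
          proof (rule wp_insert_prog[OF in4 t4 Z(3,4)], unfold Z(1))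
            fix c5 s5 ext assume 5: "trie s5 (nodes @ ext)" "regs s5 rNode < length (nodes @ ext)"
              "(nodes @ ext) ! regs s5 rNode = word n Z" "sols n (nodes @ ext) = insert Z (sols n nodes)"
              "regs s5 rNew = (if Z \<in> sols n nodes then 0 else 1)" "c4 - 100 * (1 + sz) \<le> c5"
            have "c - 700 * (1 + sz) \<le> c5" using 1(3) 2(3) 3(3) 4(3) 5(6) N2 sz by simp
            then show "?T c5 s5" using 5 by blast
          qed (use Z 1(3) 2(3) 3(3) 4(3) N2 sz budget in auto)
        qed (use 1(3) 2(3) 3(3) N2 sz budget in simp)
      qed (auto simp: wp_simps budget_simps less_Suc_eq)
    qed (use 1(3) budget in simp)
  qed (use budget in simp)
  show ?thesis
    by (rule wp_frame, rule wp_mono[OF main]) (use exit in blast)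
qed

end


section \<open>One iteration of the main loop\<close>

definition print_prog :: prog where
  "print_prog = Seq (for_upto rJ (Cond (Cell aAl (Reg rJ)) (Print (Reg rJ)) Skip)) Finish"

definition push_prog :: prog where
  "push_prog = Seq (Assign rDep (Succ (Reg rDep))) (Seq (Store aKId (Reg rDep) (Reg rNode))
     (Seq (Store aKV (Reg rDep) (Const 0)) (Seq (Store aKI (Reg rDep) (Const 0))
       (Assign rPar (Minus (Const 1) (Reg rPar))))))"

definition pop_prog :: prog where
  "pop_prog = Seq (Assign rDep (Minus (Reg rDep) (Const 1))) (Assign rPar (Minus (Const 1) (Reg rPar)))"

definition explore_prog :: prog where
  "explore_prog = Seq search_prog (Cond (Reg rNew) push_prog Skip)"

text \<open>The successor of \<open>k\<close> in its representation by \<open>k div 2\<close> and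
  \<open>k mod 2\<close>; \<open>rV\<close> still holds the old \<open>k div 2\<close>.\<close>

definition advance_prog :: prog where
  "advance_prog = Cond (Reg rI)
     (Seq (Store aKI (Reg rDep) (Const 0)) (Store aKV (Reg rDep) (Succ (Reg rV))))
     (Store aKI (Reg rDep) (Const 1))"

text \<open>Neighbours are counted from \<open>k = 2\<close>, hence the vertex
  \<open>k div 2 - 1\<close>. The frame is advanced before the exploration, so that a pushed child
  returns to a parent that already points to its next neighbour.\<close>

definition proc_prog :: prog where
  "proc_prog = Seq init_prog (Seq grow_prog (Seq (Assign rW (Minus (Reg rV) (Const 1))) (Seq cand_prog
     (Seq advance_prog (Seq (Assign rX (Reg rW)) explore_prog)))))"

text \<open>Writing 1 to \<open>aKV\<close> while \<open>aKI\<close> is 0 moves \<open>k\<close>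
  from 0 to 2. The value \<open>k = 1\<close> never occurs, so \<open>rV = 0\<close> alone marks a
  call that is about to start.\<close>

definition first_prog :: prog where
  "first_prog = Seq (Cond (Reg rPar) print_prog Skip) (Store aKV (Reg rDep) (Const 1))"

definition last_prog :: prog where
  "last_prog = Seq (Cond (Reg rPar) Skip print_prog) pop_prog"

definition load_prog :: prog where
  "load_prog = Seq (Assign rV (Cell aKV (Reg rDep))) (Seq (Assign rI (Cell aKI (Reg rDep))) decode_prog)"

text \<open>\<open>rV\<close> is \<open>n + 1\<close> exactly when all \<open>2 * n\<close>
  neighbours have been handled; the inner test is then zero.\<close>

definition body_prog :: prog where
  "body_prog = Seq load_prog
     (Cond (Reg rV) (Cond (Minus (Succ (Reg 0)) (Reg rV)) proc_prog last_prog) first_prog)"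

text \<open>Zero-initialised memory already encodes an empty stack, the trie consisting of the root,
  the start vertex 0 and no allowed vertices, so \<open>explore_prog\<close> finds and pushes a
  first solution.\<close>

definition main_prog :: prog where
  "main_prog = Seq (Assign rFresh (Const 1)) (Seq explore_prog (While (Reg rDep) body_prog))"

lemma load_prog_writes [simp]:
  "wr load_prog = {rV, rI, rNode, rJ, rX}" "wa load_prog = {aAl}"
  by (auto simp: load_prog_def)

text \<open>The variant of \<open>wp\<close> for an execution that outputs exactly one item, \<open>B\<close>.\<close>

definition wp_out :: "nat set \<Rightarrow> prog \<Rightarrow> nat \<Rightarrow> (machine \<Rightarrow> bool) \<Rightarrow> machine \<Rightarrow> bool" where
  "wp_out B p c Q s \<longleftrightarrow> (\<exists>k b j s'. exec p s (ticks k @ b @ Done # ticks j) s' \<and>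
     k + length b + 1 + j \<le> c \<and> Done \<notin> set b \<and> {v. Out v \<in> set b} = B \<and> Q s')"

lemma wp_out_after:
  assumes "wp p c1 (\<lambda>_. wp_out B q c2 Q) s"
  shows "wp_out B (Seq p q) (c1 + c2) Q s"
proof -
  obtain a s1 k b j s2 where "exec p s (ticks a) s1" "a \<le> c1" "exec q s1 (ticks k @ b @ Done # ticks j) s2"
    "k + length b + 1 + j \<le> c2" "Done \<notin> set b" "{v. Out v \<in> set b} = B" "Q s2"
    using assms unfolding wp_def wp_out_def by blast
  moreover from this have "exec (Seq p q) s (ticks (a + k) @ b @ Done # ticks j) s2"
    using exec.intros(6) by (metis append.assoc ticks_append)
  ultimately show ?thesis
    unfolding wp_out_def by (intro exI[of _ "a + k"] exI[of _ b] exI[of _ j] exI[of _ s2]) auto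
qed

lemma wp_out_before:
  assumes "wp_out B p c1 (wp q c2 (\<lambda>_. Q)) s"
  shows "wp_out B (Seq p q) (c1 + c2) Q s"
proof -
  obtain a s1 k b j s2 where "exec q s1 (ticks a) s2" "a \<le> c2" "exec p s (ticks k @ b @ Done # ticks j) s1"
    "k + length b + 1 + j \<le> c1" "Done \<notin> set b" "{v. Out v \<in> set b} = B" "Q s2"
    using assms unfolding wp_def wp_out_def by blast
  moreover from this have "exec (Seq p q) s (ticks k @ b @ Done # ticks (j + a)) s2"
    using exec.intros(6)[of p s "ticks k @ b @ Done # ticks j" s1 q "ticks a" s2] by (simp add: ticks_append)
  ultimately show ?thesis
    unfolding wp_out_def by (intro exI[of _ k] exI[of _ b] exI[of _ "j + a"] exI[of _ s2]) auto
qed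

lemma wp_out_Cond:
  assumes "wp_out B (if eval s e \<noteq> 0 then p else q) c Q s"
  shows "wp_out B (Cond e p q) (Suc (cost e) + c) Q s"
proof -
  obtain k b j s' where "exec (if eval s e \<noteq> 0 then p else q) s (ticks k @ b @ Done # ticks j) s'"
    "k + length b + 1 + j \<le> c" "Done \<notin> set b" "{v. Out v \<in> set b} = B" "Q s'"
    using assms unfolding wp_out_def by blast
  moreover from this have "exec (Cond e p q) s (ticks (Suc (cost e)) @ ticks k @ b @ Done # ticks j) s'"
    using exec.intros(7,8) by (cases "eval s e \<noteq> 0") auto
  ultimately show ?thesis
    unfolding wp_out_def
    by (intro exI[of _ "Suc (cost e) + k"] exI[of _ b] exI[of _ j] exI[of _ s'])
      (auto simp: ticks_append[symmetric])
qed

lemma wp_out_mono: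
  assumes "wp_out B p c Q s" "c \<le> c'" "\<And>s'. Q s' \<Longrightarrow> Q' s'"
  shows "wp_out B p c' Q' s"
proof -
  obtain k b j s' where "exec p s (ticks k @ b @ Done # ticks j) s'"
    "k + length b + 1 + j \<le> c" "Done \<notin> set b" "{v. Out v \<in> set b} = B" "Q s'"
    using assms(1) unfolding wp_out_def by blast
  moreover from this have "k + length b + 1 + j \<le> c'" "Q' s'" using assms(2,3) by auto
  ultimately show ?thesis unfolding wp_out_def by blast
qed

primrec frames :: "nat \<Rightarrow> machine \<Rightarrow> bool list list \<Rightarrow> (nat set \<times> nat) list \<Rightarrow> bool" where
  "frames n s nodes [] = True"
| "frames n s nodes (f # fs) =
    (mem s aKId (Suc (length fs)) < length nodes \<and>
     nodes ! mem s aKId (Suc (length fs)) = word n (fst f) \<and>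
     mem s aKV (Suc (length fs)) = snd f div 2 \<and> mem s aKI (Suc (length fs)) = snd f mod 2 \<and>
     frames n s nodes fs)"

lemma frames_cong:
  "frames n s nodes fs \<Longrightarrow>
    (\<And>d. d \<le> length fs \<Longrightarrow> mem s' aKId d = mem s aKId d \<and> mem s' aKV d = mem s aKV d \<and> mem s' aKI d = mem s aKI d) \<Longrightarrow>
    frames n s' (nodes @ ext) fs"
  by (induct fs) (simp_all add: nth_append)

section \<open>The stack as an image of the recursion\<close>

context adj_graph
begin

text \<open>A stack frame \<open>(B, k)\<close> is a pending call \<open>enum(B)\<close>: for \<open>k = 0\<close> it is about to start, for
  \<open>2 \<le> k < 2 * n + 2\<close> it proceeds with neighbour \<open>k - 2\<close> of \<open>B\<close>, and for \<open>k = 2 * n + 2\<close> it is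
  about to return. The top of the stack is the head of the list.\<close>

definition rep :: "machine \<Rightarrow> (nat set \<times> nat) list \<Rightarrow> nat set set \<Rightarrow> bool" where
  "rep s fs \<S> \<longleftrightarrow> has_input adj s \<and> regs s rDep = length fs \<and> regs s rPar = length fs mod 2 \<and>
     (\<exists>nodes. trie s nodes \<and> frames n s nodes fs \<and> \<S> = sols n nodes)"

lemma rep_same:
  assumes "rep s fs \<S>" "same p s s'" "wr p \<inter> {0, rFresh, rDep, rPar} = {}"
    "wa p \<inter> {0, 1, aC0, aC1, aTP, aTB, aKId, aKV, aKI} = {}"
  shows "rep s' fs \<S>"
proof -
  obtain nodes where r: "has_input adj s" "regs s rDep = length fs" "regs s rPar = length fs mod 2"
    "trie s nodes" "frames n s nodes fs" "\<S> = sols n nodes" using assms(1) unfolding rep_def by blast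
  have f: "regs s' 0 = regs s 0" "regs s' rFresh = regs s rFresh" "regs s' rDep = regs s rDep"
    "regs s' rPar = regs s rPar" "mem s' 0 = mem s 0" "mem s' 1 = mem s 1" "mem s' aC0 = mem s aC0"
    "mem s' aC1 = mem s aC1" "mem s' aTP = mem s aTP" "mem s' aTB = mem s aTB"
    "mem s' aKId = mem s aKId" "mem s' aKV = mem s aKV" "mem s' aKI = mem s aKI"
    using assms(2-4) unfolding same_def by auto
  have "trie s' nodes" by (rule trie_cong[OF r(4)]) (simp_all add: f)
  moreover have "frames n s' (nodes @ []) fs" by (rule frames_cong[OF r(5)]) (simp add: f)
  moreover have "has_input adj s'" using r(1) f by (simp add: has_input_def)
  ultimately show ?thesis using r f unfolding rep_def by auto
qed

lemma wp_explore_prog: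
  assumes r: "rep s fs \<S>" and "flags n (mem s aAl) A" "A \<subseteq> {..<n}" "regs s rX = v" "v < n"
    "bipartite (with_proj G \<restriction> insert v A)"
  defines "Z \<equiv> saturate (cc G v (insert v A))"
  shows "wp explore_prog (800 * (1 + sz))
    (\<lambda>_ s'. if Z \<in> \<S> then rep s' fs \<S> else rep s' ((Z, 0) # fs) (insert Z \<S>)) s"
proof -
  let ?T = "\<lambda>_ s'. if Z \<in> \<S> then rep s' fs \<S> else rep s' ((Z, 0) # fs) (insert Z \<S>)"
  obtain nodes where r: "has_input adj s" "regs s rDep = length fs" "regs s rPar = length fs mod 2"
    "trie s nodes" "frames n s nodes fs" "\<S> = sols n nodes" using r unfolding rep_def by blast
  show ?thesis
    unfolding explore_prog_def wp_Seq[of search_prog]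
  proof (rule wp_search_prog[OF r(1,4) assms(2-6), folded Z_def])
    fix c s' ext assume a: "same search_prog s s'" "trie s' (nodes @ ext)" "regs s' rNode < length (nodes @ ext)"
      "(nodes @ ext) ! regs s' rNode = word n Z" "sols n (nodes @ ext) = insert Z (sols n nodes)"
      "regs s' rNew = (if Z \<in> sols n nodes then 0 else 1)"
      "800 * (1 + sz) - 700 * (1 + sz) \<le> c"
    have c: "100 \<le> c" using a(7) by simp
    have in': "has_input adj s'" by (rule has_input_same[OF r(1) a(1)]) auto
    have f: "regs s' rDep = length fs" "regs s' rPar = length fs mod 2" "mem s' aKId = mem s aKId"
      "mem s' aKV = mem s aKV" "mem s' aKI = mem s aKI"
      using a(1) r(2,3) by (simp_all add: same_def)
    have fr: "frames n s' (nodes @ ext) fs" by (rule frames_cong[OF r(5)]) (simp add: f)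
    show "wp (Cond (Reg rNew) push_prog Skip) c ?T s'"
    proof (cases "Z \<in> \<S>")
      case True
      then have "sols n (nodes @ ext) = \<S>" using a(5) r(6) by auto
      then have "rep s' fs \<S>" unfolding rep_def using in' f a(2) fr by blast
      then show ?thesis using True a(6) r(6) c by (simp add: wp_simps budget_simps)
    next
      case False
      let ?d = "Suc (length fs)"
      let ?s = "s'\<lparr>regs := (regs s')(rDep := ?d, rPar := 1 - length fs mod 2),
        mem := (mem s')(aKId := (mem s' aKId)(?d := regs s' rNode), aKV := (mem s' aKV)(?d := 0),
          aKI := (mem s' aKI)(?d := 0))\<rparr>"
      have "trie ?s (nodes @ ext)" by (rule trie_cong[OF a(2)]) simp_all
      moreover have "frames n ?s ((nodes @ ext) @ []) fs" by (rule frames_cong[OF fr]) simp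
      moreover have "has_input adj ?s" using in' by (simp add: has_input_def)
      moreover have "1 - length fs mod 2 = Suc (length fs) mod 2" by presburger
      ultimately have "rep ?s ((Z, 0) # fs) (insert Z \<S>)"
        using a(3-5) r(6) by (auto simp: rep_def)
      then show ?thesis
        using False a(6) r(6) c f unfolding push_prog_def
        by (simp add: wp_simps budget_simps fun_upd_twist update_mem_regs)
    qed
  qed simp
qed

lemma wp_load_prog:
  assumes r: "rep s ((B, k) # fs) \<S>" "B \<subseteq> {..<n}" "B \<noteq> {}"
  shows "wp load_prog (150 * (1 + sz)) (\<lambda>_ s'. rep s' ((B, k) # fs) \<S> \<and> regs s' rV = k div 2 \<and>
    regs s' rI = k mod 2 \<and> flags n (mem s' aAl) B \<and> regs s' rX = Min B) s"
proof (rule wp_frame)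
  obtain nodes where r': "has_input adj s" "regs s rDep = Suc (length fs)"
    "trie s nodes" "frames n s nodes ((B, k) # fs)" using r(1) unfolding rep_def by auto
  let ?s = "s\<lparr>regs := (regs s)(rV := k div 2, rI := k mod 2)\<rparr>"
  have "wp decode_prog (150 * (1 + sz) - 6) (\<lambda>_ s'. same load_prog s s' \<longrightarrow> rep s' ((B, k) # fs) \<S> \<and> regs s' rV = k div 2 \<and>
    regs s' rI = k mod 2 \<and> flags n (mem s' aAl) B \<and> regs s' rX = Min B) ?s"
  proof (rule wp_decode_prog[where nodes = nodes and B = B])
    show "has_input adj ?s" using r'(1) by (simp add: has_input_def)
    show "trie ?s nodes" by (rule trie_cong[OF r'(3)]) simp_all
    fix c' s' assume a: "same decode_prog ?s s'" "flags n (mem s' aAl) B" "regs s' rX = Min B"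
    have "regs s' rV = k div 2" "regs s' rI = k mod 2" using a(1) by (simp_all add: same_def)
    moreover have "rep s' ((B, k) # fs) \<S>" if "same load_prog s s'"
      by (rule rep_same[OF r(1) that]) auto
    ultimately show "same load_prog s s' \<longrightarrow> rep s' ((B, k) # fs) \<S> \<and> regs s' rV = k div 2 \<and>
      regs s' rI = k mod 2 \<and> flags n (mem s' aAl) B \<and> regs s' rX = Min B" using a by blast
  qed (use r' assms in auto)
  then show "wp load_prog (150 * (1 + sz)) (\<lambda>_ s'. same load_prog s s' \<longrightarrow> rep s' ((B, k) # fs) \<S> \<and> regs s' rV = k div 2 \<and>
    regs s' rI = k mod 2 \<and> flags n (mem s' aAl) B \<and> regs s' rX = Min B) s"
    unfolding load_prog_def wp_Seq wp_Assign using r'(2,4) by (simp add: budget_simps)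
qed

lemma rep_advance:
  assumes "rep s ((B, k) # fs) \<S>"
    and "regs s' = regs s" "\<And>a. a \<notin> {aKV, aKI} \<Longrightarrow> mem s' a = mem s a"
    and "mem s' aKV = (mem s aKV)(Suc (length fs) := k' div 2)" "mem s' aKI = (mem s aKI)(Suc (length fs) := k' mod 2)"
  shows "rep s' ((B, k') # fs) \<S>"
proof -
  obtain nodes where r: "has_input adj s" "regs s rDep = Suc (length fs)" "regs s rPar = Suc (length fs) mod 2"
    "trie s nodes" "frames n s nodes ((B, k) # fs)" "\<S> = sols n nodes" using assms(1) unfolding rep_def by auto
  have "trie s' nodes" by (rule trie_cong[OF r(4)]) (simp_all add: assms)
  moreover have "frames n s nodes fs" using r(5) by simp
  then have "frames n s' (nodes @ []) fs" by (rule frames_cong) (simp add: assms)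
  moreover have "has_input adj s'" using r(1) assms(2,3) by (simp add: has_input_def)
  ultimately show ?thesis using r assms(2-5) unfolding rep_def by auto
qed

text \<open>The index encodes the vertex \<open>j div 2\<close> and, by its parity, the side losing
  the neighbours of that vertex. This fixes the order of the loop to be the one in which the machine
  advances its frames.\<close>

definition nb :: "nat set \<Rightarrow> nat \<Rightarrow> nat set" where
  "nb B j = (let v = j div 2 in
     if v \<in> B then B
     else saturate (cc G v (if even j then cand (fst (sides G B)) (snd (sides G B)) v
       else cand (snd (sides G B)) (fst (sides G B)) v)))"

definition nbs :: "nat set \<Rightarrow> nat set list" where
  "nbs B = map (nb B) [0..<2 * n]"

lemma set_nbs: "set (nbs B) = neighbors G saturate B"
proof -
  obtain X Y where s: "sides G B = (X, Y)" by fastforce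
  have at: "neighbors_at G saturate B v = {nb B (2 * v), nb B (2 * v + 1)}" for v
  proof (cases "v \<in> B")
    case True then show ?thesis by (simp add: neighbors_at_def nb_def)
  next
    case False then show ?thesis using neighbors_at_eq[OF s False] by (simp add: nb_def s)
  qed
  have "{..<2 * n} = (\<Union>v\<in>{..<n}. {2 * v, 2 * v + 1})"
  proof (intro equalityI subsetI)
    fix j assume "j \<in> {..<2 * n}"
    then have "j div 2 < n" "j = 2 * (j div 2) \<or> j = 2 * (j div 2) + 1" by auto
    then show "j \<in> (\<Union>v\<in>{..<n}. {2 * v, 2 * v + 1})" by blast
  qed auto
  then have "nb B ` {..<2 * n} = (\<Union>v\<in>{..<n}. {nb B (2 * v), nb B (2 * v + 1)})" by auto
  then show ?thesis unfolding nbs_def neighbors_def verts_eq at by (simp add: atLeast0LessThan)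
qed

lemma saturate_maximal: "B \<in> max_conn_bip G \<Longrightarrow> saturate B = B"
  using comp_maximal[OF comp_spec_saturate, of B] by (auto simp: max_conn_bip_def)

lemma max_conn_bipD:
  assumes "B \<in> max_conn_bip G"
  shows "conn_bip G B" "con G B" "bipartite (with_proj G \<restriction> B)" "B \<subseteq> {..<n}" "B \<noteq> {}" "finite B"
  using assms finite_conn_bip verts_eq by (auto simp: max_conn_bip_def conn_bip_def con_iff)

lemma cc_con: "con G B \<Longrightarrow> v \<in> B \<Longrightarrow> cc G v B = B"
  using cc_unique[of v B B] by auto

lemma wp_proc_prog:
  assumes r: "rep s ((B, k) # fs) \<S>" and B: "B \<in> max_conn_bip G" and k: "2 \<le> k" "k < 2 * n + 2"
    and s: "regs s rV = k div 2" "regs s rI = k mod 2" "flags n (mem s aAl) B" "regs s rX = Min B"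
  defines "Z \<equiv> nb B (k - 2)"
  shows "wp proc_prog (1300 * (1 + sz)) (\<lambda>_ s'. if Z \<in> \<S> then rep s' ((B, Suc k) # fs) \<S>
    else rep s' ((Z, 0) # (B, Suc k) # fs) (insert Z \<S>)) s"
    (is "wp proc_prog ?c ?T s")
proof -
  note B' = max_conn_bipD[OF B]
  have MinB: "Min B \<in> B" using B' by simp
  then have mn: "Min B < n" using B'(4) by auto
  let ?v = "(k - 2) div 2"
  obtain j where j: "k = Suc (Suc j)" using k(1) by (metis add_2_eq_Suc le_Suc_ex)
  then have v: "k div 2 - 1 = ?v" "?v < n" "k mod 2 = (k - 2) mod 2" using k(2) by auto
  have in0: "has_input adj s" using r by (simp add: rep_def)
  show ?thesis
    unfolding proc_prog_def wp_Seq[of init_prog] wp_Seq[of grow_prog]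
  proof (rule wp_init_prog[OF in0 s(4) mn])
    fix c1 s1 assume 1: "same init_prog s s1" "coloured s1 {Min B} {Min B} {}" "?c - 100 * (1 + sz) \<le> c1"
    have in1: "has_input adj s1" by (rule has_input_same[OF in0 1(1)]) auto
    have al1: "flags n (mem s1 aAl) B" using s(3) 1(1) by (simp add: same_def)
    have r1: "rep s1 ((B, k) # fs) \<S>" by (rule rep_same[OF r 1(1)]) auto
    \<comment> \<open>Confined to the connected set \<open>B\<close>, the search from
      \<open>Min B\<close> recovers exactly \<open>B\<close>, this time with a colouring.\<close>
    have gB: "greedy B {Min B} [0..<n] = B"
      using greedy_eq_cc[OF mn B'(4)] B'(3) MinB cc_con[OF B'(2) MinB] by (simp add: insert_absorb)
    show "wp grow_prog c1 (\<lambda>c s. wp (Seq (Assign rW (Minus (Reg rV) (Const 1))) (Seq cand_prog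
     (Seq advance_prog (Seq (Assign rX (Reg rW)) explore_prog)))) c ?T s) s1"
    proof (rule wp_grow_prog[OF in1 1(2) al1], unfold gB)
      fix c2 s2 X Y assume 2: "same grow_prog s1 s2" "coloured s2 B X Y" "{Min B} \<subseteq> X" "c1 - 200 * (1 + sz) \<le> c2"
      have in2: "has_input adj s2" by (rule has_input_same[OF in1 2(1)]) auto
      have r2: "rep s2 ((B, k) # fs) \<S>" by (rule rep_same[OF r1 2(1)]) auto
      have f2: "regs s2 rV = k div 2" "regs s2 rI = k mod 2" "flags n (mem s2 aAl) B"
        using s(1,2) al1 1(1) 2(1) by (simp_all add: same_def)
      have bip: "bip G B X Y" using 2(2) by (simp add: coloured_def)
      \<comment> \<open>The search started at \<open>Min B\<close>, which stays in the first class,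
        so its two classes come in the order required by \<open>sides\<close>.\<close>
      then have sd: "sides G B = (X, Y)" using sides_eq[OF B'(1)] 2(3) by simp
      let ?s2 = "s2\<lparr>regs := (regs s2)(rW := ?v)\<rparr>"
      let ?A = "if ?v \<in> B then B else B - (nbhd G ?v \<inter> (if regs ?s2 rI = 0 then X else Y))"
      have c2: "1000 * (1 + sz) \<le> c2" "100 * (1 + sz) \<le> c2 - 4" using 1(3) 2(4) by simp_all
      have "wp cand_prog (c2 - 4) (\<lambda>c s. wp (Seq advance_prog (Seq (Assign rX (Reg rW)) explore_prog)) c ?T s) ?s2"
      proof (rule wp_cand_prog[where v = ?v and A = B and X = X and Y = Y])
        show "has_input adj ?s2" using in2 by (simp add: has_input_def)
        show "flags n (mem ?s2 aSX) X" "flags n (mem ?s2 aSY) Y" "flags n (mem ?s2 aAl) B"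
          using 2(2) f2(3) by (simp_all add: coloured_def)
      next
        fix c3 s3 assume 3: "same cand_prog ?s2 s3" "flags n (mem s3 aAl) ?A" "c2 - 4 - 100 * (1 + sz) \<le> c3"
        have r2': "rep ?s2 ((B, k) # fs) \<S>" by (rule rep_same[OF r2, of "Assign rW (Const 0)"]) (auto simp: same_def)
        have r3: "rep s3 ((B, k) # fs) \<S>" by (rule rep_same[OF r2' 3(1)]) auto
        have f3: "regs s3 rV = k div 2" "regs s3 rI = k mod 2" "regs s3 rW = ?v" "regs s3 rDep = Suc (length fs)"
          using f2 3(1) r3 by (simp_all add: same_def rep_def)
        have kv: "mem s3 aKV (Suc (length fs)) = k div 2" using r3 by (auto simp: rep_def)
        let ?s3 = "s3\<lparr>regs := (regs s3)(rX := ?v), mem := (mem s3)(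
          aKV := (mem s3 aKV)(Suc (length fs) := Suc k div 2),
          aKI := (mem s3 aKI)(Suc (length fs) := Suc k mod 2))\<rparr>"
        let ?s3' = "s3\<lparr>mem := (mem s3)(
          aKV := (mem s3 aKV)(Suc (length fs) := Suc k div 2),
          aKI := (mem s3 aKI)(Suc (length fs) := Suc k mod 2))\<rparr>"
        have "rep ?s3' ((B, Suc k) # fs) \<S>" by (rule rep_advance[OF r3]) simp_all
        then have r4: "rep ?s3 ((B, Suc k) # fs) \<S>"
          by (rule rep_same[where p = "Assign rX (Const 0)"]) (auto simp: same_def)
        have ev: "even (k - 2) \<longleftrightarrow> k mod 2 = 0" by (simp add: j even_iff_mod_2_eq_zero)
        have A: "insert ?v ?A = (if ?v \<in> B then B else if even (k - 2) then cand X Y ?v else cand Y X ?v)"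
          using bip f2(2) unfolding ev by (auto simp: cand_def bip_iff insert_absorb)
        have Z: "Z = saturate (cc G ?v (insert ?v ?A))"
        proof (cases "?v \<in> B")
          case True
          then show ?thesis unfolding A using cc_con[OF B'(2) True] saturate_maximal[OF B] by (simp add: Z_def nb_def Let_def)
        next
          case False
          then show ?thesis unfolding A by (simp add: Z_def nb_def sd Let_def)
        qed
        have "wp explore_prog (800 * (1 + sz)) ?T ?s3"
          unfolding Z
        proof (rule wp_explore_prog[OF r4])
          show "flags n (mem ?s3 aAl) ?A" using 3(2) by simp
          show "?A \<subseteq> {..<n}" using B'(4) by auto
          show "bipartite (with_proj G \<restriction> insert ?v ?A)"
            unfolding A using bipartite_cand[OF bip] bipartite_cand[OF bip_swap[OF bip]] B'(3) by auto
        qed (use v in simp_all)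
        then have ex: "wp explore_prog m ?T ?s3" if "800 * (1 + sz) \<le> m" for m
          using that by (rule wp_budget)
        have c3: "850 * (1 + sz) \<le> c3" using c2 3(3) by simp
        then have le: "800 * (1 + sz) \<le> c3 - m" if "m \<le> 20" for m using that by simp
        show "wp (Seq advance_prog (Seq (Assign rX (Reg rW)) explore_prog)) c3 ?T s3"
        proof (cases "k mod 2 = 0")
          case True
          then have m: "Suc k div 2 = k div 2" "Suc k mod 2 = 1" by presburger+
          \<comment> \<open>For even \<open>k\<close> the program writes \<open>aKI\<close> only;
            the update of \<open>aKV\<close> in the target state is then the identity.\<close>
          have s3: "?s3 = s3\<lparr>regs := (regs s3)(rX := ?v), mem := (mem s3)(aKI := (mem s3 aKI)(Suc (length fs) := 1))\<rparr>"
            using kv unfolding m by (simp add: fun_upd_idem)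
          show ?thesis
            using ex[OF le[of 7]] c3 True f3 unfolding s3
            unfolding advance_prog_def wp_Seq wp_Cond[of "Reg rI"] wp_Assign wp_Store
            by (simp add: budget_simps update_mem_regs)
        next
          case False
          then have m: "Suc k div 2 = Suc (k div 2)" "Suc k mod 2 = 0" by presburger+
          show ?thesis
            using ex[OF le[of 11]] c3 False f3 unfolding m
            unfolding advance_prog_def wp_Seq wp_Cond[of "Reg rI"] wp_Assign wp_Store
            by (simp add: budget_simps update_mem_regs fun_upd_twist)
        qed
      qed (use v c2 in simp_all)
      then show "wp (Seq (Assign rW (Minus (Reg rV) (Const 1))) (Seq cand_prog
        (Seq advance_prog (Seq (Assign rX (Reg rW)) explore_prog)))) c2 ?T s2"
        unfolding wp_Seq[of "Assign _ _"] wp_Seq[of cand_prog] wp_Assign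
        using f2 v c2 by (simp add: budget_simps)
    qed (use 1(3) in simp)
  qed simp
qed

text \<open>\<open>wp\<close> speaks of silent runs only, so the run is built explicitly, by
  induction backwards from the end of the loop.\<close>

lemma wp_out_print_prog:
  assumes "has_input adj s" "flags n (mem s aAl) B" "B \<subseteq> {..<n}"
  shows "wp_out B print_prog (20 * (1 + sz)) (\<lambda>s'. s' = s\<lparr>regs := (regs s)(rJ := n)\<rparr>) s"
proof -
  let ?p = "Cond (Cell aAl (Reg rJ)) (Print (Reg rJ)) Skip"
  let ?e = "Minus (Reg 0) (Reg rJ)"
  let ?s = "\<lambda>j. s\<lparr>regs := (regs s)(rJ := j)\<rparr>"
  have N: "regs s 0 = n" using assms(1) by (simp add: has_input_def)
  have "\<exists>b. exec (While ?e (Seq ?p (Assign rJ (Succ (Reg rJ))))) (?s j) b (?s n) \<and>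
      length b \<le> 12 * (n - j) + 4 \<and> Done \<notin> set b \<and> {v. Out v \<in> set b} = B \<inter> {j..}" if "j \<le> n" for j
    using that
  proof (induct rule: inc_induct)
    case base
    have "exec (While ?e (Seq ?p (Assign rJ (Succ (Reg rJ))))) (?s n) (ticks (Suc (cost ?e))) (?s n)"
      by (rule exec.intros) (simp add: N)
    moreover have "length (ticks (Suc (cost ?e))) \<le> 12 * (n - n) + 4" "Done \<notin> set (ticks (Suc (cost ?e)))"
      by simp_all
    moreover have "{v. Out v \<in> set (ticks (Suc (cost ?e)))} = B \<inter> {n..}" using assms(3) by auto
    ultimately show ?case by blast
  next
    case (step j)
    then obtain b where b: "exec (While ?e (Seq ?p (Assign rJ (Succ (Reg rJ))))) (?s (Suc j)) b (?s n)"
      "length b \<le> 12 * (n - Suc j) + 4" "Done \<notin> set b" "{v. Out v \<in> set b} = B \<inter> {Suc j..}" by blast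
    define t where "t = (if j \<in> B then ticks 1 @ [Out j] else ticks 1)"
    have "exec ?p (?s j) (ticks (Suc (cost (Cell aAl (Reg rJ)))) @ t) (?s j)"
    proof (cases "j \<in> B")
      case True
      then show ?thesis
        using flagsD[OF assms(2) step(2)] exec.intros(4)[of "Reg rJ" "?s j"]
        by (intro exec.intros(7)) (simp_all add: t_def)
    next
      case False
      then show ?thesis
        using flagsD[OF assms(2) step(2)] exec.intros(1)[of "?s j"]
        by (intro exec.intros(8)) (simp_all add: t_def)
    qed
    moreover have "exec (Assign rJ (Succ (Reg rJ))) (?s j) (ticks (Suc (cost (Succ (Reg rJ))))) (?s (Suc j))"
      using exec.intros(2)[of rJ "Succ (Reg rJ)" "?s j"] by simp
    moreover have "Suc (cost (Cell aAl (Reg rJ))) = 3" "Suc (cost (Succ (Reg rJ))) = 3" by simp_all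
    ultimately have "exec (Seq ?p (Assign rJ (Succ (Reg rJ)))) (?s j) ((ticks 3 @ t) @ ticks 3) (?s (Suc j))"
      using exec.intros(6) by metis
    moreover have "eval (?s j) ?e \<noteq> 0" using step(2) N by simp
    ultimately have "exec (While ?e (Seq ?p (Assign rJ (Succ (Reg rJ))))) (?s j)
        (ticks (Suc (cost ?e)) @ ((ticks 3 @ t) @ ticks 3) @ b) (?s n)"
      using b(1) exec.intros(10) by blast
    moreover have "{v. Out v \<in> set (ticks (Suc (cost ?e)) @ ((ticks 3 @ t) @ ticks 3) @ b)} =
        {v. Out v \<in> set t} \<union> {v. Out v \<in> set b}"
      by auto
    moreover have "\<dots> = B \<inter> {j..}"
      unfolding b(4) by (auto simp: t_def Suc_le_eq order_le_less)
    moreover have "length (ticks (Suc (cost ?e)) @ ((ticks 3 @ t) @ ticks 3) @ b) \<le> 12 * (n - j) + 4"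
      using b(2) step(2) by (auto simp: t_def)
    moreover have "Done \<notin> set (ticks (Suc (cost ?e)) @ ((ticks 3 @ t) @ ticks 3) @ b)"
      using b(3) by (auto simp: t_def)
    ultimately show ?case by metis
  qed
  from this[of 0] obtain b where b: "exec (While ?e (Seq ?p (Assign rJ (Succ (Reg rJ))))) (?s 0) b (?s n)"
    "length b \<le> 12 * n + 4" "Done \<notin> set b" "{v. Out v \<in> set b} = B" by auto
  have "exec (Assign rJ (Const 0)) s (ticks 2) (?s 0)"
    using exec.intros(2)[of rJ "Const 0" s] by (simp add: numeral_2_eq_2)
  then have "exec print_prog s ((ticks 2 @ b) @ [Done]) (?s n)"
    unfolding print_prog_def for_upto_def using exec.intros(5,6) b(1) by blast
  moreover have "2 + length b + 1 + 0 \<le> 20 * (1 + sz)" using b(2) by (simp add: sz_def)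
  ultimately show ?thesis
    unfolding wp_out_def using b(3,4)
    by (intro exI[of _ 2] exI[of _ b] exI[of _ 0] exI[of _ "?s n"]) simp
qed

text \<open>\<open>rJ\<close> may have any value, since printing leaves it at \<open>n\<close>; the
  silent case instantiates it with its old value.\<close>

lemma rep_pop:
  assumes "rep s (f # fs) \<S>" "mem s' = mem s" "regs s' = (regs s)(rDep := length fs, rPar := length fs mod 2, rJ := x)"
  shows "rep s' fs \<S>"
proof -
  obtain nodes where r: "has_input adj s" "trie s nodes" "frames n s nodes (f # fs)" "\<S> = sols n nodes"
    using assms(1) unfolding rep_def by auto
  have "trie s' nodes" by (rule trie_cong[OF r(2)]) (simp_all add: assms)
  moreover have "frames n s nodes fs" using r(3) by simp
  then have "frames n s' (nodes @ []) fs" by (rule frames_cong) (simp add: assms)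
  moreover have "has_input adj s'" using r(1) assms(2,3) by (simp add: has_input_def)
  ultimately show ?thesis using r assms(2,3) unfolding rep_def by auto
qed

text \<open>A bound for one iteration of the main loop, including its test.\<close>

definition tau :: nat where "tau = 1500 * (1 + sz)"

lemma wp_body_proc:
  assumes "rep s ((B, k) # fs) \<S>" "B \<in> max_conn_bip G" "2 \<le> k" "k < 2 * n + 2"
  shows "wp body_prog (tau - 2) (\<lambda>_ s'. if nb B (k - 2) \<in> \<S> then rep s' ((B, Suc k) # fs) \<S>
    else rep s' ((nb B (k - 2), 0) # (B, Suc k) # fs) (insert (nb B (k - 2)) \<S>)) s"
  unfolding body_prog_def wp_Seq[of load_prog]
proof (rule wp_budget[OF wp_load_prog[OF assms(1) max_conn_bipD(4,5)[OF assms(2)]]])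
  let ?T = "\<lambda>_ s'. if nb B (k - 2) \<in> \<S> then rep s' ((B, Suc k) # fs) \<S>
    else rep s' ((nb B (k - 2), 0) # (B, Suc k) # fs) (insert (nb B (k - 2)) \<S>)"
  fix c' s' assume a: "rep s' ((B, k) # fs) \<S> \<and> regs s' rV = k div 2 \<and>
    regs s' rI = k mod 2 \<and> flags n (mem s' aAl) B \<and> regs s' rX = Min B" "tau - 2 - 150 * (1 + sz) \<le> c'"
  have N: "regs s' 0 = n" using a by (auto simp: rep_def has_input_def)
  have kd: "k div 2 \<noteq> 0" "k div 2 < Suc n" using assms(3,4) by auto
  have c: "1300 * (1 + sz) \<le> c' - 7" "7 \<le> c'" using a(2) by (simp_all add: tau_def)
  have "wp proc_prog (1300 * (1 + sz)) ?T s'" by (rule wp_proc_prog) (use a assms in blast)+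
  then have "wp proc_prog (c' - 7) ?T s'" using c(1) by (rule wp_budget)
  then show "wp (Cond (Reg rV) (Cond (Minus (Succ (Reg 0)) (Reg rV)) proc_prog last_prog) first_prog) c' ?T s'"
    unfolding wp_Cond using a kd N c(2) by (simp add: budget_simps)
qed (simp add: tau_def)

lemma rep_first:
  assumes "rep s ((B, 0) # fs) \<S>"
  shows "rep (s\<lparr>mem := (mem s)(aKV := (mem s aKV)(Suc (length fs) := 1))\<rparr>) ((B, 2) # fs) \<S>"
proof (rule rep_advance[OF assms])
  have "mem s aKI (Suc (length fs)) = 0" using assms by (auto simp: rep_def)
  then show "mem (s\<lparr>mem := (mem s)(aKV := (mem s aKV)(Suc (length fs) := 1))\<rparr>) aKI =
    (mem s aKI)(Suc (length fs) := 2 mod 2)" by (simp add: fun_upd_idem)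
qed simp_all

text \<open>The depth of the top call is \<open>length fs\<close>, one less than the height of the
  stack whose parity is \<open>rPar\<close>. Odd depth thus means \<open>rPar = 0\<close>, and the
  output is deferred.\<close>

lemma wp_body_first:
  assumes "rep s ((B, 0) # fs) \<S>" "B \<in> max_conn_bip G" "odd (length fs)"
  shows "wp body_prog (tau - 2) (\<lambda>_ s'. rep s' ((B, 2) # fs) \<S>) s"
  unfolding body_prog_def wp_Seq[of load_prog]
proof (rule wp_budget[OF wp_load_prog[OF assms(1) max_conn_bipD(4,5)[OF assms(2)]]])
  fix c' s' assume a: "rep s' ((B, 0) # fs) \<S> \<and> regs s' rV = 0 div 2 \<and>
    regs s' rI = 0 mod 2 \<and> flags n (mem s' aAl) B \<and> regs s' rX = Min B" "tau - 2 - 150 * (1 + sz) \<le> c'"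
  moreover have "Suc (length fs) mod 2 = 0" using assms(3) by presburger
  ultimately have f: "regs s' rPar = 0" "regs s' rDep = Suc (length fs)" "regs s' rV = 0"
    by (simp_all add: rep_def)
  have c: "100 \<le> c'" using a(2) by (simp add: tau_def)
  have "rep (s'\<lparr>mem := (mem s')(aKV := (mem s' aKV)(Suc (length fs) := 1))\<rparr>) ((B, 2) # fs) \<S>"
    using rep_first a(1) by blast
  then show "wp (Cond (Reg rV) (Cond (Minus (Succ (Reg 0)) (Reg rV)) proc_prog last_prog) first_prog) c'
      (\<lambda>_ s'. rep s' ((B, 2) # fs) \<S>) s'"
    unfolding first_prog_def wp_Cond wp_Seq wp_Store wp_Skip using f c by (simp add: budget_simps)
qed (simp add: tau_def)

lemma wp_out_body_first:
  assumes "rep s ((B, 0) # fs) \<S>" "B \<in> max_conn_bip G" "even (length fs)"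
  shows "wp_out B body_prog (tau - 2) (\<lambda>s'. rep s' ((B, 2) # fs) \<S>) s"
proof -
  let ?T = "\<lambda>s'. rep s' ((B, 2) # fs) \<S>"
  note B = max_conn_bipD(4,5)[OF assms(2)]
  have "wp load_prog (150 * (1 + sz)) (\<lambda>_. wp_out B
      (Cond (Reg rV) (Cond (Minus (Succ (Reg 0)) (Reg rV)) proc_prog last_prog) first_prog)
      (Suc (cost (Reg rV)) + ((Suc (cost (Reg rPar)) + 20 * (1 + sz)) + 3)) ?T) s"
  proof (rule wp_mono[OF wp_load_prog[OF assms(1) B]])
    fix s' assume a: "rep s' ((B, 0) # fs) \<S> \<and> regs s' rV = 0 div 2 \<and>
      regs s' rI = 0 mod 2 \<and> flags n (mem s' aAl) B \<and> regs s' rX = Min B"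
    moreover have "Suc (length fs) mod 2 = 1" using assms(3) by presburger
    ultimately have f: "regs s' rPar = 1" "regs s' rDep = Suc (length fs)" "regs s' rV = 0" "has_input adj s'"
      by (simp_all add: rep_def)
    let ?s = "s'\<lparr>regs := (regs s')(rJ := n)\<rparr>"
    have r: "rep ?s ((B, 0) # fs) \<S>"
      by (rule rep_same[of s' _ _ "Assign rJ (Const 0)"]) (use a in \<open>auto simp: same_def\<close>)
    have "wp_out B (Cond (Reg rPar) print_prog Skip) (Suc (cost (Reg rPar)) + 20 * (1 + sz)) (\<lambda>s'. s' = ?s) s'"
      by (rule wp_out_Cond) (use wp_out_print_prog[OF f(4) _ B(1)] a f(1) in simp)
    then have "wp_out B (Cond (Reg rPar) print_prog Skip) (Suc (cost (Reg rPar)) + 20 * (1 + sz))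
      (wp (Store aKV (Reg rDep) (Const 1)) 3 (\<lambda>_. ?T)) s'"
      by (rule wp_out_mono) (use rep_first[OF r] f(2) in \<open>auto simp: wp_Store\<close>)
    then have "wp_out B first_prog ((Suc (cost (Reg rPar)) + 20 * (1 + sz)) + 3) ?T s'"
      unfolding first_prog_def by (rule wp_out_before)
    then show "wp_out B (Cond (Reg rV) (Cond (Minus (Succ (Reg 0)) (Reg rV)) proc_prog last_prog) first_prog)
      (Suc (cost (Reg rV)) + ((Suc (cost (Reg rPar)) + 20 * (1 + sz)) + 3)) ?T s'"
      by (intro wp_out_Cond) (simp add: f(3))
  qed
  then have "wp_out B body_prog (150 * (1 + sz) + (Suc (cost (Reg rV)) + ((Suc (cost (Reg rPar)) + 20 * (1 + sz)) + 3))) ?T s"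
    unfolding body_prog_def by (rule wp_out_after)
  then show ?thesis by (rule wp_out_mono) (simp_all add: tau_def)
qed

lemma wp_body_last:
  assumes "rep s ((B, 2 * n + 2) # fs) \<S>" "B \<in> max_conn_bip G" "even (length fs)"
  shows "wp body_prog (tau - 2) (\<lambda>_ s'. rep s' fs \<S>) s"
  unfolding body_prog_def wp_Seq[of load_prog]
proof (rule wp_budget[OF wp_load_prog[OF assms(1) max_conn_bipD(4,5)[OF assms(2)]]])
  fix c' s' assume a: "rep s' ((B, 2 * n + 2) # fs) \<S> \<and> regs s' rV = (2 * n + 2) div 2 \<and>
    regs s' rI = (2 * n + 2) mod 2 \<and> flags n (mem s' aAl) B \<and> regs s' rX = Min B" "tau - 2 - 150 * (1 + sz) \<le> c'"
  moreover have "Suc (length fs) mod 2 = 1" using assms(3) by presburger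
  ultimately have f: "regs s' rPar = 1" "regs s' rDep = Suc (length fs)" "regs s' rV = Suc n" "regs s' 0 = n"
    by (simp_all add: rep_def has_input_def)
  have c: "100 \<le> c'" using a(2) by (simp add: tau_def)
  have "rep (s'\<lparr>regs := (regs s')(rDep := length fs, rPar := length fs mod 2, rJ := regs s' rJ)\<rparr>) fs \<S>"
    by (rule rep_pop[where s = s']) (use a(1) in auto)
  then have "rep (s'\<lparr>regs := (regs s')(rDep := length fs, rPar := 0)\<rparr>) fs \<S>"
    using assms(3) by (simp add: fun_upd_idem)
  then show "wp (Cond (Reg rV) (Cond (Minus (Succ (Reg 0)) (Reg rV)) proc_prog last_prog) first_prog) c'
      (\<lambda>_ s'. rep s' fs \<S>) s'"
    unfolding last_prog_def pop_prog_def wp_Cond wp_Seq wp_Assign wp_Skip using f c by (simp add: budget_simps)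
qed (simp add: tau_def)

lemma wp_out_body_last:
  assumes "rep s ((B, 2 * n + 2) # fs) \<S>" "B \<in> max_conn_bip G" "odd (length fs)"
  shows "wp_out B body_prog (tau - 2) (\<lambda>s'. rep s' fs \<S>) s"
proof -
  let ?T = "\<lambda>s'. rep s' fs \<S>"
  let ?e = "Minus (Succ (Reg 0)) (Reg rV)"
  note B = max_conn_bipD(4,5)[OF assms(2)]
  have "wp load_prog (150 * (1 + sz)) (\<lambda>_. wp_out B
      (Cond (Reg rV) (Cond ?e proc_prog last_prog) first_prog)
      (Suc (cost (Reg rV)) + (Suc (cost ?e) + ((Suc (cost (Reg rPar)) + 20 * (1 + sz)) + 10))) ?T) s"
  proof (rule wp_mono[OF wp_load_prog[OF assms(1) B]])
    fix s' assume a: "rep s' ((B, 2 * n + 2) # fs) \<S> \<and> regs s' rV = (2 * n + 2) div 2 \<and>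
      regs s' rI = (2 * n + 2) mod 2 \<and> flags n (mem s' aAl) B \<and> regs s' rX = Min B"
    moreover have "Suc (length fs) mod 2 = 0" using assms(3) by presburger
    ultimately have f: "regs s' rPar = 0" "regs s' rDep = Suc (length fs)" "regs s' rV = Suc n" "regs s' 0 = n"
      "has_input adj s'"
      by (simp_all add: rep_def has_input_def)
    let ?s = "s'\<lparr>regs := (regs s')(rJ := n)\<rparr>"
    have "rep (s'\<lparr>regs := (regs s')(rDep := length fs, rPar := length fs mod 2, rJ := n)\<rparr>) fs \<S>"
      by (rule rep_pop[where s = s']) (use a in auto)
    then have r: "rep (s'\<lparr>regs := (regs s')(rJ := n, rDep := length fs, rPar := 1)\<rparr>) fs \<S>"
      using assms(3) by (simp add: fun_upd_twist odd_iff_mod_2_eq_one)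
    have "wp_out B (Cond (Reg rPar) Skip print_prog) (Suc (cost (Reg rPar)) + 20 * (1 + sz)) (\<lambda>s'. s' = ?s) s'"
      by (rule wp_out_Cond) (use wp_out_print_prog[OF f(5) _ B(1)] a f(1) in simp)
    then have "wp_out B (Cond (Reg rPar) Skip print_prog) (Suc (cost (Reg rPar)) + 20 * (1 + sz))
      (wp pop_prog 10 (\<lambda>_. ?T)) s'"
      by (rule wp_out_mono) (use r f(1,2) in \<open>auto simp: pop_prog_def wp_Seq wp_Assign\<close>)
    then have "wp_out B last_prog ((Suc (cost (Reg rPar)) + 20 * (1 + sz)) + 10) ?T s'"
      unfolding last_prog_def by (rule wp_out_before)
    then have "wp_out B (Cond ?e proc_prog last_prog)
      (Suc (cost ?e) + ((Suc (cost (Reg rPar)) + 20 * (1 + sz)) + 10)) ?T s'"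
      by (intro wp_out_Cond) (simp add: f(3,4))
    then show "wp_out B (Cond (Reg rV) (Cond ?e proc_prog last_prog) first_prog)
      (Suc (cost (Reg rV)) + (Suc (cost ?e) + ((Suc (cost (Reg rPar)) + 20 * (1 + sz)) + 10))) ?T s'"
      by (intro wp_out_Cond) (simp add: f(3))
  qed
  then have "wp_out B body_prog (150 * (1 + sz) + (Suc (cost (Reg rV)) + (Suc (cost ?e) +
      ((Suc (cost (Reg rPar)) + 20 * (1 + sz)) + 10)))) ?T s"
    unfolding body_prog_def by (rule wp_out_after)
  then show ?thesis by (rule wp_out_mono) (simp_all add: tau_def)
qed

end


section \<open>Delay\<close>

text \<open>\<open>paced L g tr outs g'\<close>: if at most \<open>g\<close> steps were made since the last output, then during
  \<open>tr\<close>, which outputs \<open>outs\<close>, no period exceeds \<open>L\<close>, and at its end at most \<open>g'\<close> steps were made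
  since the last output.\<close>

inductive paced :: "nat \<Rightarrow> nat \<Rightarrow> event list \<Rightarrow> nat set list \<Rightarrow> nat \<Rightarrow> bool" for L where
  paced_Nil: "g \<le> g' \<Longrightarrow> paced L g [] [] g'"
| paced_ticks: "paced L (g + k) tr outs g' \<Longrightarrow> paced L g (ticks k @ tr) outs g'"
| paced_item: "g + length b + 1 \<le> L \<Longrightarrow> Done \<notin> set b \<Longrightarrow> {v. Out v \<in> set b} = B \<Longrightarrow>
    paced L 0 tr outs g' \<Longrightarrow> paced L g (b @ Done # tr) (B # outs) g'"

lemma paced_mono: "paced L g tr outs g' \<Longrightarrow> h \<le> g \<Longrightarrow> paced L h tr outs g'"
proof (induct arbitrary: h rule: paced.induct)
  case (paced_ticks g k tr outs g')
  then show ?case by (intro paced.paced_ticks) simp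
qed (auto intro: paced.intros)

lemma paced_append:
  "paced L g tr outs g1 \<Longrightarrow> g1 \<le> g2 \<Longrightarrow> paced L g2 tr' outs' g' \<Longrightarrow> paced L g (tr @ tr') (outs @ outs') g'"
proof (induct rule: paced.induct)
  case (paced_Nil g g1)
  then show ?case using paced_mono by simp
next
  case (paced_ticks g k tr outs g1)
  then show ?case using paced.paced_ticks by simp
next
  case (paced_item g b B tr outs g1)
  then show ?case using paced.paced_item by simp
qed

lemma paced_ticks_only: "g + k \<le> g' \<Longrightarrow> paced L g (ticks k) [] g'"
  using paced_ticks[OF paced_Nil, of g k g' L] by simp

lemma paced_item_only:
  assumes "g + length b + 1 \<le> L" "Done \<notin> set b" "{v. Out v \<in> set b} = B" "k \<le> g'"
  shows "paced L g (b @ Done # ticks k) [B] g'"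
  using paced_item[OF assms(1-3) paced_ticks_only[of 0 k g' L]] assms(4) by simp

lemma periods_no_Done: "Done \<notin> set b \<Longrightarrow> periods b = [b]"
proof (induct b)
  case (Cons e b) then show ?case by (cases e) auto
qed simp

lemma periods_Done: "Done \<notin> set b \<Longrightarrow> periods (b @ Done # tr) = (b @ [Done]) # periods tr"
proof (induct b)
  case (Cons e b) then show ?case by (cases e) auto
qed simp

text \<open>The \<open>j\<close> leading ticks stand for the steps made since the last output;
  without them the induction could not pass \<open>paced_ticks\<close>.\<close>

lemma paced_periods:
  "paced L g tr outs g' \<Longrightarrow> g' \<le> L \<Longrightarrow> j \<le> g \<Longrightarrow>
    outputs (ticks j @ tr) = outs \<and> (\<forall>b\<in>set (periods (ticks j @ tr)). length b \<le> L)"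
proof (induct arbitrary: j rule: paced.induct)
  case (paced_Nil g g')
  then show ?case by (simp add: periods_no_Done outputs_def)
next
  case (paced_ticks g k tr outs g')
  then show ?case using paced_ticks(2)[of "j + k"] by (simp add: replicate_add)
next
  case (paced_item g b B tr outs g')
  have "periods (ticks j @ b @ Done # tr) = (ticks j @ b @ [Done]) # periods tr"
    using periods_Done[of "ticks j @ b" tr] paced_item by simp
  moreover have "outputs tr = outs" "\<forall>b\<in>set (periods tr). length b \<le> L"
    using paced_item(5)[of 0] paced_item by simp_all
  moreover have "periods tr \<noteq> []"
    by (induct tr rule: periods.induct) (auto split: list.splits)
  moreover have "{v. Out v \<in> set (ticks j @ b @ [Done])} = B" using paced_item(3) by auto
  ultimately show ?case using paced_item(1,7) by (simp add: outputs_def)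
qed

lemma paced_delay:
  assumes "paced L 0 tr outs g'" "g' \<le> L"
  shows "outputs tr = outs" "delay tr \<le> L"
proof -
  have p: "outputs tr = outs" "\<forall>b\<in>set (periods tr). length b \<le> L"
    using paced_periods[OF assms, of 0] by simp_all
  show "outputs tr = outs" by (rule p)
  have "periods tr \<noteq> []"
    by (induct tr rule: periods.induct) (auto split: list.splits)
  then show "delay tr \<le> L" unfolding delay_def using p(2) by simp
qed

text \<open>\<open>exec\<close> relates only complete runs. A partial run of the main loop is
  therefore expressed by its effect on continuations: every complete run from \<open>s'\<close>
  extends to one from \<open>s\<close>.\<close>

definition reach :: "machine \<Rightarrow> event list \<Rightarrow> machine \<Rightarrow> bool" where
  "reach s tr s' \<longleftrightarrow> (\<forall>tr' s''. exec (While (Reg rDep) body_prog) s' tr' s'' \<longrightarrow>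
     exec (While (Reg rDep) body_prog) s (tr @ tr') s'')"

lemma reach_refl: "reach s [] s"
  by (simp add: reach_def)

lemma reach_trans: "reach s tr s1 \<Longrightarrow> reach s1 tr' s2 \<Longrightarrow> reach s (tr @ tr') s2"
  by (simp add: reach_def)

lemma reach_body:
  assumes "exec body_prog s tr s'" "regs s rDep \<noteq> 0"
  shows "reach s (ticks 2 @ tr) s'"
  unfolding reach_def
proof (intro allI impI)
  fix tr' s'' assume "exec (While (Reg rDep) body_prog) s' tr' s''"
  moreover have "eval s (Reg rDep) \<noteq> 0" using assms(2) by simp
  ultimately have "exec (While (Reg rDep) body_prog) s (ticks (Suc (cost (Reg rDep))) @ tr @ tr') s''"
    using assms(1) exec.intros(10) by blast
  then show "exec (While (Reg rDep) body_prog) s ((ticks 2 @ tr) @ tr') s''"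
    by (simp add: numeral_2_eq_2)
qed

lemma reach_wp:
  assumes "wp body_prog (t - 2) (\<lambda>_. Q) s" "regs s rDep \<noteq> 0" "2 \<le> t"
  obtains k s' where "reach s (ticks k) s'" "k \<le> t" "Q s'"
proof -
  obtain k s' where k: "exec body_prog s (ticks k) s'" "k \<le> t - 2" "Q s'"
    using assms(1) unfolding wp_def by blast
  have "reach s (ticks (2 + k)) s'" using reach_body[OF k(1) assms(2)] unfolding ticks_append .
  moreover have "2 + k \<le> t" using k(2) assms(3) by simp
  ultimately show thesis using that k(3) by blast
qed

lemma reach_wp_out:
  assumes "wp_out B body_prog (t - 2) Q s" "regs s rDep \<noteq> 0" "2 \<le> t"
  obtains b k s' where "reach s (b @ Done # ticks k) s'" "length b + 1 + k \<le> t" "Done \<notin> set b"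
    "{v. Out v \<in> set b} = B" "Q s'"
proof -
  obtain j b k s' where e: "exec body_prog s (ticks j @ b @ Done # ticks k) s'"
    "j + length b + 1 + k \<le> t - 2" "Done \<notin> set b" "{v. Out v \<in> set b} = B" "Q s'"
    using assms(1) unfolding wp_out_def by blast
  have "reach s ((ticks 2 @ ticks j @ b) @ Done # ticks k) s'" using reach_body[OF e(1) assms(2)] by simp
  moreover have "length (ticks 2 @ ticks j @ b) + 1 + k \<le> t" using e(2) assms(3) by simp
  moreover have "Done \<notin> set (ticks 2 @ ticks j @ b)" "{v. Out v \<in> set (ticks 2 @ ticks j @ b)} = B"
    using e(3,4) by auto
  ultimately show thesis using that e(5) by blast
qed

section \<open>Gap bounds along the recursion\<close>

context adj_graph
begin

text \<open>Bounds on the time since the last output when a call at depth \<open>d\<close> starts, when its loop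
  starts, and when it returns. A call makes at most \<open>2 * n + 2\<close> iterations of its own. At even depth
  it outputs at once, so it may start late, but it returns a full loop after its own or its last
  child's output; at odd depth it outputs just before it returns, so it must start early.\<close>

definition gap_in :: "nat \<Rightarrow> nat" where
  "gap_in d = (if even d then (4 * n + 2) * tau else (2 * n + 1) * tau)"

definition gap_loop :: "nat \<Rightarrow> nat" where
  "gap_loop d = (if even d then tau else (2 * n + 2) * tau)"

definition gap_out :: "nat \<Rightarrow> nat" where
  "gap_out d = (if even d then (2 * n + 2) * tau else tau)"

text \<open>At an output the gap is at most \<open>gap_in d + tau\<close> for even depth and
  \<open>gap_loop d + 2 * n * tau + tau\<close> for odd depth, in both cases
  \<open>(4 * n + 3) * tau\<close>.\<close>

definition max_gap :: nat where
  "max_gap = (4 * n + 4) * tau"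

text \<open>Equality holds for the last neighbour, \<open>p = 2 * n - 1\<close>, at both parities;
  this determines the values of \<open>gap_in\<close>.\<close>

lemma gap_call: "p < 2 * n \<Longrightarrow> gap_loop d + Suc p * tau \<le> gap_in (Suc d)"
proof -
  assume p: "p < 2 * n"
  have "(2 + p) * tau \<le> (2 * n + 1) * tau" "((2 * n + 2) + Suc p) * tau \<le> (4 * n + 2) * tau"
    using p by (intro mult_right_mono; simp)+
  then show ?thesis by (auto simp: gap_loop_def gap_in_def algebra_simps)
qed

lemma gap_return: "gap_out (Suc d) \<le> gap_loop d"
  by (simp add: gap_loop_def gap_out_def)

lemma drop_eq_Cons:
  assumes "x # xs = drop p ys"
  shows "p < length ys" "x = ys ! p" "xs = drop (Suc p) ys"
proof -
  show p: "p < length ys" using assms by (metis drop_all list.distinct(1) not_less)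
  have "x # xs = ys ! p # drop (Suc p) ys" using assms Cons_nth_drop_Suc[OF p] by metis
  then show "x = ys ! p" "xs = drop (Suc p) ys" by simp_all
qed

text \<open>Induction on the derivation of \<open>enum\<close>, with an arbitrary remaining stack
  \<open>fs\<close> that is left as it was. In the loop, position \<open>p\<close> has gap at most
  \<open>gap_loop d + p * tau\<close>. An iteration without a call adds at most \<open>tau\<close>;
  one with a call ends at most at \<open>gap_out (Suc d)\<close>, which \<open>gap_loop d\<close>
  already covers, so any number of calls is harmless.\<close>

lemma simulate:
  "enum nbs d S \<S> \<S>' out \<Longrightarrow> length fs = d \<Longrightarrow> S \<in> max_conn_bip G \<Longrightarrow>
     rep s ((S, 0) # fs) (insert S \<S>) \<Longrightarrow>
     \<exists>tr s'. reach s tr s' \<and> rep s' fs \<S>' \<and> paced max_gap (gap_in d) tr out (gap_out d)"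
  "enum_loop nbs d Ns \<S> \<S>' out \<Longrightarrow> length fs = d \<Longrightarrow> B \<in> max_conn_bip G \<Longrightarrow> p \<le> 2 * n \<Longrightarrow>
     Ns = drop p (nbs B) \<Longrightarrow> rep s ((B, p + 2) # fs) \<S> \<Longrightarrow>
     \<exists>tr s'. reach s tr s' \<and> rep s' ((B, 2 * n + 2) # fs) \<S>' \<and>
       paced max_gap (gap_loop d + p * tau) tr out (gap_loop d + 2 * n * tau)"
proof (induct arbitrary: fs s and fs B p s rule: enum_enum_loop.inducts)
  case (enum d S \<S> \<S>' out)
  have dep: "regs s' rDep \<noteq> 0" if "rep s' (f # fs) X" for s' f X using that by (simp add: rep_def)
  have tau: "2 \<le> tau" by (simp add: tau_def)
  show ?case
  proof (cases "even d")
    case True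
    obtain b k s1 where 1: "reach s (b @ Done # ticks k) s1" "length b + 1 + k \<le> tau" "Done \<notin> set b"
      "{v. Out v \<in> set b} = S" "rep s1 ((S, 2) # fs) (insert S \<S>)"
      using reach_wp_out[OF wp_out_body_first[OF enum.prems(3,2)] dep[OF enum.prems(3)] tau]
        enum.prems(1) True by blast
    have "rep s1 ((S, 0 + 2) # fs) (insert S \<S>)" using 1(5) by (simp only: add_0)
    then obtain tr s2 where 2: "reach s1 tr s2" "rep s2 ((S, 2 * n + 2) # fs) \<S>'"
      "paced max_gap (gap_loop d + 0 * tau) tr out (gap_loop d + 2 * n * tau)"
      using enum.hyps(2)[OF enum.prems(1,2) le0 drop_0[symmetric]] by blast
    obtain k' s3 where 3: "reach s2 (ticks k') s3" "k' \<le> tau" "rep s3 fs \<S>'"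
      using reach_wp[OF wp_body_last[OF 2(2) enum.prems(2)] dep[OF 2(2)] tau] enum.prems(1) True by blast
    have "paced max_gap (gap_in d) (b @ Done # ticks k) [S] (gap_loop d)"
      using 1(2-4) True by (intro paced_item_only) (auto simp: gap_in_def max_gap_def gap_loop_def algebra_simps)
    moreover have "paced max_gap (gap_loop d + 2 * n * tau) (ticks k') [] (gap_out d)"
      using 3(2) True by (intro paced_ticks_only) (auto simp: gap_out_def gap_loop_def algebra_simps)
    ultimately have "paced max_gap (gap_in d) ((b @ Done # ticks k) @ tr @ ticks k') ([S] @ out @ []) (gap_out d)"
      using 2(3) by (intro paced_append[where ?g1.0 = "gap_loop d" and ?g2.0 = "gap_loop d"]
        paced_append[where ?g1.0 = "gap_loop d + 2 * n * tau" and ?g2.0 = "gap_loop d + 2 * n * tau"]) auto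
    moreover have "reach s ((b @ Done # ticks k) @ tr @ ticks k') s3"
      by (rule reach_trans[OF 1(1) reach_trans[OF 2(1) 3(1)]])
    ultimately show ?thesis using 3(3) True by (auto intro!: exI)
  next
    case False
    obtain k s1 where 1: "reach s (ticks k) s1" "k \<le> tau" "rep s1 ((S, 2) # fs) (insert S \<S>)"
      using reach_wp[OF wp_body_first[OF enum.prems(3,2)] dep[OF enum.prems(3)] tau]
        enum.prems(1) False by blast
    have "rep s1 ((S, 0 + 2) # fs) (insert S \<S>)" using 1(3) by (simp only: add_0)
    then obtain tr s2 where 2: "reach s1 tr s2" "rep s2 ((S, 2 * n + 2) # fs) \<S>'"
      "paced max_gap (gap_loop d + 0 * tau) tr out (gap_loop d + 2 * n * tau)"
      using enum.hyps(2)[OF enum.prems(1,2) le0 drop_0[symmetric]] by blast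
    obtain b k' s3 where 3: "reach s2 (b @ Done # ticks k') s3" "length b + 1 + k' \<le> tau" "Done \<notin> set b"
      "{v. Out v \<in> set b} = S" "rep s3 fs \<S>'"
      using reach_wp_out[OF wp_out_body_last[OF 2(2) enum.prems(2)] dep[OF 2(2)] tau] enum.prems(1) False by blast
    have "paced max_gap (gap_in d) (ticks k) [] (gap_loop d)"
      using 1(2) False by (intro paced_ticks_only) (auto simp: gap_in_def gap_loop_def algebra_simps)
    moreover have "paced max_gap (gap_loop d + 2 * n * tau) (b @ Done # ticks k') [S] (gap_out d)"
      using 3(2-4) False by (intro paced_item_only) (auto simp: gap_out_def max_gap_def gap_loop_def algebra_simps)
    ultimately have "paced max_gap (gap_in d) (ticks k @ tr @ (b @ Done # ticks k')) ([] @ out @ [S]) (gap_out d)"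
      using 2(3) by (intro paced_append[where ?g1.0 = "gap_loop d" and ?g2.0 = "gap_loop d"]
        paced_append[where ?g1.0 = "gap_loop d + 2 * n * tau" and ?g2.0 = "gap_loop d + 2 * n * tau"]) auto
    moreover have "reach s (ticks k @ tr @ (b @ Done # ticks k')) s3"
      by (rule reach_trans[OF 1(1) reach_trans[OF 2(1) 3(1)]])
    ultimately show ?thesis using 3(5) False by (auto intro!: exI)
  qed
next
  case (loop_Nil d \<S>)
  then have "p = 2 * n" by (auto simp: nbs_def)
  then show ?case using loop_Nil reach_refl paced_Nil by blast
next
  case (loop_old S' \<S> d Ns \<S>' out)
  have p: "p < 2 * n" "S' = nb B p" "Ns = drop (Suc p) (nbs B)"
    using drop_eq_Cons[OF loop_old.prems(4)] by (auto simp: nbs_def)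
  have dep: "regs s rDep \<noteq> 0" using loop_old.prems(5) by (simp add: rep_def)
  have tau: "2 \<le> tau" by (simp add: tau_def)
  have "wp body_prog (tau - 2) (\<lambda>_ s'. rep s' ((B, Suc p + 2) # fs) \<S>) s"
    using wp_body_proc[OF loop_old.prems(5,2)] p loop_old.hyps(1) by simp
  then obtain k s1 where 1: "reach s (ticks k) s1" "k \<le> tau" "rep s1 ((B, Suc p + 2) # fs) \<S>"
    using reach_wp[OF _ dep tau] by blast
  obtain tr s2 where 2: "reach s1 tr s2" "rep s2 ((B, 2 * n + 2) # fs) \<S>'"
    "paced max_gap (gap_loop d + Suc p * tau) tr out (gap_loop d + 2 * n * tau)"
    using loop_old.hyps(3)[OF loop_old.prems(1,2) _ p(3) 1(3)] p(1) by auto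
  have "paced max_gap (gap_loop d + p * tau) (ticks k) [] (gap_loop d + Suc p * tau)"
    using 1(2) by (intro paced_ticks_only) simp
  then have "paced max_gap (gap_loop d + p * tau) (ticks k @ tr) out (gap_loop d + 2 * n * tau)"
    using paced_append[OF _ order_refl 2(3)] by fastforce
  then show ?case using reach_trans[OF 1(1) 2(1)] 2(2) by blast
next
  case (loop_new S' \<S> d \<S>1 out1 Ns \<S>2 out2)
  have p: "p < 2 * n" "S' = nb B p" "Ns = drop (Suc p) (nbs B)"
    using drop_eq_Cons[OF loop_new.prems(4)] by (auto simp: nbs_def)
  have "S' \<in> set (nbs B)" using p by (auto simp: nbs_def)
  then have S': "S' \<in> max_conn_bip G"
    using set_nbs neighbors_maximal[OF comp_spec_saturate loop_new.prems(2)] by auto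
  have dep: "regs s rDep \<noteq> 0" using loop_new.prems(5) by (simp add: rep_def)
  have tau: "2 \<le> tau" by (simp add: tau_def)
  have "wp body_prog (tau - 2) (\<lambda>_ s'. rep s' ((S', 0) # (B, Suc p + 2) # fs) (insert S' \<S>)) s"
    using wp_body_proc[OF loop_new.prems(5,2)] p loop_new.hyps(1) by simp
  then obtain k s1 where 1: "reach s (ticks k) s1" "k \<le> tau" "rep s1 ((S', 0) # (B, Suc p + 2) # fs) (insert S' \<S>)"
    using reach_wp[OF _ dep tau] by blast
  obtain tr1 s2 where 2: "reach s1 tr1 s2" "rep s2 ((B, Suc p + 2) # fs) \<S>1"
    "paced max_gap (gap_in (Suc d)) tr1 out1 (gap_out (Suc d))"
    using loop_new.hyps(3)[OF _ S' 1(3)] loop_new.prems(1) by auto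
  obtain tr2 s3 where 3: "reach s2 tr2 s3" "rep s3 ((B, 2 * n + 2) # fs) \<S>2"
    "paced max_gap (gap_loop d + Suc p * tau) tr2 out2 (gap_loop d + 2 * n * tau)"
    using loop_new.hyps(5)[OF loop_new.prems(1,2) _ p(3) 2(2)] p(1) by auto
  have "gap_out (Suc d) \<le> gap_loop d + Suc p * tau" using gap_return[of d] by simp
  then have "paced max_gap (gap_in (Suc d)) (tr1 @ tr2) (out1 @ out2) (gap_loop d + 2 * n * tau)"
    using paced_append[OF 2(3) _ 3(3)] by simp
  moreover have "paced max_gap (gap_loop d + p * tau) (ticks k) [] (gap_in (Suc d))"
    using 1(2) gap_call[OF p(1), of d] by (intro paced_ticks_only) simp
  ultimately have "paced max_gap (gap_loop d + p * tau) (ticks k @ tr1 @ tr2) ([] @ out1 @ out2) (gap_loop d + 2 * n * tau)"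
    using paced_append[OF _ order_refl] by blast
  then show ?case using reach_trans[OF 1(1) reach_trans[OF 2(1) 3(1)]] 3(2) by auto
qed

lemma rep_initial:
  assumes "0 < n"
  shows "rep ((input adj)\<lparr>regs := (regs (input adj))(rFresh := 1)\<rparr>) [] {}"
proof -
  let ?s = "(input adj)\<lparr>regs := (regs (input adj))(rFresh := 1)\<rparr>"
  have "trie ?s [[]]" by (simp add: trie_def input_def)
  \<comment> \<open>With \<open>n = 0\<close> the root would be a word of full length and the empty
    set would count as found.\<close>
  moreover have "sols n [[]] = {}" using assms by (auto simp: sols_def word_def)
  ultimately show ?thesis
    unfolding rep_def by (auto simp: has_input_def input_def intro!: exI[of _ "[[]]"])
qed

lemma main_prog_correct:
  assumes "0 < n"
  obtains S0 out tr s' where "S0 \<in> max_conn_bip G" "exec main_prog (input adj) tr s'"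
    "alg_outputs nbs S0 out" "outputs tr = out" "delay tr \<le> max_gap"
proof -
  let ?s = "(input adj)\<lparr>regs := (regs (input adj))(rFresh := 1)\<rparr>"
  have v0: "0 \<in> pverts G" using assms verts_eq by simp
  define S0 where "S0 = saturate (cc G 0 (insert 0 {}))"
  have cb: "conn_bip G {0}" by (rule conn_bip_singleton[OF v0])
  have "cc G 0 (insert 0 {}) = {0}" using cc_con[of "{0}" 0] cb by (simp add: conn_bip_def)
  then have S0: "S0 \<in> max_conn_bip G" using comp_maximal(1)[OF comp_spec_saturate cb] by (simp add: S0_def)
  have adm: "admissible G saturate nbs S0"
    unfolding admissible_def using comp_spec_saturate set_nbs S0 by simp
  obtain out \<S>' where out: "enum nbs 0 S0 {} \<S>' out" "alg_outputs nbs S0 out"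
    using alg_correct(1)[OF adm] by (auto simp: alg_outputs_def)
  have "wp explore_prog (800 * (1 + sz)) (\<lambda>_ s'. if S0 \<in> {} then rep s' [] {} else rep s' [(S0, 0)] (insert S0 {})) ?s"
    unfolding S0_def
  proof (rule wp_explore_prog[OF rep_initial[OF assms]])
    show "flags n (mem ?s aAl) {}" by (simp add: flags_def input_def)
    show "regs ?s rX = 0" by (simp add: input_def)
    show "bipartite (with_proj G \<restriction> insert 0 {})" using cb by (simp add: conn_bip_def)
  qed (use assms in simp_all)
  then obtain k s1 where 1: "exec explore_prog ?s (ticks k) s1" "k \<le> 800 * (1 + sz)" "rep s1 [(S0, 0)] (insert S0 {})"
    unfolding wp_def by auto
  obtain tr s2 where 2: "reach s1 tr s2" "rep s2 [] \<S>'" "paced max_gap (gap_in 0) tr out (gap_out 0)"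
    using simulate(1)[OF out(1) _ S0 1(3)] by auto
  have "exec (While (Reg rDep) body_prog) s2 (ticks (Suc (cost (Reg rDep)))) s2"
    using 2(2) by (intro exec.intros) (simp add: rep_def)
  then have "exec (While (Reg rDep) body_prog) s1 (tr @ ticks 2) s2"
    using 2(1) by (simp add: reach_def numeral_2_eq_2)
  moreover have "exec (Assign rFresh (Const 1)) (input adj) (ticks 2) ?s"
    using exec.intros(2)[of rFresh "Const 1" "input adj"] by (simp add: numeral_2_eq_2)
  ultimately have ex: "exec main_prog (input adj) (ticks 2 @ ticks k @ tr @ ticks 2) s2"
    unfolding main_prog_def using 1(1) exec.intros(6) by blast
  have "2 + k \<le> tau" using 1(2) by (simp add: tau_def)
  then have "2 + k \<le> gap_in 0" by (simp add: gap_in_def)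
  then have "paced max_gap 0 (ticks (2 + k)) [] (gap_in 0)" by (intro paced_ticks_only) simp
  moreover have "2 \<le> tau" by (simp add: tau_def)
  \<comment> \<open>The 2 accounts for the final test of the main loop, which belongs to the last
    period.\<close>
  then have fin: "gap_out 0 + 2 \<le> max_gap" by (simp add: gap_out_def max_gap_def algebra_simps)
  have "paced max_gap (gap_in 0) (tr @ ticks 2) (out @ []) max_gap"
    using paced_append[OF 2(3) order_refl paced_ticks_only[OF fin]] .
  ultimately have "paced max_gap 0 (ticks (2 + k) @ tr @ ticks 2) ([] @ out @ []) max_gap"
    using paced_append[OF _ order_refl] by blast
  then have "paced max_gap 0 (ticks 2 @ ticks k @ tr @ ticks 2) out max_gap"
    by (simp only: replicate_add append_assoc append_Nil append_Nil2)
  from paced_delay[OF this order_refl] show thesis using that[OF S0 ex out(2)] by simp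
qed

text \<open>Handshake count: the list entries correspond to the arcs, and at most two arcs have the
  same edge as their set of ends.\<close>

lemma length_concat_adj: "length (concat adj) \<le> 2 * card (edges G)"
proof -
  have "length (concat adj) = (\<Sum>v<n. length (adj ! v))"
    by (simp add: length_concat sum_list_sum_nth atLeast0LessThan)
  also have "\<dots> = (\<Sum>v<n. card (nbhd G v))"
  proof (rule sum.cong)
    fix v assume "v \<in> {..<n}"
    then have "distinct (adj ! v)" "set (adj ! v) = nbhd G v"
      using adj by (simp_all add: adjacency_lists_def)
    then show "length (adj ! v) = card (nbhd G v)" using distinct_card by metis
  qed simp
  also have "\<dots> = card (SIGMA v:{..<n}. nbhd G v)"
    using finite_subset[of "nbhd G _" "{..<n}"] nbhd_less by (subst card_SigmaI) auto
  also have "\<dots> = card (parcs G)"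
    using in_arcsD1 verts_eq by (intro arg_cong[where f = card]) (auto simp: nbhd_def)
  also have "\<dots> \<le> card (\<Union>e\<in>edges G. {(u, v). (u, v) \<in> parcs G \<and> e = {u, v}})"
  proof (rule card_mono)
    show "finite (\<Union>e\<in>edges G. {(u, v). (u, v) \<in> parcs G \<and> e = {u, v}})"
      by (rule finite_subset[OF _ pair_finite_arcs]) auto
  qed (auto simp: edges_def)
  also have "\<dots> \<le> (\<Sum>e\<in>edges G. card {(u, v). (u, v) \<in> parcs G \<and> e = {u, v}})"
  proof (rule card_UN_le)
    have "edges G = (\<lambda>(u, v). {u, v}) ` parcs G" by (auto simp: edges_def)
    then show "finite (edges G)" using pair_finite_arcs by simp
  qed
  also have "\<dots> \<le> (\<Sum>e\<in>edges G. 2)"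
  proof (rule sum_mono)
    fix e assume "e \<in> edges G"
    then obtain u v where e: "e = {u, v}" by (auto simp: edges_def)
    have "{(x, y). (x, y) \<in> parcs G \<and> e = {x, y}} \<subseteq> {(u, v), (v, u)}"
      unfolding e by (auto simp: doubleton_eq_iff)
    then have "card {(x, y). (x, y) \<in> parcs G \<and> e = {x, y}} \<le> card {(u, v), (v, u)}"
      by (intro card_mono) auto
    also have "\<dots> \<le> 2" by (rule card_insert_le_m1) simp_all
    finally show "card {(x, y). (x, y) \<in> parcs G \<and> e = {x, y}} \<le> 2" .
  qed
  finally show ?thesis by simp
qed

text \<open>Without isolated vertices \<open>n\<close> is at most twice the number \<open>m\<close>
  of edges, so \<open>1 + sz\<close> is at most \<open>5 * m\<close>. Together with
  \<open>4 * n + 4 \<le> 8 * n\<close> this gives the constant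
  \<open>8 * 1500 * 5 = 60000\<close>.\<close>

lemma max_gap_le:
  assumes "0 < n" "\<forall>v\<in>pverts G. nbhd G v \<noteq> {}"
  shows "max_gap \<le> 60000 * (card (pverts G) * card (edges G))"
proof -
  let ?m = "card (edges G)"
  have "(\<Sum>v<n. 1) \<le> (\<Sum>v<n. length (adj ! v))"
  proof (rule sum_mono)
    fix v assume "v \<in> {..<n}"
    then have "set (adj ! v) \<noteq> {}" using assms(2) adj_nbhd verts_eq by simp
    then show "1 \<le> length (adj ! v)" by (simp add: Suc_le_eq)
  qed
  then have "n \<le> length (concat adj)"
    by (simp add: length_concat sum_list_sum_nth atLeast0LessThan)
  then have "n \<le> 2 * ?m" "sz \<le> 4 * ?m" using length_concat_adj by (simp_all add: sz_def)
  then have "1 + sz \<le> 5 * ?m" "4 * n + 4 \<le> 8 * n" using assms(1) by linarith+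
  then have "(4 * n + 4) * (1500 * (1 + sz)) \<le> (8 * n) * (1500 * (5 * ?m))"
    by (intro mult_mono) simp_all
  then show ?thesis by (simp add: max_gap_def tau_def verts_eq)
qed

end

theorem theorem5p4:
  shows
    "(\<forall>(G :: ngraph) n cmp nbs S0.
        pair_graph G \<and> pverts G = {..<n} \<and> admissible G cmp nbs S0 \<longrightarrow>
          (\<exists>out. alg_outputs nbs S0 out) \<and>
          (\<forall>out. alg_outputs nbs S0 out \<longrightarrow> distinct out \<and> set out = max_conn_bip G)) \<and>
     (\<exists>(P :: prog) (C :: nat). \<forall>(G :: ngraph) adj.
        pair_graph G \<and> pverts G \<noteq> {} \<and> adjacency_lists G adj \<longrightarrow>
          (\<exists>cmp nbs S0 tr s'.
             admissible G cmp nbs S0 \<and>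
             exec P (input adj) tr s' \<and>
             alg_outputs nbs S0 (outputs tr) \<and>
             ((\<forall>v \<in> pverts G. nbhd G v \<noteq> {}) \<longrightarrow>
                delay tr \<le> C * (card (pverts G) * card (edges G)))))"
proof (intro conjI)
  show "\<forall>(G :: ngraph) n cmp nbs S0.
      pair_graph G \<and> pverts G = {..<n} \<and> admissible G cmp nbs S0 \<longrightarrow>
        (\<exists>out. alg_outputs nbs S0 out) \<and>
        (\<forall>out. alg_outputs nbs S0 out \<longrightarrow> distinct out \<and> set out = max_conn_bip G)"
  proof (intro allI impI, elim conjE)
    fix G :: ngraph and cmp nbs S0
    assume "pair_graph G" and adm: "admissible G cmp nbs S0"
    then interpret labelled_graph G by (simp add: labelled_graph_def)
    show "(\<exists>out. alg_outputs nbs S0 out) \<and>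
        (\<forall>out. alg_outputs nbs S0 out \<longrightarrow> distinct out \<and> set out = max_conn_bip G)"
      using alg_correct[OF adm] by blast
  qed
  show "\<exists>(P :: prog) (C :: nat). \<forall>(G :: ngraph) adj.
      pair_graph G \<and> pverts G \<noteq> {} \<and> adjacency_lists G adj \<longrightarrow>
        (\<exists>cmp nbs S0 tr s'. admissible G cmp nbs S0 \<and> exec P (input adj) tr s' \<and>
           alg_outputs nbs S0 (outputs tr) \<and>
           ((\<forall>v \<in> pverts G. nbhd G v \<noteq> {}) \<longrightarrow>
              delay tr \<le> C * (card (pverts G) * card (edges G))))"
  proof (intro exI[of _ main_prog] exI[of _ 60000] allI impI, elim conjE)
    fix G :: ngraph and adj
    assume "pair_graph G" "pverts G \<noteq> {}" "adjacency_lists G adj"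
    then interpret adj_graph G adj
      by (simp add: adj_graph_def labelled_graph_def adj_graph_axioms_def)
    have n: "0 < n" using \<open>pverts G \<noteq> {}\<close> verts_eq by (auto simp: lessThan_empty_iff)
    obtain S0 out tr s' where o: "S0 \<in> max_conn_bip G" "exec main_prog (input adj) tr s'"
      "alg_outputs nbs S0 out" "outputs tr = out" "delay tr \<le> max_gap"
      by (rule main_prog_correct[OF n])
    have "admissible G saturate nbs S0"
      unfolding admissible_def using comp_spec_saturate set_nbs o(1) by simp
    moreover have "delay tr \<le> 60000 * (card (pverts G) * card (edges G))"
      if "\<forall>v\<in>pverts G. nbhd G v \<noteq> {}"
      using o(5) max_gap_le[OF n that] by (rule le_trans)
    ultimately show "\<exists>cmp nbs S0 tr s'. admissible G cmp nbs S0 \<and> exec main_prog (input adj) tr s' \<and>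
        alg_outputs nbs S0 (outputs tr) \<and>
        ((\<forall>v \<in> pverts G. nbhd G v \<noteq> {}) \<longrightarrow>
           delay tr \<le> 60000 * (card (pverts G) * card (edges G)))"
      using o(2-4) by (intro exI[of _ saturate] exI[of _ nbs] exI[of _ S0] exI[of _ tr] exI[of _ s']) simp
  qed
qed


end
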